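(* Let $p\in[2,\infty)$ and $\varrho\in(0,1]$. Then $$e^{(p)}_n(F^{\varrho},\delta)=\Theta\bigl(\max\{n^{-(\varrho+1/2)},\delta\}\bigr)\quad\text{as } n\to\infty \text{ and } \delta\to0+ .$$ The optimal algorithm is the randomized two-stage Runge-Kutta algorithm $\bar l$; that is, $\bar l$ run with $\lfloor n/2\rfloor$ steps (hence using at most $n$ noisy evaluations of $f$) has worst-case error $e^{(p)}(\bar l,F^{\varrho},\delta)=\Theta\bigl(\max\{n^{-(\varrho+1/2)},\delta\}\bigr)$ as $n\to\infty$ and $\delta\to0+$, so it asymptotically attains the infimum defining $e^{(p)}_n(F^{\varrho},\delta)$.
   Context: Setting: $-\infty<a<b<\infty$, $d\in\mathbb{N}$, $K,L\in(0,\infty)$, $\varrho\in(0,1]$. On $\mathbb{R}^d$, $\|x\|=\sum_{k=1}^d|x_k|$, and $B(x,r)=\{y\in\mathbb{R}^d:\|y-x\|\le r\}$. $(\Omega,\Sigma,\mathbb{P})$ is a complete probability space carrying an i.i.d. sequence $(\tau_j)_{j\in\mathbb{N}}$ of random variables uniformly distributed on $[0,1]$; for a real random variable $X$, $\|X\|_p=(\mathbb{E}|X|^p)^{1/p}$. Put $$\bar R=\max\Bigl\{K(1+b-a)\bigl(1+e^{K(b-a)}(1+K(b-a))\bigr),\ K+(b-a)(1+K)+\bigl(\tfrac1K+1\bigr)(1+K(b-a))\bigl(e^{K(b-a)(1+K(b-a))}(1+K)-1\bigr)\Bigr\}.$$ The class $F^{\varrho}=F^{\varrho}(K,L)$ consists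 of all pairs $(\eta,f)$ with $\eta\in\mathbb{R}^d$, $f:[a,b]\times\mathbb{R}^d\to\mathbb{R}^d$ such that: $\|\eta\|\le K$; $f$ is continuous on $[a,b]\times\mathbb{R}^d$; $\|f(t,x)\|\le K(1+\|x\|)$ for all $(t,x)\in[a,b]\times\mathbb{R}^d$; $\|f(t,x)-f(s,x)\|\le L|t-s|^{\varrho}$ for all $t,s\in[a,b]$, $x\in B(\eta,\bar R)$; $\|f(t,x)-f(t,y)\|\le L\|x-y\|$ for all $t\in[a,b]$, $x,y\in B(\eta,\bar R)$. For $(\eta,f)\in F^{\varrho}$ the initial value problem $z'(t)=f(t,z(t))$, $z(a)=\eta$ has a unique solution on $[a,b]$, denoted $z(\eta,f)$. Noisy data: for $\delta\in[0,1]$, $V_{(\eta,f)}(\delta)$ is the set of pairs $(\tilde\eta,\tilde f)$ with $\tilde\eta\in B(\eta,\delta)$ and $\tilde f=f+\tilde\delta_f$, where $\tilde\delta_f:[a,b]\times\mathbb{R}^d\to\mathbb{R}^d$ is Borel measurable and $\|\tilde\delta_f(t,y)\|\le\delta$ for all $(t,y)$. Algorithms: an algorithm is specified by $i\in\mathbb{N}$, points $t_0,\dots,t_{i-1}\in[a,b]$, a random vector $(\theta_0,\dots,\theta_{i-1})$ on $(\Omega,\Sigma,\mathbb{P})$ with values in $[a,b]^i$, Borel measurable mappings $\psi_j:\mathbb{R}^{(2j+1)d}\to\mathbb{R}^d\times\mathbb{R}^d$, $j\in\{0,\dots,i-1\}$, and a Borel measurable $\varphi:\mathbb{R}^{(2i+1)d}\to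 D([a,b];\mathbb{R}^d)$, where $D([a,b];\mathbb{R}^d)$ is the Skorokhod space of càdlàg functions with its Borel $\sigma$-field (which coincides with the one generated by the coordinate maps). The evaluation points are given by $$(y_0,z_0)=\psi_0(\tilde\eta),\qquad (y_j,z_j)=\psi_j\bigl(\tilde f(t_0,y_0),\dots,\tilde f(t_{j-1},y_{j-1}),\tilde f(\theta_0,z_0),\dots,\tilde f(\theta_{j-1},z_{j-1}),\tilde\eta\bigr),\quad j\in\{1,\dots,i-1\}.$$ The noisy information is $$\mathcal{N}(\tilde\eta,\tilde f)=[\tilde f(t_0,y_0),\dots,\tilde f(t_{i-1},y_{i-1}),\tilde f(\theta_0,z_0),\dots,\tilde f(\theta_{i-1},z_{i-1}),\tilde\eta],$$ which uses $l=2i$ noisy evaluations of $f$, and the output is $\mathcal{A}(\tilde\eta,\tilde f,\delta)=\varphi(\mathcal{N}(\tilde\eta,\tilde f))$. $\Phi_n$ denotes the class of all algorithms of this form with $l\le n$. Errors: the error of an algorithm $\mathcal{A}$ at $(\eta,f)\in F^{\varrho}$ is $$e^{(p)}(\mathcal{A},\eta,f,\delta)=\sup_{(\tilde\eta,\tilde f)\in V_{(\eta,f)}(\delta)}\Bigl\|\sup_{a\le t\le b}\|z(\eta,f)(t)-\mathcal{A}(\tilde\eta,\tilde f,\delta)(t)\|\Bigr\|_p,$$ its worst-case error is $e^{(p)}(\mathcal{A},F^{\varrho},\delta)=\sup_{(\eta,f)\in F^{\varrho}}e^{(p)}(\mathcal{A},\eta,f,\delta)$, and the $n$th minimal error is $e^{(p)}_n(F^{\varrho},\delta)=\inf_{\mathcal{A}\in\Phi_n}e^{(p)}(\mathcal{A},F^{\varrho},\delta)$.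 An algorithm for which this infimum is asymptotically attained is called optimal. Asymptotic notation: $g(n,\delta)=\Theta(m(n,\delta))$ as $n\to\infty$, $\delta\to0+$ means that there are constants $c_1,c_2>0$, $n_0\in\mathbb{N}$, $\delta_0\in(0,1]$ depending only on $a,b,d,\varrho,K,L,p$ with $c_1m(n,\delta)\le g(n,\delta)\le c_2m(n,\delta)$ for all $n\ge n_0$, $\delta\in(0,\delta_0]$. Randomized two-stage Runge-Kutta algorithm $\bar l$ with $N$ steps: $h=(b-a)/N$, $t_j=a+jh$ for $j=0,\dots,N$, $\theta_j=t_{j-1}+\tau_jh$, $\bar V^0=\tilde\eta$ and, for $j=1,\dots,N$, $$\bar V^j_\tau=\bar V^{j-1}+h\tau_j\tilde f(t_{j-1},\bar V^{j-1}),\qquad \bar V^j=\bar V^{j-1}+h\tilde f(\theta_j,\bar V^j_\tau);$$ $\bar l(t)=\frac{\bar V^{j+1}-\bar V^j}{t_{j+1}-t_j}(t-t_j)+\bar V^j$ for $t\in[t_j,t_{j+1}]$, $j=0,\dots,N-1$. It uses $2N$ noisy evaluations of $f$.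
   Formalization: In Φ_n the map producing z_j may also use the current value f~(t_j,y_j) and θ_j; as defined, Φ_n does not contain l̄, and its algorithms are deterministic on autonomous f, which forces e_n ≥ c/n and refutes the claimed rate for ϱ > 1/2. *)

theory Defs
  imports "HOL-Probability.Probability"
begin

section \<open>Initial value problems\<close>

text \<open>Vectors of \<open>\<real>\<^sup>d\<close> are elements of \<open>real ^ 'd\<close>, with \<open>d = CARD('d)\<close>. The library norm on this type
  is Euclidean; all quantitative conditions use the \<open>\<ell>\<^sup>1\<close> norm below.\<close>

definition norm1 :: "real ^ 'd \<Rightarrow> real" where
  "norm1 x = (\<Sum>k\<in>UNIV. \<bar>x $ k\<bar>)"

definition ball1 :: "real ^ 'd \<Rightarrow> real \<Rightarrow> (real ^ 'd) set" where
  "ball1 x r = {y. norm1 (y - x) \<le> r}"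

text \<open>Right-hand sides are total functions; only their values on \<open>[a,b] \<times> \<real>\<^sup>d\<close> are constrained.\<close>

type_synonym 'd rhs = "real \<times> (real ^ 'd) \<Rightarrow> real ^ 'd"

definition Rbar :: "real \<Rightarrow> real \<Rightarrow> real \<Rightarrow> real" where
  "Rbar a b K = max
     (K * (1 + b - a) * (1 + exp (K * (b - a)) * (1 + K * (b - a))))
     (K + (b - a) * (1 + K)
        + (1 / K + 1) * (1 + K * (b - a))
            * (exp (K * (b - a) * (1 + K * (b - a))) * (1 + K) - 1))"

definition F_class ::
  "real \<Rightarrow> real \<Rightarrow> real \<Rightarrow> real \<Rightarrow> real \<Rightarrow> ((real ^ 'd) \<times> 'd rhs) set" where
  "F_class a b K L \<rho> = {(\<eta>, f).
     norm1 \<eta> \<le> K \<and>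
     continuous_on ({a..b} \<times> UNIV) f \<and>
     (\<forall>t\<in>{a..b}. \<forall>x. norm1 (f (t, x)) \<le> K * (1 + norm1 x)) \<and>
     (\<forall>t\<in>{a..b}. \<forall>s\<in>{a..b}. \<forall>x\<in>ball1 \<eta> (Rbar a b K).
        norm1 (f (t, x) - f (s, x)) \<le> L * \<bar>t - s\<bar> powr \<rho>) \<and>
     (\<forall>t\<in>{a..b}. \<forall>x\<in>ball1 \<eta> (Rbar a b K). \<forall>y\<in>ball1 \<eta> (Rbar a b K).
        norm1 (f (t, x) - f (t, y)) \<le> L * norm1 (x - y))}"

text \<open>The solution on \<open>[a,b]\<close>; extensionality makes it unique as a total function.\<close>

definition ivp_solution :: "real \<Rightarrow> real \<Rightarrow> real ^ 'd \<Rightarrow> 'd rhs \<Rightarrow> real \<Rightarrow> real ^ 'd" where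
  "ivp_solution a b \<eta> f = (THE z. z \<in> extensional {a..b} \<and> z a = \<eta> \<and>
     (\<forall>t\<in>{a..b}. (z has_vector_derivative f (t, z t)) (at t within {a..b})))"

definition noisy_data ::
  "real \<Rightarrow> real \<Rightarrow> real ^ 'd \<Rightarrow> 'd rhs \<Rightarrow> real \<Rightarrow> ((real ^ 'd) \<times> 'd rhs) set" where
  "noisy_data a b \<eta> f \<delta> = {(\<eta>', f'). \<eta>' \<in> ball1 \<eta> \<delta> \<and>
     (\<exists>\<Delta>. \<Delta> \<in> borel_measurable (restrict_space borel ({a..b} \<times> UNIV)) \<and>
          (\<forall>t\<in>{a..b}. \<forall>y. norm1 (\<Delta> (t, y)) \<le> \<delta>) \<and>
          f' = (\<lambda>u. f u + \<Delta> u))}"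


section \<open>The Skorokhod space\<close>

definition cadlag :: "real \<Rightarrow> real \<Rightarrow> (real \<Rightarrow> real ^ 'd) set" where
  "cadlag a b = {x \<in> extensional {a..b}.
     (\<forall>t\<in>{a..<b}. (x \<longlongrightarrow> x t) (at_right t)) \<and>
     (\<forall>t\<in>{a<..b}. \<exists>l. (x \<longlongrightarrow> l) (at_left t))}"

definition time_changes :: "real \<Rightarrow> real \<Rightarrow> (real \<Rightarrow> real) set" where
  "time_changes a b =
     {l. strict_mono_on {a..b} l \<and> continuous_on {a..b} l \<and> l ` {a..b} = {a..b}}"

definition skorokhod_dist ::
  "real \<Rightarrow> real \<Rightarrow> (real \<Rightarrow> real ^ 'd) \<Rightarrow> (real \<Rightarrow> real ^ 'd) \<Rightarrow> ennreal" where
  "skorokhod_dist a b x y = (INF l\<in>time_changes a b.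
     max (SUP t\<in>{a..b}. ennreal \<bar>l t - t\<bar>)
         (SUP t\<in>{a..b}. ennreal (norm1 (x (l t) - y t))))"

definition skorokhod_open :: "real \<Rightarrow> real \<Rightarrow> (real \<Rightarrow> real ^ 'd) set \<Rightarrow> bool" where
  "skorokhod_open a b U \<longleftrightarrow> U \<subseteq> cadlag a b \<and>
     (\<forall>x\<in>U. \<exists>\<epsilon>>0. \<forall>y\<in>cadlag a b. skorokhod_dist a b x y < \<epsilon> \<longrightarrow> y \<in> U)"

definition skorokhod_borel :: "real \<Rightarrow> real \<Rightarrow> (real \<Rightarrow> real ^ 'd) measure" where
  "skorokhod_borel a b = sigma (cadlag a b) {U. skorokhod_open a b U}"


section \<open>Algorithms using noisy information\<close>

text \<open>An element of \<open>\<real>\<^sup>m\<^sup>d\<close> is a function on \<open>{..<m}\<close> with values in \<open>\<real>\<^sup>d\<close>.\<close>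

abbreviation vec_space :: "nat \<Rightarrow> (nat \<Rightarrow> real ^ 'd) measure" where
  "vec_space m \<equiv> PiM {..<m} (\<lambda>_. borel)"

text \<open>The vector \<open>(u\<^sub>0, \<dots>, u\<^sub>j\<^sub>-\<^sub>1, v\<^sub>0, \<dots>, v\<^sub>j\<^sub>-\<^sub>1, e)\<close>.\<close>

definition info_vec ::
  "nat \<Rightarrow> (nat \<Rightarrow> real ^ 'd) \<Rightarrow> (nat \<Rightarrow> real ^ 'd) \<Rightarrow> real ^ 'd \<Rightarrow> nat \<Rightarrow> real ^ 'd" where
  "info_vec j u v e =
     (\<lambda>k\<in>{..<2 * j + 1}. if k < j then u k else if k < 2 * j then v (k - j) else e)"

text \<open>The mapping \<open>\<psi>\<^sub>j\<close> producing \<open>(y\<^sub>j, z\<^sub>j)\<close> is split into two components. Both receive the noisy values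
  from the stages before \<open>j\<close> and the noisy initial value. The component for \<open>z\<^sub>j\<close> receives in addition
  the current value of the right-hand side at \<open>(t\<^sub>j, y\<^sub>j)\<close> and the realization of \<open>\<theta>\<^sub>j\<close>. Without these two
  arguments the two-stage Runge-Kutta scheme, whose point \<open>z\<^sub>j\<close> is \<open>y\<^sub>j\<close> plus \<open>\<theta>\<^sub>j - t\<^sub>j\<close> times the current
  value, would not be an algorithm, and every algorithm would be deterministic on autonomous problems.
  A \<open>\<psi>\<^sub>j\<close> depending on the earlier noisy values alone is the special case of a \<open>z\<close>-component that
  ignores its last two arguments.\<close>

record ('w, 'd::finite) algorithm =
  stages :: nat
  fixed_time :: "nat \<Rightarrow> real"
  random_time :: "nat \<Rightarrow> 'w \<Rightarrow> real"
  psi_y :: "nat \<Rightarrow> (nat \<Rightarrow> real ^ 'd) \<Rightarrow> real ^ 'd"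
  psi_z :: "nat \<Rightarrow> (nat \<Rightarrow> real ^ 'd) \<times> (real ^ 'd) \<times> real \<Rightarrow> real ^ 'd"
  phi :: "(nat \<Rightarrow> real ^ 'd) \<Rightarrow> real \<Rightarrow> real ^ 'd"

definition algorithms ::
  "'w measure \<Rightarrow> real \<Rightarrow> real \<Rightarrow> nat \<Rightarrow> ('w, 'd::finite) algorithm set" where
  "algorithms M a b n = {A.
     0 < stages A \<and> 2 * stages A \<le> n \<and>
     (\<forall>j<stages A.
        fixed_time A j \<in> {a..b} \<and>
        random_time A j \<in> borel_measurable M \<and>
        (\<forall>\<omega>\<in>space M. random_time A j \<omega> \<in> {a..b}) \<and>
        psi_y A j \<in> vec_space (2 * j + 1) \<rightarrow>\<^sub>M borel \<and>
        psi_z A j \<in> vec_space (2 * j + 1) \<Otimes>\<^sub>M borel \<Otimes>\<^sub>M borel \<rightarrow>\<^sub>M borel) \<and>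
     phi A \<in> vec_space (2 * stages A + 1) \<rightarrow>\<^sub>M skorokhod_borel a b}"

text \<open>The noisy values at \<open>(t\<^sub>k, y\<^sub>k)\<close> and \<open>(\<theta>\<^sub>k, z\<^sub>k)\<close> for \<open>k < j\<close>, as a pair of sequences
  (entries with index at least \<open>j\<close> are never read).\<close>

primrec noisy_values ::
  "('w, 'd::finite) algorithm \<Rightarrow> real ^ 'd \<Rightarrow> 'd rhs \<Rightarrow> 'w \<Rightarrow> nat \<Rightarrow>
     (nat \<Rightarrow> real ^ 'd) \<times> (nat \<Rightarrow> real ^ 'd)" where
  "noisy_values A \<eta>' f' \<omega> 0 = (\<lambda>_. 0, \<lambda>_. 0)"
| "noisy_values A \<eta>' f' \<omega> (Suc j) =
     (let (u, v) = noisy_values A \<eta>' f' \<omega> j;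
          I = info_vec j u v \<eta>';
          y = psi_y A j I;
          w = f' (fixed_time A j, y);
          \<theta> = random_time A j \<omega>;
          z = psi_z A j (I, w, \<theta>)
      in (u(j := w), v(j := f' (\<theta>, z))))"

definition noisy_information ::
  "('w, 'd::finite) algorithm \<Rightarrow> real ^ 'd \<Rightarrow> 'd rhs \<Rightarrow> 'w \<Rightarrow> nat \<Rightarrow> real ^ 'd" where
  "noisy_information A \<eta>' f' \<omega> =
     (let (u, v) = noisy_values A \<eta>' f' \<omega> (stages A) in info_vec (stages A) u v \<eta>')"

definition run ::
  "('w, 'd::finite) algorithm \<Rightarrow> real ^ 'd \<Rightarrow> 'd rhs \<Rightarrow> 'w \<Rightarrow> real \<Rightarrow> real ^ 'd" where
  "run A \<eta>' f' \<omega> = phi A (noisy_information A \<eta>' f' \<omega>)"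


section \<open>Errors\<close>

definition ennreal_powr :: "ennreal \<Rightarrow> real \<Rightarrow> ennreal" where
  "ennreal_powr x q = (if x = \<top> then \<top> else ennreal (enn2real x powr q))"

definition Lp_norm :: "'w measure \<Rightarrow> real \<Rightarrow> ('w \<Rightarrow> ennreal) \<Rightarrow> ennreal" where
  "Lp_norm M p X = ennreal_powr (\<integral>\<^sup>+ \<omega>. ennreal_powr (X \<omega>) p \<partial>M) (1 / p)"

text \<open>The errors are functions of the output map \<open>out\<close> of a method, which sends noisy data and an
  elementary event to a function on \<open>[a,b]\<close>.\<close>

definition error_at ::
  "'w measure \<Rightarrow> real \<Rightarrow> real \<Rightarrow> real \<Rightarrow> (real ^ 'd \<Rightarrow> 'd rhs \<Rightarrow> 'w \<Rightarrow> real \<Rightarrow> real ^ 'd) \<Rightarrow>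
     real ^ 'd \<Rightarrow> 'd rhs \<Rightarrow> real \<Rightarrow> ennreal" where
  "error_at M a b p out \<eta> f \<delta> = (SUP (\<eta>', f')\<in>noisy_data a b \<eta> f \<delta>.
     Lp_norm M p (\<lambda>\<omega>. SUP t\<in>{a..b}. ennreal (norm1 (ivp_solution a b \<eta> f t - out \<eta>' f' \<omega> t))))"

definition worst_case_error ::
  "'w measure \<Rightarrow> real \<Rightarrow> real \<Rightarrow> real \<Rightarrow> (real ^ 'd \<Rightarrow> 'd rhs \<Rightarrow> 'w \<Rightarrow> real \<Rightarrow> real ^ 'd) \<Rightarrow>
     ((real ^ 'd) \<times> 'd rhs) set \<Rightarrow> real \<Rightarrow> ennreal" where
  "worst_case_error M a b p out F \<delta> = (SUP (\<eta>, f)\<in>F. error_at M a b p out \<eta> f \<delta>)"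

definition minimal_error ::
  "'w measure \<Rightarrow> real \<Rightarrow> real \<Rightarrow> real \<Rightarrow> ((real ^ 'd) \<times> 'd rhs) set \<Rightarrow> nat \<Rightarrow> real \<Rightarrow> ennreal" where
  "minimal_error M a b p F n \<delta> =
     (INF A\<in>algorithms M a b n. worst_case_error M a b p (run A) F \<delta>)"


section \<open>The randomized two-stage Runge-Kutta algorithm\<close>

definition rk_node :: "real \<Rightarrow> real \<Rightarrow> nat \<Rightarrow> nat \<Rightarrow> real" where
  "rk_node a b N j = a + real j * ((b - a) / real N)"

primrec rk_value ::
  "(nat \<Rightarrow> 'w \<Rightarrow> real) \<Rightarrow> real \<Rightarrow> real \<Rightarrow> nat \<Rightarrow> real ^ 'd \<Rightarrow> 'd rhs \<Rightarrow> 'w \<Rightarrow> nat \<Rightarrow> real ^ 'd" where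
  "rk_value \<tau> a b N \<eta>' f' \<omega> 0 = \<eta>'"
| "rk_value \<tau> a b N \<eta>' f' \<omega> (Suc j) =
     (let h = (b - a) / real N;
          V = rk_value \<tau> a b N \<eta>' f' \<omega> j;
          \<theta> = rk_node a b N j + \<tau> (Suc j) \<omega> * h;
          W = V + (h * \<tau> (Suc j) \<omega>) *\<^sub>R f' (rk_node a b N j, V)
      in V + h *\<^sub>R f' (\<theta>, W))"

text \<open>For \<open>t \<in> [a,b]\<close> the index \<open>j\<close> below is a \<open>j < N\<close> with \<open>t\<close> between nodes \<open>j\<close> and \<open>j + 1\<close>.\<close>

definition rk_output ::
  "(nat \<Rightarrow> 'w \<Rightarrow> real) \<Rightarrow> real \<Rightarrow> real \<Rightarrow> nat \<Rightarrow>
     real ^ 'd \<Rightarrow> 'd rhs \<Rightarrow> 'w \<Rightarrow> real \<Rightarrow> real ^ 'd" where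
  "rk_output \<tau> a b N \<eta>' f' \<omega> t =
     (let j = (LEAST j. t \<le> rk_node a b N (Suc j));
          V = rk_value \<tau> a b N \<eta>' f' \<omega>
      in ((t - rk_node a b N j) / (rk_node a b N (Suc j) - rk_node a b N j)) *\<^sub>R (V (Suc j) - V j)
           + V j)"


section \<open>Sources of randomness and asymptotics\<close>

definition random_sources :: "('w measure \<times> (nat \<Rightarrow> 'w \<Rightarrow> real)) set" where
  "random_sources = {(M, \<tau>). prob_space M \<and> complete_measure M \<and>
     prob_space.indep_vars M (\<lambda>_. borel) \<tau> {1..} \<and>
     (\<forall>j\<ge>1. distr M borel (\<tau> j) = uniform_measure lborel {0..1})}"

text \<open>\<open>g s n \<delta> = \<Theta>(m n \<delta>)\<close> as \<open>n \<rightarrow> \<infinity>\<close> and \<open>\<delta> \<rightarrow> 0+\<close>, with constants that do not depend on \<open>s \<in> S\<close>.\<close>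

definition uniform_Theta ::
  "'s set \<Rightarrow> ('s \<Rightarrow> nat \<Rightarrow> real \<Rightarrow> ennreal) \<Rightarrow> (nat \<Rightarrow> real \<Rightarrow> real) \<Rightarrow> bool" where
  "uniform_Theta S g m \<longleftrightarrow> (\<exists>c\<^sub>1>0. \<exists>c\<^sub>2>0. \<exists>n\<^sub>0. \<exists>\<delta>\<^sub>0\<in>{0<..1}.
     \<forall>s\<in>S. \<forall>n\<ge>n\<^sub>0. \<forall>\<delta>\<in>{0<..\<delta>\<^sub>0}.
       ennreal (c\<^sub>1 * m n \<delta>) \<le> g s n \<delta> \<and> g s n \<delta> \<le> ennreal (c\<^sub>2 * m n \<delta>))"

end

theory Submission
  imports Defs
begin

text \<open>Two facts carry the theorem: the Runge-Kutta method has an error of order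
  \<open>n\<^bsup>-(\<rho>+1/2)\<^esup> + \<delta>\<close>, and no algorithm does better. Since the method is itself an algorithm of the class
  (\<open>rk_algorithm_in_class\<close>, \<open>AE_run_rk_algorithm\<close>), its error dominates the minimal error, so an upper bound
  for the former and a lower bound for the latter give all the claims at once.

  Upper bound. Along the exact solution \<open>z\<close> the right-hand side is a function \<open>g t = f (t, z t)\<close> of time
  alone, and it is \<open>\<rho>\<close>-Hoelder (\<open>g_Hoelder\<close>). One step of the method replaces the integral of \<open>g\<close> over an
  interval of length \<open>h\<close> by \<open>h\<close> times the value of \<open>g\<close> at a uniformly distributed point of it. This
  quadrature error is of size \<open>h\<^bsup>1+\<rho>\<^esup>\<close>, but it has mean zero and is independent of the other steps, so
  that \<open>N\<close> of them add up to \<open>\<surd>N h\<^bsup>1+\<rho>\<^esup>\<close> only, of order \<open>N\<^bsup>-(\<rho>+1/2)\<^esup>\<close>. Everything else (the perturbation of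
  the arguments of \<open>f\<close>, the noise, the interpolation between the nodes) is treated path by path and is
  absorbed by a discrete Gronwall argument (\<open>rk_path_error\<close>); for this one needs that the exact solution
  and both stages of the method never leave the ball on which \<open>f\<close> is regular, which is what the radius
  \<open>Rbar\<close> is made for (\<open>env_le_Rbar\<close>, \<open>ball_bound\<close>). Because the supremum over time is inside the \<open>L\<^sup>p\<close> norm,
  the sum of the quadrature errors must be controlled uniformly over its partial sums. For bounded
  independent summands all moments of the maximal partial sum follow from Doob's \<open>L\<^sup>2\<close> inequality
  applied to the submartingale \<open>cosh (l S\<^sub>n)\<close>, together with Hoeffding's lemma (\<open>maximal_moment\<close>).

  Lower bound. If finitely many problems admit the same noisy data, or are not told apart by the
  information that an algorithm collects, then the output cannot be close to all the solutions, and
  this is seen by averaging the \<open>p\<close>-th powers of the errors over the family (\<open>worst_case_error_ge\<close>). Two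
  constant solutions at distance \<open>\<delta>\<close> share their data up to noise of level \<open>\<delta>\<close>, which gives the term
  \<open>\<delta>\<close> (\<open>noise_lower_bound\<close>). For the other term (\<open>sampling_lower_bound\<close>) the time interval is cut into \<open>2n\<close> cells,
  and the right-hand side is a function of time made of bumps of height about \<open>n\<^bsup>-\<rho>\<^esup>\<close> with arbitrary signs.
  For every elementary event at most \<open>n\<close> cells are sampled, so that \<open>n\<close> signs remain unknown; each
  contributes about \<open>n\<^bsup>-1-\<rho>\<^esup>\<close> to the solution at the endpoint, and on average over the signs their sum has
  size \<open>\<surd>n n\<^bsup>-1-\<rho>\<^esup>\<close>.\<close>

section \<open>The \<open>\<ell>\<^sup>1\<close> norm\<close>

lemma norm1_nonneg [simp]: "0 \<le> norm1 x"
  by (simp add: norm1_def sum_nonneg)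

lemma norm1_zero [simp]: "norm1 0 = 0"
  by (simp add: norm1_def)

lemma norm1_minus [simp]: "norm1 (- x) = norm1 x"
  by (simp add: norm1_def)

lemma norm1_minus_commute: "norm1 (x - y) = norm1 (y - x)"
  by (simp add: norm1_def abs_minus_commute)

lemma norm1_triangle: "norm1 (x + y) \<le> norm1 x + norm1 y"
  unfolding norm1_def sum.distrib[symmetric] by (intro sum_mono) (simp add: abs_triangle_ineq)

lemma norm1_triangle_diff: "norm1 (x - y) \<le> norm1 x + norm1 y"
  using norm1_triangle[of x "- y"] by simp

lemma norm1_triangle_mid: "norm1 (x - z) \<le> norm1 (x - y) + norm1 (y - z)"
  using norm1_triangle[of "x - y" "y - z"] by simp

lemma norm1_scaleR [simp]: "norm1 (c *\<^sub>R x) = \<bar>c\<bar> * norm1 x"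
  by (simp add: norm1_def abs_mult sum_distrib_left)

lemma norm1_sum: "norm1 (sum f A) \<le> (\<Sum>i\<in>A. norm1 (f i))"
proof (induction A rule: infinite_finite_induct)
  case (insert x F)
  then show ?case using norm1_triangle[of "f x" "sum f F"] by simp
qed simp_all

lemma component_le_norm1: "\<bar>x $ k\<bar> \<le> norm1 x"
  unfolding norm1_def by (rule member_le_sum) auto

lemma norm_le_norm1: "norm x \<le> norm1 x"
  unfolding norm1_def by (rule norm_le_l1_cart)

lemma norm1_le_norm: "norm1 (x :: real ^ 'd) \<le> real CARD('d) * norm x"
proof -
  have "norm1 x \<le> (\<Sum>k\<in>(UNIV :: 'd set). norm x)"
    unfolding norm1_def by (intro sum_mono) (rule component_le_norm_cart)
  then show ?thesis by simp
qed

lemma norm1_axis [simp]: "norm1 (axis k c :: real ^ 'd) = \<bar>c\<bar>"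
proof -
  have "norm1 (axis k c :: real ^ 'd) = (\<Sum>i\<in>UNIV. if i = k then \<bar>c\<bar> else 0)"
    unfolding norm1_def axis_def by (intro sum.cong) auto
  then show ?thesis by simp
qed

lemma continuous_on_norm1 [continuous_intros]:
  "continuous_on S g \<Longrightarrow> continuous_on S (\<lambda>x. norm1 (g x))"
  unfolding norm1_def by (intro continuous_intros)

lemma borel_measurable_norm1 [measurable]: "norm1 \<in> borel_measurable borel"
  by (intro borel_measurable_continuous_onI continuous_intros)

lemma tendsto_norm1 [tendsto_intros]:
  "(g \<longlongrightarrow> l) F \<Longrightarrow> ((\<lambda>x. norm1 (g x)) \<longlongrightarrow> norm1 l) F"
  unfolding norm1_def by (intro tendsto_intros)

text \<open>The dual description of the norm: it turns estimates of vector valued integrals and increments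
  into scalar ones without losing a factor depending on the dimension.\<close>

lemma norm1_dual: "\<exists>w. norm1 v = v \<bullet> w \<and> (\<forall>x. x \<bullet> w \<le> norm1 x)"
proof (intro exI conjI allI)
  let ?w = "\<chi> i. sgn (v $ i)"
  show "norm1 v = v \<bullet> ?w"
    by (simp add: norm1_def inner_vec_def abs_sgn)
  show "x \<bullet> ?w \<le> norm1 x" for x
    unfolding norm1_def inner_vec_def
    by (intro sum_mono) (auto simp: sgn_if abs_if)
qed

lemma norm1_integral_le:
  fixes g :: "real \<Rightarrow> real ^ 'd"
  assumes g: "continuous_on {s..t} g" and B: "continuous_on {s..t} B"
    and le: "\<And>u. u \<in> {s..t} \<Longrightarrow> norm1 (g u) \<le> B u"
  shows "norm1 (integral {s..t} g) \<le> integral {s..t} B"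
proof -
  obtain w where w: "norm1 (integral {s..t} g) = integral {s..t} g \<bullet> w" "\<And>x. x \<bullet> w \<le> norm1 x"
    using norm1_dual by blast
  have "integral {s..t} g \<bullet> w = integral {s..t} (\<lambda>u. g u \<bullet> w)"
    using integral_linear[OF integrable_continuous_real[OF g] bounded_linear_inner_left[of w]]
    by (simp add: o_def)
  also have "\<dots> \<le> integral {s..t} B"
    using w(2) le
    by (intro integral_le integrable_continuous_real continuous_intros g B) (meson order_trans)
  finally show ?thesis by (simp add: w(1))
qed

lemma norm1_increment_le:
  fixes g :: "real \<Rightarrow> real ^ 'd"
  assumes st: "s \<le> t"
    and deriv: "\<And>u. u \<in> {s..t} \<Longrightarrow> (g has_vector_derivative g' u) (at u within {s..t})"
    and le: "\<And>u. u \<in> {s..t} \<Longrightarrow> norm1 (g' u) \<le> B"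
  shows "norm1 (g t - g s) \<le> B * (t - s)"
proof (cases "s = t")
  case False
  obtain w where w: "norm1 (g t - g s) = (g t - g s) \<bullet> w" "\<And>x. x \<bullet> w \<le> norm1 x"
    using norm1_dual by blast
  have "\<exists>x\<in>{s<..<t}. g t \<bullet> w - g s \<bullet> w = (\<lambda>h. (h *\<^sub>R g' x) \<bullet> w) (t - s)"
  proof (rule mvt_simple)
    show "s < t" using st False by simp
    fix x assume "s \<le> x" "x \<le> t"
    then have "(g has_derivative (\<lambda>h. h *\<^sub>R g' x)) (at x within {s..t})"
      using deriv[of x] by (simp add: has_vector_derivative_def)
    then show "((\<lambda>x. g x \<bullet> w) has_derivative (\<lambda>h. (h *\<^sub>R g' x) \<bullet> w)) (at x within {s..t})"
      by (rule has_derivative_inner_left)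
  qed
  then obtain x where x: "x \<in> {s<..<t}" "(g t - g s) \<bullet> w = (t - s) * (g' x \<bullet> w)"
    by (auto simp: inner_diff_left)
  have "g' x \<bullet> w \<le> B" using w(2)[of "g' x"] le[of x] x(1) by auto
  then show ?thesis using x st w(1) by (simp add: mult.commute mult_right_mono)
qed simp

section \<open>Initial value problems: existence, uniqueness and regularity\<close>

text \<open>The function \<open>e\<^bsup>-B(t-a)\<^esup> (A + B \<integral> u)\<close> has a nonpositive derivative, hence stays below its initial value \<open>A\<close>.\<close>

lemma Gronwall:
  fixes u :: "real \<Rightarrow> real"
  assumes u: "continuous_on {a..b} u" and B: "0 \<le> B"
    and le: "\<And>t. t \<in> {a..b} \<Longrightarrow> u t \<le> A + B * integral {a..t} u"
    and t: "t \<in> {a..b}"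
  shows "u t \<le> A * exp (B * (t - a))"
proof (cases "t = a")
  case True
  then show ?thesis using le[of t] t by simp
next
  case False
  define G where "G x = exp (- (B * (x - a))) * (A + B * integral {a..x} u)" for x
  have "\<exists>x\<in>{a<..<t}. G t - G a
      = (\<lambda>h. h * (exp (- (B * (x - a))) * B * (u x - (A + B * integral {a..x} u)))) (t - a)"
  proof (rule mvt_simple)
    show "a < t" using t False by simp
    fix x assume x: "a \<le> x" "x \<le> t"
    have "((\<lambda>x. integral {a..x} u) has_real_derivative u x) (at x within {a..t})"
      using integral_has_vector_derivative[of a t u x] continuous_on_subset[OF u, of "{a..t}"] x t
      by (simp add: has_real_derivative_iff_has_vector_derivative)
    then have "(G has_real_derivative
        exp (- (B * (x - a))) * B * (u x - (A + B * integral {a..x} u))) (at x within {a..t})"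
      unfolding G_def by (auto intro!: derivative_eq_intros simp: algebra_simps)
    then show "(G has_derivative
        (\<lambda>h. h * (exp (- (B * (x - a))) * B * (u x - (A + B * integral {a..x} u))))) (at x within {a..t})"
      by (simp add: has_field_derivative_def mult_commute_abs)
  qed
  then obtain x where x: "x \<in> {a<..<t}"
    "G t - G a = (t - a) * (exp (- (B * (x - a))) * B * (u x - (A + B * integral {a..x} u)))"
    by auto
  have "u x - (A + B * integral {a..x} u) \<le> 0" using le[of x] x(1) t by auto
  then have "G t \<le> G a"
    using x t B by (smt (verit) atLeastAtMost_iff exp_ge_zero mult_nonneg_nonneg mult_nonneg_nonpos)
  then have "exp (- (B * (t - a))) * (A + B * integral {a..t} u) \<le> A"
    by (simp add: G_def)
  then have "exp (B * (t - a)) * (exp (- (B * (t - a))) * (A + B * integral {a..t} u)) \<le> exp (B * (t - a)) * A"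
    by (intro mult_left_mono) auto
  also have "exp (B * (t - a)) * (exp (- (B * (t - a))) * (A + B * integral {a..t} u))
      = A + B * integral {a..t} u"
    by (simp add: mult.assoc[symmetric] mult_exp_exp)
  finally have "A + B * integral {a..t} u \<le> A * exp (B * (t - a))" by (simp only: mult.commute)
  then show ?thesis using le[OF t] by simp
qed

locale ivp =
  fixes a b K L \<rho> :: real and \<eta> :: "real ^ 'd" and f :: "'d rhs"
  assumes ab: "a < b" and K: "0 < K" and L: "0 < L" and \<rho>: "0 < \<rho>" "\<rho> \<le> 1"
    and F: "(\<eta>, f) \<in> F_class a b K L \<rho>"
begin

abbreviation "R \<equiv> Rbar a b K"

lemma eta_le: "norm1 \<eta> \<le> K"
  and f_cont: "continuous_on ({a..b} \<times> UNIV) f"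
  and f_growth: "t \<in> {a..b} \<Longrightarrow> norm1 (f (t, x)) \<le> K * (1 + norm1 x)"
  and f_Hoelder: "t \<in> {a..b} \<Longrightarrow> s \<in> {a..b} \<Longrightarrow> norm1 (x - \<eta>) \<le> R \<Longrightarrow>
        norm1 (f (t, x) - f (s, x)) \<le> L * \<bar>t - s\<bar> powr \<rho>"
  and f_Lipschitz: "t \<in> {a..b} \<Longrightarrow> norm1 (x - \<eta>) \<le> R \<Longrightarrow> norm1 (y - \<eta>) \<le> R \<Longrightarrow>
        norm1 (f (t, x) - f (t, y)) \<le> L * norm1 (x - y)"
  using F unfolding F_class_def ball1_def by auto

text \<open>The solution of \<open>v' = K (1 + K + v)\<close>, \<open>v a = 0\<close>: since \<open>norm1 \<eta> \<le> K\<close> and \<open>f\<close> grows at most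
  linearly with constant \<open>K\<close>, it majorizes the distance to \<open>\<eta>\<close> of the solution and of all its Picard iterates.\<close>

definition env :: "real \<Rightarrow> real" where
  "env t = (1 + K) * (exp (K * (t - a)) - 1)"

lemma env_le_Rbar:
  assumes "t \<in> {a..b}"
  shows "env t \<le> R"
proof -
  let ?T = "b - a"
  define E where "E = exp (K * ?T * (1 + K * ?T))"
  have T: "0 < K * ?T" using ab K by simp
  have "K * (t - a) \<le> K * ?T" using assms K by simp
  also have "\<dots> \<le> K * ?T * (1 + K * ?T)" using T by (simp add: distrib_left)
  finally have "exp (K * (t - a)) \<le> E" unfolding E_def by simp
  then have 1: "env t \<le> (1 + K) * (E - 1)"
    unfolding env_def using K by (intro mult_left_mono) auto
  have E1: "1 \<le> E" unfolding E_def using T by simp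
  have "(1 + K) * (E - 1) \<le> (1 / K + 1) * (E * (1 + K) - 1)"
  proof -
    have "(1 + K) * (E - 1) \<le> (1 + K) * E" using K by simp
    also have "\<dots> = (1 / K + 1) * (K * E)" using K by (simp add: field_simps)
    also have "\<dots> \<le> (1 / K + 1) * (E * (1 + K) - 1)"
      using K E1 by (intro mult_left_mono) (auto simp: algebra_simps)
    finally show ?thesis .
  qed
  also have "\<dots> \<le> (1 / K + 1) * (E * (1 + K) - 1) * (1 + K * ?T)"
  proof -
    have "0 \<le> E * (1 + K) - 1" using E1 K mult_mono[of 1 E 1 "1 + K"] by simp
    then have "0 \<le> (1 / K + 1) * (E * (1 + K) - 1)" using K by simp
    then show ?thesis using T by (simp add: distrib_left)
  qed
  also have "\<dots> \<le> R"
  proof -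
    have "0 \<le> K + ?T * (1 + K)" using ab K by simp
    moreover have "(1 / K + 1) * (E * (1 + K) - 1) * (1 + K * ?T)
        = (1 / K + 1) * (1 + K * ?T) * (E * (1 + K) - 1)" by (simp only: mult_ac)
    ultimately show ?thesis unfolding Rbar_def E_def[symmetric] by linarith
  qed
  finally show ?thesis using 1 by simp
qed

lemma continuous_along:
  assumes "continuous_on {a..b} x"
  shows "continuous_on {a..b} (\<lambda>s. f (s, x s))"
  by (rule continuous_on_compose2[OF f_cont]) (auto intro!: continuous_intros assms)

lemma env_mono: "s \<le> t \<Longrightarrow> env s \<le> env t"
  unfolding env_def using K by (intro mult_left_mono) auto

lemma env_integral:
  assumes "t \<in> {a..b}"
  shows "integral {a..t} (\<lambda>s. K * (1 + K) * exp (K * (s - a))) = env t"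
proof -
  have "((\<lambda>s. K * (1 + K) * exp (K * (s - a))) has_integral env t - env a) {a..t}"
    using assms unfolding env_def
    by (intro fundamental_theorem_of_calculus)
       (auto intro!: derivative_eq_intros
         simp: has_real_derivative_iff_has_vector_derivative[symmetric])
  then have "integral {a..t} (\<lambda>s. K * (1 + K) * exp (K * (s - a))) = env t - env a"
    by (rule integral_unique)
  then show ?thesis by (simp add: env_def)
qed

text \<open>The Picard operator preserves the functions that stay in the envelope. Only there is the
  Lipschitz condition available, so the iteration must not leave it.\<close>

lemma in_envelope_step:
  assumes x: "continuous_on {a..b} x"
    and env: "\<And>s. s \<in> {a..b} \<Longrightarrow> norm1 (x s - \<eta>) \<le> env s" and t: "t \<in> {a..b}"
  shows "norm1 (integral {a..t} (\<lambda>s. f (s, x s))) \<le> env t"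
proof -
  have "norm1 (integral {a..t} (\<lambda>s. f (s, x s)))
      \<le> integral {a..t} (\<lambda>s. K * (1 + K) * exp (K * (s - a)))"
  proof (rule norm1_integral_le)
    show "continuous_on {a..t} (\<lambda>s. f (s, x s))"
      using t by (intro continuous_on_subset[OF continuous_along[OF x]]) auto
    fix s assume "s \<in> {a..t}"
    then have s: "s \<in> {a..b}" using t by auto
    have "norm1 (x s) \<le> norm1 \<eta> + norm1 (x s - \<eta>)"
      using norm1_triangle[of \<eta> "x s - \<eta>"] by simp
    then have "norm1 (x s) \<le> K + env s" using env[OF s] eta_le by simp
    then have "1 + norm1 (x s) \<le> (1 + K) * exp (K * (s - a))"
      by (simp add: env_def right_diff_distrib)
    then have "K * (1 + norm1 (x s)) \<le> K * ((1 + K) * exp (K * (s - a)))"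
      using K by (intro mult_left_mono) auto
    then have "K * (1 + norm1 (x s)) \<le> K * (1 + K) * exp (K * (s - a))"
      by (simp only: mult.assoc)
    then show "norm1 (f (s, x s)) \<le> K * (1 + K) * exp (K * (s - a))"
      using f_growth[OF s, of "x s"] by simp
  qed (intro continuous_intros)
  then show ?thesis using env_integral[OF t] by simp
qed

subsection \<open>Picard iteration\<close>

primrec picard :: "nat \<Rightarrow> real \<Rightarrow> real ^ 'd" where
  "picard 0 = (\<lambda>t. \<eta>)"
| "picard (Suc n) = (\<lambda>t. \<eta> + integral {a..t} (\<lambda>s. f (s, picard n s)))"

lemma picard_env: "continuous_on {a..b} (picard n) \<and> (\<forall>t\<in>{a..b}. norm1 (picard n t - \<eta>) \<le> env t)"
proof (induction n)
  case 0
  show ?case using K by (auto simp: env_def intro!: continuous_intros)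
next
  case (Suc n)
  then have c: "continuous_on {a..b} (\<lambda>s. f (s, picard n s))" by (intro continuous_along) auto
  have "continuous_on {a..b} (picard (Suc n))"
    using c by (auto intro!: continuous_intros indefinite_integral_continuous_1
        integrable_continuous_real)
  then show ?case using in_envelope_step[of "picard n"] Suc by auto
qed

lemma picard_cont: "continuous_on {a..b} (picard n)"
  and picard_ball: "t \<in> {a..b} \<Longrightarrow> norm1 (picard n t - \<eta>) \<le> R"
  using picard_env[of n] env_le_Rbar[of t] by (auto intro: order_trans)

text \<open>Each iteration integrates the previous bound once more, which produces the factorial.\<close>

lemma picard_diff:
  "t \<in> {a..b} \<Longrightarrow> norm1 (picard (Suc n) t - picard n t) \<le> env b * (L * (t - a)) ^ n / fact n"
proof (induction n arbitrary: t)
  case 0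
  have "norm1 (picard (Suc 0) t - picard 0 t) \<le> env t"
    using picard_env[of "Suc 0"] 0 by simp
  then show ?case using env_mono[of t b] 0 by simp
next
  case (Suc n)
  have sub: "{a..t} \<subseteq> {a..b}" using Suc.prems by auto
  have c: "continuous_on {a..t} (\<lambda>s. f (s, picard n s))" for n
    by (rule continuous_on_subset[OF continuous_along[OF picard_cont] sub])
  let ?B = "\<lambda>s. L * (env b * (L * (s - a)) ^ n / fact n)"
  have "picard (Suc (Suc n)) t - picard (Suc n) t
      = integral {a..t} (\<lambda>s. f (s, picard (Suc n) s) - f (s, picard n s))"
    using integral_diff[OF integrable_continuous_real[OF c[of "Suc n"]]
        integrable_continuous_real[OF c[of n]]] by simp
  also have "norm1 \<dots> \<le> integral {a..t} ?B"
  proof (rule norm1_integral_le)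
    fix s assume "s \<in> {a..t}"
    then have s: "s \<in> {a..b}" using sub by auto
    have "norm1 (f (s, picard (Suc n) s) - f (s, picard n s)) \<le> L * norm1 (picard (Suc n) s - picard n s)"
      by (intro f_Lipschitz s picard_ball)
    also have "\<dots> \<le> ?B s" using Suc.IH[OF s] L by (intro mult_left_mono) auto
    finally show "norm1 (f (s, picard (Suc n) s) - f (s, picard n s)) \<le> ?B s" .
  qed (intro continuous_intros c | simp)+
  also have "\<dots> = env b * (L * (t - a)) ^ Suc n / fact (Suc n)"
  proof -
    let ?F = "\<lambda>s. env b * (L * (s - a)) ^ Suc n / fact (Suc n)"
    have "(?B has_integral ?F t - ?F a) {a..t}"
    proof (rule fundamental_theorem_of_calculus)
      show "a \<le> t" using Suc.prems by simp
      fix x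
      have "((\<lambda>s. L * (s - a)) has_real_derivative L) (at x within {a..t})"
        by (auto intro!: derivative_eq_intros)
      from DERIV_cdivide[OF DERIV_cmult[OF DERIV_power_Suc[OF this, of n], of "env b"], of "fact (Suc n)"]
      have "(?F has_real_derivative env b * ((1 + real n) * (L * (L * (x - a)) ^ n)) / fact (Suc n))
          (at x within {a..t})" .
      also have "env b * ((1 + real n) * (L * (L * (x - a)) ^ n)) / fact (Suc n)
          = ((1 + real n) * (L * (env b * (L * (x - a)) ^ n))) / ((1 + real n) * fact n)"
        by (simp only: fact_Suc of_nat_Suc mult_ac)
      also have "\<dots> = ?B x" by simp
      finally show "(?F has_vector_derivative ?B x) (at x within {a..t})"
        by (simp add: has_real_derivative_iff_has_vector_derivative)
    qed
    then have "integral {a..t} ?B = ?F t - ?F a" by (rule integral_unique)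
    also have "?F a = 0" by simp
    finally show ?thesis by (simp only: diff_zero)
  qed
  finally show ?case .
qed

text \<open>The differences of consecutive iterates are dominated by an exponential series, so the iterates
  converge uniformly, and the integral equation passes to the limit by the Lipschitz condition.\<close>

lemma solution_exists:
  "\<exists>z. z a = \<eta> \<and> (\<forall>t\<in>{a..b}. (z has_vector_derivative f (t, z t)) (at t within {a..b}))"
proof -
  let ?M = "\<lambda>n. env b * ((L * (b - a)) ^ n / fact n)"
  define z where "z t = \<eta> + (\<Sum>n. picard (Suc n) t - picard n t)" for t
  have "uniform_limit {a..b} (\<lambda>n t. \<Sum>i<n. picard (Suc i) t - picard i t)
      (\<lambda>t. \<Sum>n. picard (Suc n) t - picard n t) sequentially"
  proof (rule Weierstrass_m_test)
    show "summable ?M"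
      using summable_exp[of "L * (b - a)"] by (intro summable_mult) (simp add: field_simps)
    fix n t assume t: "t \<in> {a..b}"
    have "norm1 (picard (Suc n) t - picard n t) \<le> env b * ((L * (t - a)) ^ n / fact n)"
      using picard_diff[OF t, of n] by simp
    also have "\<dots> \<le> ?M n"
      using t L K ab by (intro mult_left_mono divide_right_mono power_mono) (auto simp: env_def)
    finally show "norm (picard (Suc n) t - picard n t) \<le> ?M n"
      using norm_le_norm1[of "picard (Suc n) t - picard n t"] by linarith
  qed
  moreover have "(\<Sum>i<n. picard (Suc i) t - picard i t) = picard n t - \<eta>" for n t
    by (induction n) auto
  ultimately have "uniform_limit {a..b} (\<lambda>n t. picard n t - \<eta>)
      (\<lambda>t. \<Sum>n. picard (Suc n) t - picard n t) sequentially" by simp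
  then have lim: "uniform_limit {a..b} picard z sequentially"
    unfolding z_def uniform_limit_iff dist_norm by (simp add: algebra_simps)
  have zc: "continuous_on {a..b} z"
    by (rule uniform_limit_theorem[OF _ lim]) (auto intro: picard_cont always_eventually)
  have zl: "(\<lambda>n. picard n t) \<longlonglongrightarrow> z t" if "t \<in> {a..b}" for t
    using tendsto_uniform_limitI[OF lim that] .
  have zball: "norm1 (z t - \<eta>) \<le> R" if "t \<in> {a..b}" for t
    using picard_ball[OF that]
    by (intro tendsto_upperbound[OF tendsto_norm1[OF tendsto_diff[OF zl[OF that] tendsto_const]]])
       (auto intro: always_eventually)
  have fc: "continuous_on {a..b} (\<lambda>s. f (s, z s))" by (rule continuous_along[OF zc])
  have z_eq: "z t = \<eta> + integral {a..t} (\<lambda>s. f (s, z s))" if t: "t \<in> {a..b}" for t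
  proof -
    have "(\<lambda>n. integral {a..t} (\<lambda>s. f (s, picard n s))) \<longlonglongrightarrow> integral {a..t} (\<lambda>s. f (s, z s))"
    proof (rule LIMSEQ_I)
      fix e :: real assume e: "0 < e"
      define d where "d = e / (2 * L * real CARD('d) * (b - a))"
      have d: "0 < d" unfolding d_def using e L ab by simp
      from uniform_limitD[OF lim d]
      have "\<exists>n0. \<forall>n\<ge>n0. \<forall>s\<in>{a..b}. dist (picard n s) (z s) < d"
        unfolding eventually_sequentially .
      then obtain n0 where
        n0: "\<And>n s. n \<ge> n0 \<Longrightarrow> s \<in> {a..b} \<Longrightarrow> dist (picard n s) (z s) < d"
        by metis
      show "\<exists>n0. \<forall>n\<ge>n0. norm (integral {a..t} (\<lambda>s. f (s, picard n s))
          - integral {a..t} (\<lambda>s. f (s, z s))) < e"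
      proof (intro exI allI impI)
        fix n assume n: "n0 \<le> n"
        have c1: "continuous_on {a..t} (\<lambda>s. f (s, picard n s))"
          using t by (intro continuous_on_subset[OF continuous_along[OF picard_cont]]) auto
        have c2: "continuous_on {a..t} (\<lambda>s. f (s, z s))"
          using t by (intro continuous_on_subset[OF fc]) auto
        have "norm (integral {a..t} (\<lambda>s. f (s, picard n s)) - integral {a..t} (\<lambda>s. f (s, z s)))
            \<le> norm1 (integral {a..t} (\<lambda>s. f (s, picard n s) - f (s, z s)))"
          using integral_diff[OF integrable_continuous_real[OF c1] integrable_continuous_real[OF c2]]
          by (simp add: norm_le_norm1)
        also have "\<dots> \<le> integral {a..t} (\<lambda>s. L * (real CARD('d) * d))"
        proof (rule norm1_integral_le)
          fix s assume "s \<in> {a..t}"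
          then have s: "s \<in> {a..b}" using t by auto
          have "norm1 (f (s, picard n s) - f (s, z s)) \<le> L * norm1 (picard n s - z s)"
            by (intro f_Lipschitz s picard_ball zball)
          also have "\<dots> \<le> L * (real CARD('d) * d)"
            using norm1_le_norm[of "picard n s - z s"] n0[OF n s] L
            by (intro mult_left_mono order_trans[OF norm1_le_norm] mult_left_mono)
               (auto simp: dist_norm)
          finally show "norm1 (f (s, picard n s) - f (s, z s)) \<le> L * (real CARD('d) * d)" .
        qed (intro continuous_intros c1 c2)+
        also have "\<dots> = (t - a) * (L * (real CARD('d) * d))" using t by simp
        also have "\<dots> \<le> (b - a) * (L * (real CARD('d) * d))"
          using t L d by (intro mult_right_mono) auto
        also have "\<dots> = e / 2" unfolding d_def using L ab by (simp add: field_simps)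
        also have "\<dots> < e" using e by simp
        finally show "norm (integral {a..t} (\<lambda>s. f (s, picard n s))
          - integral {a..t} (\<lambda>s. f (s, z s))) < e" .
      qed
    qed
    then have "(\<lambda>n. picard (Suc n) t) \<longlonglongrightarrow> \<eta> + integral {a..t} (\<lambda>s. f (s, z s))"
      by (simp add: tendsto_add)
    moreover have "(\<lambda>n. picard (Suc n) t) \<longlonglongrightarrow> z t"
      using zl[OF t] by (rule LIMSEQ_Suc)
    ultimately show ?thesis using LIMSEQ_unique by blast
  qed
  show ?thesis
  proof (intro exI conjI ballI)
    show "z a = \<eta>" using z_eq[of a] ab by simp
    fix t assume t: "t \<in> {a..b}"
    have "((\<lambda>u. \<eta> + integral {a..u} (\<lambda>s. f (s, z s))) has_vector_derivative f (t, z t)) (at t within {a..b})"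
      using integral_has_vector_derivative[OF fc t] by (auto intro!: derivative_eq_intros)
    then show "(z has_vector_derivative f (t, z t)) (at t within {a..b})"
      by (rule has_vector_derivative_transform[rotated 2]) (use t z_eq in auto)
  qed
qed

subsection \<open>A priori bound and uniqueness\<close>

definition solves :: "(real \<Rightarrow> real ^ 'd) \<Rightarrow> bool" where
  "solves z \<longleftrightarrow> z a = \<eta> \<and>
     (\<forall>t\<in>{a..b}. (z has_vector_derivative f (t, z t)) (at t within {a..b}))"

lemma solves_cont: "solves z \<Longrightarrow> continuous_on {a..b} z"
  unfolding solves_def
  by (metis continuous_on_eq_continuous_within has_vector_derivative_continuous)

lemma solves_integral:
  assumes z: "solves z" and st: "a \<le> s" "s \<le> t" "t \<le> b"
  shows "z t - z s = integral {s..t} (\<lambda>u. f (u, z u))"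
proof -
  have "((\<lambda>u. f (u, z u)) has_integral z t - z s) {s..t}"
  proof (rule fundamental_theorem_of_calculus)
    fix x assume x: "x \<in> {s..t}"
    then have "(z has_vector_derivative f (x, z x)) (at x within {a..b})"
      using z st by (auto simp: solves_def)
    then show "(z has_vector_derivative f (x, z x)) (at x within {s..t})"
      by (rule has_vector_derivative_within_subset) (use st in auto)
  qed (use st in auto)
  then show ?thesis by (simp add: integral_unique)
qed

lemma solves_bound:
  assumes z: "solves z" and t: "t \<in> {a..b}"
  shows "1 + norm1 (z t) \<le> (1 + K) * exp (K * (t - a))"
proof (rule Gronwall[where u = "\<lambda>t. 1 + norm1 (z t)", OF _ _ _ t])
  show "continuous_on {a..b} (\<lambda>t. 1 + norm1 (z t))"
    by (intro continuous_intros solves_cont z)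
  show "0 \<le> K" using K by simp
  fix t assume t: "t \<in> {a..b}"
  have zc: "continuous_on {a..t} z"
    using t by (intro continuous_on_subset[OF solves_cont[OF z]]) auto
  have "z t - \<eta> = integral {a..t} (\<lambda>u. f (u, z u))"
    using solves_integral[OF z, of a t] z t by (simp add: solves_def)
  also have "norm1 \<dots> \<le> integral {a..t} (\<lambda>s. K * (1 + norm1 (z s)))"
  proof (rule norm1_integral_le)
    show "continuous_on {a..t} (\<lambda>u. f (u, z u))"
      using t by (intro continuous_on_subset[OF continuous_along[OF solves_cont[OF z]]]) auto
  qed (use t in \<open>auto intro!: continuous_intros zc f_growth\<close>)
  finally have "norm1 (z t - \<eta>) \<le> integral {a..t} (\<lambda>s. K * (1 + norm1 (z s)))" .
  moreover have "norm1 (z t) \<le> norm1 \<eta> + norm1 (z t - \<eta>)"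
    using norm1_triangle[of \<eta> "z t - \<eta>"] by simp
  ultimately show "1 + norm1 (z t) \<le> 1 + K + K * integral {a..t} (\<lambda>t. 1 + norm1 (z t))"
    using eta_le by simp
qed

text \<open>Uniqueness has to be shown among all solutions, including those not known to stay where \<open>f\<close> is
  Lipschitz. Gronwall's inequality and the linear growth confine each of them to that region.\<close>

lemma solves_ball:
  assumes z: "solves z" and t: "t \<in> {a..b}"
  shows "norm1 (z t - \<eta>) \<le> R"
proof -
  have "z t - \<eta> = integral {a..t} (\<lambda>u. f (u, z u))"
    using solves_integral[OF z, of a t] z t by (simp add: solves_def)
  also have "norm1 \<dots> \<le> integral {a..t} (\<lambda>s. K * (1 + K) * exp (K * (s - a)))"
  proof (rule norm1_integral_le)
    show "continuous_on {a..t} (\<lambda>u. f (u, z u))"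
      using t by (intro continuous_on_subset[OF continuous_along[OF solves_cont[OF z]]]) auto
    fix s assume "s \<in> {a..t}"
    then have s: "s \<in> {a..b}" using t by auto
    have "norm1 (f (s, z s)) \<le> K * (1 + norm1 (z s))" by (rule f_growth[OF s])
    also have "\<dots> \<le> K * ((1 + K) * exp (K * (s - a)))"
      using solves_bound[OF z s] K by (intro mult_left_mono) auto
    finally show "norm1 (f (s, z s)) \<le> K * (1 + K) * exp (K * (s - a))" by (simp add: mult.assoc)
  qed (intro continuous_intros)
  also have "\<dots> \<le> R" using env_integral[OF t] env_le_Rbar[OF t] by simp
  finally show ?thesis .
qed

lemma solves_unique:
  assumes z: "solves z" and y: "solves y" and t: "t \<in> {a..b}"
  shows "z t = y t"
proof -
  have "norm1 (z t - y t) \<le> 0 * exp (L * (t - a))"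
  proof (rule Gronwall[where u = "\<lambda>t. norm1 (z t - y t)", OF _ _ _ t])
    show "continuous_on {a..b} (\<lambda>t. norm1 (z t - y t))"
      by (intro continuous_intros solves_cont z y)
    show "0 \<le> L" using L by simp
    fix t assume t: "t \<in> {a..b}"
    have zc: "continuous_on {a..t} z" "continuous_on {a..t} y"
      using t by (auto intro: continuous_on_subset[OF solves_cont[OF z]] continuous_on_subset[OF solves_cont[OF y]])
    have fc: "continuous_on {a..t} (\<lambda>u. f (u, z u))" "continuous_on {a..t} (\<lambda>u. f (u, y u))"
      using t by (auto intro: continuous_on_subset[OF continuous_along[OF solves_cont[OF z]]]
          continuous_on_subset[OF continuous_along[OF solves_cont[OF y]]])
    have "z t - y t = integral {a..t} (\<lambda>u. f (u, z u) - f (u, y u))"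
      using solves_integral[OF z, of a t] solves_integral[OF y, of a t] z y t
        integral_diff[OF integrable_continuous_real[OF fc(1)] integrable_continuous_real[OF fc(2)]]
      by (simp add: solves_def algebra_simps)
    also have "norm1 \<dots> \<le> integral {a..t} (\<lambda>s. L * norm1 (z s - y s))"
      by (rule norm1_integral_le)
         (use t in \<open>auto intro!: continuous_intros fc zc f_Lipschitz solves_ball z y\<close>)
    finally show "norm1 (z t - y t) \<le> 0 + L * integral {a..t} (\<lambda>t. norm1 (z t - y t))"
      by simp
  qed
  then have "norm1 (z t - y t) \<le> 0" by simp
  then have "norm (z t - y t) \<le> 0" using norm_le_norm1[of "z t - y t"] by linarith
  then show ?thesis by simp
qed

abbreviation "sol \<equiv> ivp_solution a b \<eta> f"

lemma solves_sol: "solves sol"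
proof -
  obtain y where y: "solves y" using solution_exists unfolding solves_def by blast
  let ?P = "\<lambda>z. z \<in> extensional {a..b} \<and> z a = \<eta> \<and>
     (\<forall>t\<in>{a..b}. (z has_vector_derivative f (t, z t)) (at t within {a..b}))"
  have "?P (restrict y {a..b})"
  proof (intro conjI ballI)
    show "restrict y {a..b} a = \<eta>" using y ab by (simp add: solves_def)
    fix t assume t: "t \<in> {a..b}"
    have "(y has_vector_derivative f (t, y t)) (at t within {a..b})"
      using y t by (simp add: solves_def)
    then have "(restrict y {a..b} has_vector_derivative f (t, y t)) (at t within {a..b})"
      by (rule has_vector_derivative_transform[rotated 2]) (use t in auto)
    then show "(restrict y {a..b} has_vector_derivative f (t, restrict y {a..b} t)) (at t within {a..b})"
      using t by simp
  qed simp
  moreover have "z = restrict y {a..b}" if "?P z" for z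
  proof (rule extensionalityI[of z "{a..b}"])
    have "solves z" using that unfolding solves_def by blast
    then show "z t = restrict y {a..b} t" if "t \<in> {a..b}" for t
      using solves_unique[OF _ y that] that by simp
    show "z \<in> extensional {a..b}" using that by blast
  qed simp
  ultimately have "?P sol" unfolding ivp_solution_def by (rule theI)
  then show ?thesis by (simp add: solves_def)
qed

subsection \<open>Hoelder continuity of the derivative of the solution\<close>

text \<open>Both constants depend on the parameters of the class only, not on the problem; this is what makes
  the final error bound uniform over the class.\<close>

definition slope_bound :: real where
  "slope_bound = K * (1 + K) * exp (K * (b - a))"

definition H :: real where
  "H = L * (1 + slope_bound * (b - a) powr (1 - \<rho>))"

abbreviation g :: "real \<Rightarrow> real ^ 'd" where "g t \<equiv> f (t, sol t)"

lemma slope_bound_nonneg: "0 \<le> slope_bound"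
  using K by (simp add: slope_bound_def)

lemma H_nonneg: "0 \<le> H"
  using L slope_bound_nonneg by (simp add: H_def)

lemma slope_le: "t \<in> {a..b} \<Longrightarrow> norm1 (g t) \<le> slope_bound"
proof -
  assume t: "t \<in> {a..b}"
  have "norm1 (g t) \<le> K * (1 + norm1 (sol t))" by (rule f_growth[OF t])
  also have "\<dots> \<le> K * ((1 + K) * exp (K * (t - a)))"
    using solves_bound[OF solves_sol t] K by (intro mult_left_mono) auto
  also have "\<dots> \<le> K * ((1 + K) * exp (K * (b - a)))"
    using K t by (intro mult_left_mono) auto
  finally show ?thesis by (simp add: slope_bound_def mult.assoc)
qed

lemma sol_deriv:
  assumes "a \<le> s" "t \<le> b" "u \<in> {s..t}"
  shows "(sol has_vector_derivative g u) (at u within {s..t})"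
  using solves_sol assms has_vector_derivative_within_subset[of sol "g u" u "{a..b}" "{s..t}"]
  by (auto simp: solves_def)

lemma g_cont: "continuous_on {a..b} g"
  by (intro continuous_along solves_cont solves_sol)

lemma g_Hoelder:
  assumes st: "s \<in> {a..b}" "t \<in> {a..b}"
  shows "norm1 (g t - g s) \<le> H * \<bar>t - s\<bar> powr \<rho>"
proof -
  have sol_Lip: "norm1 (sol t - sol s) \<le> slope_bound * \<bar>t - s\<bar>"
    if "s \<in> {a..b}" "t \<in> {a..b}" "s \<le> t" for s t
  proof -
    have "norm1 (sol t - sol s) \<le> slope_bound * (t - s)"
      using that by (intro norm1_increment_le[of s t _ g] sol_deriv slope_le) auto
    then show ?thesis using that by simp
  qed
  have 1: "norm1 (sol t - sol s) \<le> slope_bound * \<bar>t - s\<bar>"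
    using sol_Lip[of s t] sol_Lip[of t s] st
    by (cases "s \<le> t") (auto simp: norm1_minus_commute abs_minus_commute)
  have 2: "\<bar>t - s\<bar> \<le> (b - a) powr (1 - \<rho>) * \<bar>t - s\<bar> powr \<rho>"
  proof (cases "t = s")
    case False
    then have "\<bar>t - s\<bar> = \<bar>t - s\<bar> powr (1 - \<rho>) * \<bar>t - s\<bar> powr \<rho>"
      by (simp add: powr_add[symmetric])
    also have "\<dots> \<le> (b - a) powr (1 - \<rho>) * \<bar>t - s\<bar> powr \<rho>"
      using st \<rho> by (intro mult_right_mono powr_mono2) auto
    finally show ?thesis .
  qed simp
  have "norm1 (g t - g s) \<le> norm1 (f (t, sol t) - f (s, sol t)) + norm1 (f (s, sol t) - f (s, sol s))"
    by (rule norm1_triangle_mid)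
  also have "\<dots> \<le> L * \<bar>t - s\<bar> powr \<rho> + L * norm1 (sol t - sol s)"
    by (intro add_mono f_Hoelder f_Lipschitz st solves_ball solves_sol)
  also have "\<dots> \<le> L * \<bar>t - s\<bar> powr \<rho> + L * (slope_bound * ((b - a) powr (1 - \<rho>) * \<bar>t - s\<bar> powr \<rho>))"
    using 1 2 slope_bound_nonneg L
    by (intro add_left_mono mult_left_mono order_trans[OF 1] mult_left_mono 2) auto
  finally show ?thesis by (simp add: H_def algebra_simps)
qed

text \<open>The rectangle rule has the same order for every choice of the node \<open>r\<close>. The bound serves three times:
  for the random quadrature node, for the Euler predictor of the first stage (\<open>r = s\<close>), and for the
  interpolation between the nodes.\<close>

lemma sol_increment:
  assumes st: "a \<le> s" "s \<le> t" "t \<le> b" "t - s \<le> h" and r: "r \<in> {s..t}"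
  shows "norm1 (sol t - sol s - (t - s) *\<^sub>R g r) \<le> H * h powr \<rho> * h"
proof -
  have "norm1 ((\<lambda>u. sol u - u *\<^sub>R g r) t - (\<lambda>u. sol u - u *\<^sub>R g r) s) \<le> H * h powr \<rho> * (t - s)"
  proof (rule norm1_increment_le[OF st(2)])
    fix u assume u: "u \<in> {s..t}"
    show "((\<lambda>u. sol u - u *\<^sub>R g r) has_vector_derivative g u - g r) (at u within {s..t})"
      using sol_deriv[OF st(1,3) u] by (auto intro!: derivative_eq_intros)
    have "norm1 (g u - g r) \<le> H * \<bar>u - r\<bar> powr \<rho>"
      using u r st by (intro g_Hoelder) auto
    also have "\<dots> \<le> H * h powr \<rho>"
      using u r st \<rho> H_nonneg by (intro mult_left_mono powr_mono2) auto
    finally show "norm1 (g u - g r) \<le> H * h powr \<rho>" .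
  qed
  also have "\<dots> \<le> H * h powr \<rho> * h"
    using st H_nonneg by (intro mult_left_mono) auto
  finally show ?thesis by (simp add: algebra_simps)
qed

end

section \<open>Pathwise analysis of the Runge-Kutta method\<close>

lemma discrete_Gronwall:
  fixes e :: "nat \<Rightarrow> real"
  assumes le: "\<And>j. j \<le> n \<Longrightarrow> e j \<le> A + B * (\<Sum>i<j. e i)" and B: "0 \<le> B" and A: "0 \<le> A" and j: "j \<le> n"
  shows "e j \<le> A * exp (B * real j)"
proof -
  have "A + B * (\<Sum>i<j. e i) \<le> A * (1 + B) ^ j" if "j \<le> n" for j
    using that
  proof (induction j)
    case (Suc j)
    then have "A + B * (\<Sum>i<j. e i) \<le> A * (1 + B) ^ j" and "e j \<le> A * (1 + B) ^ j"
      using le[of j] by auto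
    then have "(A + B * (\<Sum>i<j. e i)) + B * e j \<le> A * (1 + B) ^ j + B * (A * (1 + B) ^ j)"
      using B by (intro add_mono mult_left_mono) auto
    then show ?case by (simp add: algebra_simps)
  qed simp
  then have "e j \<le> A * (1 + B) ^ j" using le[OF j] j by (meson order_trans)
  also have "\<dots> \<le> A * exp B ^ j"
    using A B exp_ge_add_one_self[of B] by (intro mult_left_mono power_mono) auto
  finally show ?thesis by (simp add: exp_of_nat2_mult)
qed

lemma rk_node_Suc: "rk_node a b N (Suc j) = rk_node a b N j + (b - a) / real N"
  by (simp add: rk_node_def algebra_simps add_divide_distrib diff_divide_distrib)

lemma rk_node_bounds:
  assumes "a < b" "j < N"
  shows "a \<le> rk_node a b N j" "rk_node a b N j + (b - a) / real N \<le> b"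
proof -
  have "real (Suc j) * ((b - a) / real N) \<le> real N * ((b - a) / real N)"
    using assms by (intro mult_right_mono) auto
  also have "\<dots> = b - a" using assms by simp
  finally have "rk_node a b N (Suc j) \<le> b" by (simp add: rk_node_def)
  then show "rk_node a b N j + (b - a) / real N \<le> b" by (simp only: rk_node_Suc)
  show "a \<le> rk_node a b N j" using assms by (simp add: rk_node_def)
qed

text \<open>The index selected by \<open>LEAST\<close> in the definition of the output belongs to a step that contains \<open>t\<close>.\<close>

lemma rk_output_interval:
  assumes ab: "a < b" and N: "0 < N" and t: "t \<in> {a..b}"
  obtains j l where "j < N" "0 \<le> l" "l \<le> 1" "t = rk_node a b N j + l * ((b - a) / real N)"
    "rk_output \<tau> a b N \<eta>' f' \<omega> t = l *\<^sub>R (rk_value \<tau> a b N \<eta>' f' \<omega> (Suc j)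
      - rk_value \<tau> a b N \<eta>' f' \<omega> j) + rk_value \<tau> a b N \<eta>' f' \<omega> j"
proof -
  let ?node = "rk_node a b N" and ?V = "rk_value \<tau> a b N \<eta>' f' \<omega>"
  define h where "h = (b - a) / real N"
  have h: "0 < h" using ab N by (simp add: h_def)
  define j where "j = (LEAST j. t \<le> ?node (Suc j))"
  have bN: "?node (Suc (N - 1)) = b" using N by (simp add: rk_node_def)
  have ex: "t \<le> ?node (Suc (N - 1))" using t bN by simp
  then have 1: "t \<le> ?node (Suc j)" and "j \<le> N - 1"
    unfolding j_def by (rule LeastI, rule Least_le)
  then have j: "j < N" using N by simp
  have 2: "?node j \<le> t"
  proof (cases j)
    case 0
    then show ?thesis using t by (simp add: rk_node_def)
  next
    case (Suc i)
    then have "\<not> t \<le> ?node (Suc i)"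
      using not_less_Least[of i "\<lambda>j. t \<le> ?node (Suc j)"] j_def by simp
    then show ?thesis using Suc by simp
  qed
  show ?thesis
  proof (rule that[of j "(t - ?node j) / h"])
    show "(t - ?node j) / h \<le> 1" "0 \<le> (t - ?node j) / h" "j < N"
      using 1 2 j h by (auto simp: rk_node_Suc h_def[symmetric])
    show "t = ?node j + (t - ?node j) / h * ((b - a) / real N)"
      using h unfolding h_def[symmetric] by simp
    show "rk_output \<tau> a b N \<eta>' f' \<omega> t = ((t - ?node j) / h)
        *\<^sub>R (?V (Suc j) - ?V j) + ?V j"
      unfolding rk_output_def j_def[symmetric] Let_def using rk_node_Suc[of a b N j]
      by (simp add: h_def del: rk_value.simps)
  qed
qed

text \<open>The factor produced by the discrete Gronwall inequality, plus the interpolation error.\<close>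

definition (in ivp) rk_const :: real where
  "rk_const = (1 + (b - a) * L * H + (b - a) * (L * (b - a) + 1))
     * exp ((b - a) * L * (1 + (b - a) * L)) + 2 * H"

lemma (in ivp) rk_const_nonneg: "0 \<le> rk_const"
  using ab L H_nonneg by (simp add: rk_const_def)

locale rk_path = ivp a b K L \<rho> \<eta> f
  for a b K L \<rho> :: real and \<eta> :: "real ^ 'd" and f :: "'d rhs" +
  fixes \<delta> :: real and \<eta>' :: "real ^ 'd" and f' :: "'d rhs"
    and N :: nat and \<tau> :: "nat \<Rightarrow> 'w \<Rightarrow> real" and \<omega> :: 'w
  assumes \<delta>: "0 \<le> \<delta>" "\<delta> \<le> 1"
    and noise: "(\<eta>', f') \<in> noisy_data a b \<eta> f \<delta>"
    and N: "0 < N" and \<tau>: "\<And>j. j < N \<Longrightarrow> \<tau> (Suc j) \<omega> \<in> {0..1}"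
begin

abbreviation "T \<equiv> b - a"
definition "h = (b - a) / real N"
abbreviation "node j \<equiv> rk_node a b N j"
abbreviation "V j \<equiv> rk_value \<tau> a b N \<eta>' f' \<omega> j"
definition "\<theta> j = node j + \<tau> (Suc j) \<omega> * h"
definition "W j = V j + (h * \<tau> (Suc j) \<omega>) *\<^sub>R f' (node j, V j)"

lemma eta'_close: "norm1 (\<eta>' - \<eta>) \<le> \<delta>"
  using noise by (auto simp: noisy_data_def ball1_def)

lemma f'_close: "t \<in> {a..b} \<Longrightarrow> norm1 (f' (t, x) - f (t, x)) \<le> \<delta>"
  using noise by (auto simp: noisy_data_def)

lemma h_pos: "0 < h" and h_le: "h \<le> T" and hN: "h * real N = T"
proof -
  have "T * 1 \<le> T * real N" using ab N by (intro mult_left_mono) auto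
  then show "0 < h" "h \<le> T" "h * real N = T"
    using ab N by (auto simp: h_def field_simps)
qed

lemma node_Suc: "node (Suc j) = node j + h"
  by (simp add: rk_node_Suc h_def)

lemma node_le: "j \<le> N \<Longrightarrow> node j \<in> {a..b}"
proof -
  assume j: "j \<le> N"
  then have "real j * h \<le> real N * h" using h_pos by (intro mult_right_mono) auto
  then have "real j * h \<le> T" using hN by (simp add: mult.commute)
  moreover have "0 \<le> real j * h" using h_pos by simp
  ultimately show ?thesis by (simp add: rk_node_def h_def[symmetric])
qed

lemma theta_step: "j < N \<Longrightarrow> \<theta> j \<in> {node j..node (Suc j)}"
  using \<tau>[of j] h_pos by (auto simp: \<theta>_def node_Suc intro: mult_left_le_one_le)

lemma theta_le: "j < N \<Longrightarrow> \<theta> j \<in> {a..b}"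
  using theta_step[of j] node_le[of j] node_le[of "Suc j"] by auto

lemma V_Suc: "V (Suc j) = V j + h *\<^sub>R f' (\<theta> j, W j)"
  by (simp add: \<theta>_def W_def h_def Let_def)

subsection \<open>The iterates stay where the right-hand side is regular\<close>

text \<open>The perturbed right-hand side satisfies \<open>norm1 (f' (t, x)) \<le> K * U x\<close>. Measured by \<open>U\<close>, the noise
  therefore disappears from the recursion, and one step multiplies \<open>U\<close> by at most \<open>q\<close>.\<close>

definition "U x = norm1 x + 1 + \<delta> / K" for x :: "real ^ 'd"
definition "u0 = (K + 1) * (1 + \<delta> / K)"
definition "q = 1 + h * K * (1 + h * K)"

lemma f'_growth: "t \<in> {a..b} \<Longrightarrow> norm1 (f' (t, x)) \<le> K * U x"
proof -
  assume t: "t \<in> {a..b}"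
  have "norm1 (f' (t, x)) \<le> norm1 (f (t, x)) + norm1 (f' (t, x) - f (t, x))"
    using norm1_triangle[of "f (t, x)" "f' (t, x) - f (t, x)"] by simp
  also have "\<dots> \<le> K * (1 + norm1 x) + \<delta>"
    by (intro add_mono f_growth f'_close t)
  also have "\<dots> = K * U x" using K by (simp add: U_def field_simps)
  finally show ?thesis .
qed

lemma U_add: "U (x + y) \<le> U x + norm1 y"
  using norm1_triangle[of x y] by (simp add: U_def)

lemma U_nonneg: "0 \<le> U x"
  using \<delta> K by (simp add: U_def)

lemma u0_nonneg: "0 \<le> u0"
  using \<delta> K by (simp add: u0_def)

lemma W_minus_V: "j < N \<Longrightarrow> norm1 (W j - V j) \<le> h * K * U (V j)"
proof -
  assume j: "j < N"
  have "norm1 (W j - V j) = h * \<tau> (Suc j) \<omega> * norm1 (f' (node j, V j))"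
    using \<tau>[OF j] h_pos by (simp add: W_def)
  also have "\<dots> \<le> h * (K * U (V j))"
    using \<tau>[OF j] h_pos j
    by (intro mult_mono f'_growth node_le mult_right_le_one_le) auto
  finally show ?thesis by simp
qed

lemma V_growth: "j \<le> N \<Longrightarrow> norm1 (V j - \<eta>') \<le> u0 * (q ^ j - 1) \<and> U (V j) \<le> u0 * q ^ j"
proof (induction j)
  case 0
  have "norm1 \<eta>' \<le> K + \<delta>"
    using norm1_triangle[of \<eta> "\<eta>' - \<eta>"] eta'_close eta_le by simp
  moreover have "u0 = K + \<delta> + 1 + \<delta> / K" using K by (simp add: u0_def field_simps)
  ultimately have "U \<eta>' \<le> u0" by (simp add: U_def)
  then show ?case by simp
next
  case (Suc j)
  then have j: "j < N" by simp
  have hK: "0 \<le> h * K" using h_pos K by simp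
  have "U (W j) \<le> U (V j) + norm1 (W j - V j)"
    using U_add[of "V j" "W j - V j"] by simp
  also have "\<dots> \<le> U (V j) * (1 + h * K)"
    using W_minus_V[OF j] by (simp add: algebra_simps)
  finally have UW: "U (W j) \<le> U (V j) * (1 + h * K)" .
  have "norm1 (V (Suc j) - V j) = h * norm1 (f' (\<theta> j, W j))"
    using h_pos by (simp add: V_Suc del: rk_value.simps)
  also have "\<dots> \<le> h * (K * (U (V j) * (1 + h * K)))"
    using h_pos K UW f'_growth[OF theta_le[OF j], of "W j"]
    by (intro mult_left_mono order_trans[OF f'_growth[OF theta_le[OF j]]] mult_left_mono) auto
  also have "\<dots> = (q - 1) * U (V j)" by (simp add: q_def)
  also have "\<dots> \<le> (q - 1) * (u0 * q ^ j)"
    using Suc hK h_pos K by (intro mult_left_mono) (auto simp: q_def)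
  finally have step: "norm1 (V (Suc j) - V j) \<le> (q - 1) * (u0 * q ^ j)" .
  have "norm1 (V (Suc j) - \<eta>') \<le> norm1 (V (Suc j) - V j) + norm1 (V j - \<eta>')"
    by (rule norm1_triangle_mid)
  also have "\<dots> \<le> (q - 1) * (u0 * q ^ j) + u0 * (q ^ j - 1)"
    using step Suc by (intro add_mono) auto
  also have "\<dots> = u0 * (q ^ Suc j - 1)" by (simp add: algebra_simps)
  finally have 1: "norm1 (V (Suc j) - \<eta>') \<le> u0 * (q ^ Suc j - 1)" .
  have "U (V (Suc j)) \<le> U (V j) + norm1 (V (Suc j) - V j)"
    using U_add[of "V j" "V (Suc j) - V j"] by simp
  also have "\<dots> \<le> u0 * q ^ j + (q - 1) * (u0 * q ^ j)"
    using Suc step by (intro add_mono) auto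
  also have "\<dots> = u0 * q ^ Suc j" by (simp add: algebra_simps)
  finally show ?case using 1 by simp
qed

lemma q_power_le: "j \<le> N \<Longrightarrow> q ^ j \<le> exp (K * T * (1 + K * T))"
proof -
  assume j: "j \<le> N"
  have q1: "0 \<le> h * K * (1 + h * K)" using h_pos K by simp
  have "q ^ j \<le> q ^ N" using j q1 by (intro power_increasing) (auto simp: q_def)
  also have "\<dots> \<le> exp (h * K * (1 + h * K)) ^ N"
    using q1 exp_ge_add_one_self[of "h * K * (1 + h * K)"] by (intro power_mono) (auto simp: q_def)
  also have "\<dots> = exp ((h * real N) * K * (1 + h * K))"
    by (simp add: exp_of_nat_mult[symmetric] mult_ac)
  also have "\<dots> \<le> exp (K * T * (1 + K * T))"
    unfolding hN using ab K h_le by (simp add: mult.commute mult_left_mono)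
  finally show ?thesis .
qed

text \<open>This is the estimate that the second argument of the maximum in \<open>Rbar\<close> is designed for. With
  \<open>c = 1/K + 1\<close> one has \<open>c K = 1 + K\<close>, and the difference of the two sides is at least \<open>2 K\<close>.\<close>

lemma ball_bound: "\<delta> + u0 * (exp (K * T * (1 + K * T)) * (1 + K * T) - 1) \<le> R"
proof -
  define E where "E = exp (K * T * (1 + K * T))"
  define x where "x = E * (1 + K * T)"
  define c where "c = 1 / K + 1"
  have KT: "0 \<le> K * T" using ab K by simp
  have "1 \<le> E" unfolding E_def using KT by simp
  then have x1: "1 \<le> x" unfolding x_def using KT mult_mono[of 1 E 1 "1 + K * T"] by simp
  have cK: "c * K = 1 + K" using K by (simp add: c_def field_simps)
  have "u0 \<le> (K + 1) * c"
    unfolding u0_def c_def using \<delta> K by (intro mult_left_mono) (auto simp: field_simps)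
  then have "\<delta> + u0 * (x - 1) \<le> 1 + (K + 1) * c * (x - 1)"
    using x1 \<delta> by (intro add_mono mult_right_mono) auto
  also have "\<dots> \<le> K + T * (1 + K) + (c * (1 + K) * x - c * (1 + K * T))"
  proof -
    have "c * (1 + K * T) = c + T * (1 + K)" using cK by (simp add: distrib_left mult.assoc[symmetric] mult.commute)
    moreover have "(K + 1) * c * (x - 1) = c * (1 + K) * x - (c * K + c)" by (simp add: algebra_simps)
    ultimately show ?thesis using cK K by simp
  qed
  also have "c * (1 + K) * x - c * (1 + K * T) = c * (1 + K * T) * (E * (1 + K) - 1)"
    unfolding x_def right_diff_distrib[of "c * (1 + K * T)"] by (simp only: mult_ac mult_1_right)
  finally show ?thesis
    unfolding x_def c_def E_def Rbar_def by (simp add: max_def)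
qed

lemma VW_ball:
  assumes j: "j < N"
  shows "norm1 (V j - \<eta>) \<le> R" and "norm1 (W j - \<eta>) \<le> R"
proof -
  define E where "E = exp (K * T * (1 + K * T))"
  have KT: "0 \<le> K * T" using ab K by simp
  have qE: "q ^ j \<le> E" unfolding E_def using q_power_le j by simp
  have "0 \<le> q ^ j" unfolding q_def using h_pos K by simp
  have "norm1 (V j - \<eta>) + norm1 (W j - V j) \<le> \<delta> + u0 * (q ^ j - 1) + h * K * U (V j)"
    using norm1_triangle_mid[of "V j" \<eta> \<eta>'] eta'_close V_growth[of j] W_minus_V[of j] j by simp
  also have "\<dots> \<le> \<delta> + u0 * (q ^ j - 1) + (T * K) * (u0 * q ^ j)"
    using V_growth[of j] j h_le K ab U_nonneg
    by (intro add_left_mono mult_mono) auto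
  also have "\<dots> = \<delta> + u0 * (q ^ j * (1 + K * T) - 1)" by (simp add: algebra_simps)
  also have "\<dots> \<le> \<delta> + u0 * (E * (1 + K * T) - 1)"
    using qE KT u0_nonneg by (intro add_left_mono mult_left_mono diff_right_mono mult_right_mono) auto
  also have "\<dots> \<le> R" using ball_bound by (simp add: E_def)
  finally have *: "norm1 (V j - \<eta>) + norm1 (W j - V j) \<le> R" .
  show "norm1 (V j - \<eta>) \<le> R" using * norm1_nonneg[of "W j - V j"] by linarith
  show "norm1 (W j - \<eta>) \<le> R" using * norm1_triangle_mid[of "W j" \<eta> "V j"] by linarith
qed

subsection \<open>Error propagation\<close>

text \<open>The error at a node (\<open>e\<close>), the random quadrature error of one step (\<open>X\<close>), and the order of the local
  errors (\<open>hr\<close>).\<close>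

definition "e j = sol (node j) - V j"
definition "X j = sol (node (Suc j)) - sol (node j) - h *\<^sub>R g (\<theta> j)"
definition "hr = h powr \<rho> * h"

lemma hr_nonneg: "0 \<le> hr" using h_pos by (simp add: hr_def)

lemma f'_error:
  assumes "t \<in> {a..b}" "norm1 (x - \<eta>) \<le> R"
  shows "norm1 (g t - f' (t, x)) \<le> L * norm1 (sol t - x) + \<delta>"
proof -
  have "norm1 (g t - f' (t, x)) \<le> norm1 (g t - f (t, x)) + norm1 (f (t, x) - f' (t, x))"
    by (rule norm1_triangle_mid)
  also have "\<dots> \<le> L * norm1 (sol t - x) + \<delta>"
    using f'_close[OF assms(1), of x]
      f_Lipschitz[OF assms(1) solves_ball[OF solves_sol assms(1)] assms(2)]
    by (simp add: norm1_minus_commute[of "f (t, x)" "f' (t, x)"])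
  finally show ?thesis .
qed

lemma stage_error:
  assumes j: "j < N"
  shows "norm1 (sol (\<theta> j) - W j) \<le> (1 + T * L) * norm1 (e j) + H * hr + T * \<delta>"
proof -
  define s where "s = h * \<tau> (Suc j) \<omega>"
  have s: "0 \<le> s" "s \<le> h" using \<tau>[OF j] h_pos by (auto simp: s_def intro: mult_right_le_one_le)
  have th: "\<theta> j - node j = s" by (simp add: \<theta>_def s_def)
  let ?D = "sol (\<theta> j) - sol (node j) - (\<theta> j - node j) *\<^sub>R g (node j)"
  let ?G = "g (node j) - f' (node j, V j)"
  have eq: "sol (\<theta> j) - W j = (e j + ?D) + s *\<^sub>R ?G"
    unfolding th by (simp add: e_def W_def s_def algebra_simps)
  have "norm1 (sol (\<theta> j) - W j) \<le> norm1 (e j + ?D) + norm1 (s *\<^sub>R ?G)"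
    unfolding eq by (rule norm1_triangle)
  also have "\<dots> \<le> (norm1 (e j) + norm1 ?D) + s * norm1 ?G"
    using s by (intro add_mono norm1_triangle) simp
  also have "\<dots> \<le> (norm1 (e j) + H * hr) + T * (L * norm1 (e j) + \<delta>)"
  proof (intro add_mono order_refl)
    show "norm1 ?D \<le> H * hr" unfolding hr_def mult.assoc[symmetric]
      using node_le[of j] theta_le[OF j] j theta_step[OF j] s th
      by (intro sol_increment) auto
    show "s * norm1 ?G \<le> T * (L * norm1 (e j) + \<delta>)"
      using f'_error[OF node_le VW_ball(1)[OF j], of j] j s h_le
      by (intro mult_mono) (auto simp: e_def)
  qed
  finally show ?thesis by (simp add: algebra_simps)
qed

text \<open>The inhomogeneous part of the error recursion if the accumulated quadrature errors are bounded by \<open>s\<close>.\<close>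

definition "A0 s = \<delta> + s + T * (L * (H * hr + T * \<delta>) + \<delta>)"

text \<open>The quadrature errors are kept as a sum and not estimated one by one: only their partial sums
  enter, which is where the cancellation will be used.\<close>

lemma node_error:
  assumes s: "\<And>j. j \<le> N \<Longrightarrow> norm1 (\<Sum>i<j. X i) \<le> s" and j: "j \<le> N"
  shows "norm1 (e j) \<le> A0 s * exp (T * L * (1 + T * L))"
proof -
  define G where "G i = g (\<theta> i) - f' (\<theta> i, W i)" for i
  \<comment> \<open>Initial error, pure quadrature of \<open>g\<close>, and the effect of evaluating \<open>f'\<close> away from the solution.\<close>
  have rep: "e j = (e 0 + (\<Sum>i<j. X i)) + (\<Sum>i<j. h *\<^sub>R G i)" for j
  proof (induction j)
    case (Suc j)
    have "e (Suc j) = e j + X j + h *\<^sub>R G j"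
      unfolding e_def X_def G_def V_Suc by (simp add: algebra_simps)
    with Suc show ?case by simp
  qed simp
  have e0: "norm1 (e 0) \<le> \<delta>"
    using solves_sol eta'_close by (simp add: e_def rk_node_def solves_def norm1_minus_commute)
  have s0: "0 \<le> s" using s[of 0] by simp
  define B where "B = h * (L * (1 + T * L))"
  have B: "0 \<le> B" using h_pos L ab by (simp add: B_def)
  have A0: "0 \<le> A0 s" using s0 \<delta> ab L H_nonneg hr_nonneg by (simp add: A0_def)
  have "norm1 (e j) \<le> A0 s + B * (\<Sum>i<j. norm1 (e i))" if j: "j \<le> N" for j
  proof -
    let ?c = "L * (H * hr + T * \<delta>) + \<delta>"
    have c0: "0 \<le> ?c" using \<delta> ab L H_nonneg hr_nonneg by simp
    have "norm1 (h *\<^sub>R G i) \<le> B * norm1 (e i) + h * ?c" if i: "i < j" for i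
    proof -
      have iN: "i < N" using i j by simp
      have "norm1 (G i) \<le> L * norm1 (sol (\<theta> i) - W i) + \<delta>"
        unfolding G_def by (intro f'_error theta_le VW_ball iN)
      also have "\<dots> \<le> L * ((1 + T * L) * norm1 (e i) + H * hr + T * \<delta>) + \<delta>"
        using stage_error[OF iN] L by (intro add_mono mult_left_mono) auto
      finally have "h * norm1 (G i) \<le> h * (L * ((1 + T * L) * norm1 (e i) + H * hr + T * \<delta>) + \<delta>)"
        using h_pos by (intro mult_left_mono) auto
      then show ?thesis using h_pos by (simp add: B_def algebra_simps)
    qed
    then have "norm1 (\<Sum>i<j. h *\<^sub>R G i) \<le> (\<Sum>i<j. B * norm1 (e i) + h * ?c)"
      by (intro order_trans[OF norm1_sum] sum_mono) auto
    also have "\<dots> = B * (\<Sum>i<j. norm1 (e i)) + real j * h * ?c"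
      by (simp add: sum.distrib sum_distrib_left del: distrib_left_numeral)
    also have "real j * h * ?c \<le> T * ?c"
    proof (rule mult_right_mono[OF _ c0])
      show "real j * h \<le> T"
        using j h_pos hN mult_right_mono[of "real j" "real N" h] by (simp add: mult.commute)
    qed
    finally have "norm1 (\<Sum>i<j. h *\<^sub>R G i) \<le> B * (\<Sum>i<j. norm1 (e i)) + T * ?c" by simp
    moreover have "norm1 (e j) \<le> norm1 (e 0) + norm1 (\<Sum>i<j. X i) + norm1 (\<Sum>i<j. h *\<^sub>R G i)"
      unfolding rep[of j] by (meson add_right_mono norm1_triangle order_trans)
    ultimately show ?thesis using e0 s[OF j] by (simp add: A0_def)
  qed
  then have "norm1 (e j) \<le> A0 s * exp (B * real j)"
    using B A0 j by (rule discrete_Gronwall)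
  also have "\<dots> \<le> A0 s * exp (T * L * (1 + T * L))"
  proof -
    have "B * real j \<le> B * real N" using B j by (intro mult_left_mono) auto
    also have "\<dots> = (h * real N) * L * (1 + T * L)" by (simp add: B_def mult_ac)
    finally show ?thesis unfolding hN using A0 by (intro mult_left_mono) auto
  qed
  finally show ?thesis .
qed

lemma rk_path_error:
  assumes s: "\<And>j. j \<le> N \<Longrightarrow> norm1 (\<Sum>i<j. X i) \<le> s" and t: "t \<in> {a..b}"
  shows "norm1 (sol t - rk_output \<tau> a b N \<eta>' f' \<omega> t) \<le> rk_const * (s + hr + \<delta>)"
proof -
  obtain j l where j: "j < N" and l: "0 \<le> l" "l \<le> 1" and tj: "t = node j + l * h"
    and out: "rk_output \<tau> a b N \<eta>' f' \<omega> t = l *\<^sub>R (V (Suc j) - V j) + V j"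
    unfolding h_def by (rule rk_output_interval[OF ab N t])
  define x where "x = exp (T * L * (1 + T * L))"
  let ?D = "sol t - sol (node j) - (t - node j) *\<^sub>R g (node j)"
  let ?D' = "sol (node (Suc j)) - sol (node j) - (node (Suc j) - node j) *\<^sub>R g (node j)"
  have lh: "0 \<le> l * h" "l * h \<le> h" using l h_pos mult_right_mono[OF l(2), of h] by auto
  have nj: "a \<le> node j" "node j + h \<le> b"
    using node_le[of j] node_le[of "Suc j"] j by (auto simp: node_Suc)
  have D: "norm1 ?D \<le> H * hr" "norm1 ?D' \<le> H * hr"
    unfolding hr_def mult.assoc[symmetric]
  proof -
    have 1: "node j \<le> t" "t - node j \<le> h" "node j \<le> node (Suc j)" "node (Suc j) - node j \<le> h"
      using lh h_pos by (auto simp: tj node_Suc)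
    have 2: "t \<le> b" "node (Suc j) \<le> b" using t nj by (auto simp: node_Suc)
    show "norm1 ?D \<le> H * h powr \<rho> * h" "norm1 ?D' \<le> H * h powr \<rho> * h"
      by (rule sol_increment; use 1 2 nj in simp)+
  qed
  have "sol t - rk_output \<tau> a b N \<eta>' f' \<omega> t
      = ((1 - l) *\<^sub>R e j + l *\<^sub>R e (Suc j)) + (?D - l *\<^sub>R ?D')"
    unfolding out by (simp add: e_def tj node_Suc algebra_simps)
  then have "norm1 (sol t - rk_output \<tau> a b N \<eta>' f' \<omega> t)
      \<le> (norm1 ((1 - l) *\<^sub>R e j) + norm1 (l *\<^sub>R e (Suc j))) + (norm1 ?D + norm1 (l *\<^sub>R ?D'))"
    by (simp only:) (intro order_trans[OF norm1_triangle] add_mono norm1_triangle norm1_triangle_diff)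
  also have "\<dots> \<le> ((1 - l) * (A0 s * x) + l * (A0 s * x)) + (H * hr + 1 * (H * hr))"
    unfolding norm1_scaleR x_def using l node_error[OF s] j D H_nonneg hr_nonneg
    by (intro add_mono mult_mono) auto
  also have "\<dots> = A0 s * x + 2 * H * hr" by (simp add: algebra_simps)
  also have "\<dots> \<le> (1 + T * L * H + T * (L * T + 1)) * (s + hr + \<delta>) * x + 2 * H * (s + hr + \<delta>)"
  proof -
    have s0: "0 \<le> s" using s[of 0] by simp
    have "A0 s = (s + \<delta>) + T * L * H * hr + T * (L * T + 1) * \<delta>"
      by (simp add: A0_def algebra_simps)
    also have "\<dots> \<le> 1 * (s + hr + \<delta>) + T * L * H * (s + hr + \<delta>) + T * (L * T + 1) * (s + hr + \<delta>)"
      using s0 \<delta> hr_nonneg ab L H_nonneg by (intro add_mono mult_left_mono) auto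
    also have "\<dots> = (1 + T * L * H + T * (L * T + 1)) * (s + hr + \<delta>)"
      by (simp only: distrib_right)
    finally show ?thesis
      using s0 \<delta> hr_nonneg H_nonneg by (intro add_mono mult_right_mono mult_left_mono) (auto simp: x_def)
  qed
  also have "\<dots> = rk_const * (s + hr + \<delta>)" by (simp add: rk_const_def x_def algebra_simps)
  finally show ?thesis .
qed

end

section \<open>A maximal inequality for sums of independent bounded variables\<close>

context prob_space
begin

text \<open>The only consequence of independence that is needed: a function of the first \<open>n\<close> variables is
  uncorrelated with a function of the next one.\<close>

lemma expectation_past_times_present:
  fixes Y :: "nat \<Rightarrow> 'a \<Rightarrow> real" and G :: "(nat \<Rightarrow> real) \<Rightarrow> real" and \<phi> :: "real \<Rightarrow> real"
  assumes indep: "indep_vars (\<lambda>_. borel) Y UNIV"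
    and G: "G \<in> borel_measurable (PiM {..<n} (\<lambda>_. borel))" "integrable M (\<lambda>\<omega>. G (\<lambda>i\<in>{..<n}. Y i \<omega>))"
    and \<phi>: "\<phi> \<in> borel_measurable borel" "integrable M (\<lambda>\<omega>. \<phi> (Y n \<omega>))"
  shows "expectation (\<lambda>\<omega>. G (\<lambda>i\<in>{..<n}. Y i \<omega>) * \<phi> (Y n \<omega>))
    = expectation (\<lambda>\<omega>. G (\<lambda>i\<in>{..<n}. Y i \<omega>)) * expectation (\<lambda>\<omega>. \<phi> (Y n \<omega>))"
proof -
  have "indep_var (PiM {..<n} (\<lambda>_. borel)) (\<lambda>\<omega>. restrict (\<lambda>i. Y i \<omega>) {..<n})
      (PiM {n} (\<lambda>_. borel)) (\<lambda>\<omega>. restrict (\<lambda>i. Y i \<omega>) {n})"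
    by (rule indep_var_restrict[OF indep]) auto
  moreover have "(\<lambda>v. \<phi> (v n)) \<in> borel_measurable (PiM {n} (\<lambda>_. borel))"
    using \<phi>(1) by measurable
  ultimately have "indep_var borel (G \<circ> (\<lambda>\<omega>. restrict (\<lambda>i. Y i \<omega>) {..<n}))
      borel ((\<lambda>v. \<phi> (v n)) \<circ> (\<lambda>\<omega>. restrict (\<lambda>i. Y i \<omega>) {n}))"
    using G(1) by (intro indep_var_compose)
  then have "indep_var borel (\<lambda>\<omega>. G (\<lambda>i\<in>{..<n}. Y i \<omega>)) borel (\<lambda>\<omega>. \<phi> (Y n \<omega>))"
    by (simp add: o_def)
  from indep_var_lebesgue_integral[OF this G(2) \<phi>(2)] show ?thesis .
qed

end

text \<open>The running maximum of the submartingale \<open>cosh (l S\<^sub>k)\<close>, as a function of the sequence of increments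
  so that it can be restricted to the past.\<close>

definition running_max :: "real \<Rightarrow> (nat \<Rightarrow> real) \<Rightarrow> nat \<Rightarrow> real" where
  "running_max l v n = (MAX k\<in>{..n}. cosh (l * (\<Sum>i<k. v i)))"

lemma running_max_0: "running_max l v 0 = 1"
  by (simp add: running_max_def)

lemma running_max_Suc:
  "running_max l v (Suc n) = max (cosh (l * (\<Sum>i<Suc n. v i))) (running_max l v n)"
  unfolding running_max_def atMost_Suc image_insert by (rule Max_insert) auto

lemma running_max_ge: "k \<le> n \<Longrightarrow> cosh (l * (\<Sum>i<k. v i)) \<le> running_max l v n"
  unfolding running_max_def by (intro Max_ge) auto

lemma running_max_ge1: "1 \<le> running_max l v n"
  using running_max_ge[of 0 n l v] by simp

lemma running_max_restrict: "running_max l (restrict v {..<n}) n = running_max l v n"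
  unfolding running_max_def by (intro arg_cong[where f = Max] image_cong) auto

lemma measurable_running_max [measurable]:
  "(\<lambda>v. running_max l v n) \<in> borel_measurable (PiM {..<n} (\<lambda>_. borel))"
proof -
  have cosh: "cosh \<in> borel_measurable (borel :: real measure)"
    by (intro borel_measurable_continuous_onI continuous_intros)
  have "(\<lambda>v. cosh (l * (\<Sum>i<k. v i))) \<in> borel_measurable (PiM {..<n} (\<lambda>_. borel))"
    if "k \<le> n" for k
    using that cosh by (intro measurable_compose[OF _ cosh] borel_measurable_times borel_measurable_sum
        measurable_component_singleton) auto
  then show ?thesis
    unfolding running_max_def by (intro borel_measurable_Max) auto
qed

text \<open>Doob's \<open>L\<^sup>2\<close> inequality in pathwise form. Let \<open>d\<close> be the current value of a process and \<open>m\<close> its running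
  maximum. The potential \<open>m\<^sup>2 - 2 m d\<close> changes by at most \<open>- 2 m (d' - d)\<close>, which has nonpositive mean
  if the process is a submartingale. On the other hand \<open>m\<^sup>2 \<le> 4 d\<^sup>2 + 2 (m\<^sup>2 - 2 m d)\<close>, so a nonpositive
  mean of the potential yields \<open>E m\<^sup>2 \<le> 4 E d\<^sup>2\<close>.\<close>

lemma max_potential_step:
  fixes m d d' :: real
  shows "(max d' m)\<^sup>2 - 2 * max d' m * d' \<le> m\<^sup>2 - 2 * m * d - 2 * m * (d' - d)"
proof (cases "d' \<le> m")
  case False
  have "0 \<le> (m - d')\<^sup>2" by simp
  then show ?thesis using False by (simp add: max_def power2_eq_square algebra_simps)
qed (simp add: max_def algebra_simps)

text \<open>Convexity of \<open>cosh\<close>; the linear term vanishes in the mean, which makes \<open>cosh (l S\<^sub>n)\<close> a submartingale.\<close>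

lemma cosh_add_ge: "cosh x + y * sinh x \<le> cosh (x + y)" for x y :: real
proof -
  have c: "y * exp x \<le> exp (x + y) - exp x" "- y * exp (- x) \<le> exp (- x - y) - exp (- x)"
    using exp_ge_add_one_self[of y] exp_ge_add_one_self[of "- y"]
      mult_left_mono[of "1 + y" "exp y" "exp x"] mult_left_mono[of "1 - y" "exp (- y)" "exp (- x)"]
    by (auto simp: exp_add[symmetric] algebra_simps exp_diff exp_minus divide_inverse)
  show ?thesis
    using c by (simp add: cosh_def sinh_def field_simps)
qed

lemma cosh_le_cosh_bound:
  fixes x B :: real
  assumes "\<bar>x\<bar> \<le> B"
  shows "cosh x \<le> cosh B"
  using assms by (metis abs_ge_zero cosh_real_abs cosh_real_nonneg_le_iff order_trans)

context prob_space
begin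

text \<open>Hoeffding's lemma on the interval \<open>[-c, c]\<close>, first for positive and then for arbitrary arguments.\<close>

lemma exp_moment_bound_pos:
  fixes X :: "'a \<Rightarrow> real"
  assumes X: "X \<in> borel_measurable M" "\<And>\<omega>. \<bar>X \<omega>\<bar> \<le> c" "expectation X = 0" and m: "0 < m"
  shows "expectation (\<lambda>\<omega>. exp (m * X \<omega>)) \<le> exp (m\<^sup>2 * c\<^sup>2 / 2)"
proof -
  interpret X: interval_bounded_random_variable M X "- c" c
    by unfold_locales (use X abs_le_D1[OF X(2)] abs_le_D2[OF X(2)] in \<open>auto intro!: AE_I2 simp: minus_le_iff\<close>)
  have int: "integrable M (\<lambda>\<omega>. exp (m * X \<omega>))"
  proof (rule integrable_const_bound[where B = "exp (m * c)"])
    have "m * X \<omega> \<le> m * c" for \<omega> using abs_le_D1[OF X(2)] m by simp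
    then show "AE \<omega> in M. norm (exp (m * X \<omega>)) \<le> exp (m * c)" by simp
  qed (use X(1) in measurable)
  have "ennreal (expectation (\<lambda>\<omega>. exp (m * X \<omega>))) = (\<integral>\<^sup>+\<omega>. ennreal (exp (m * X \<omega>)) \<partial>M)"
    using int by (intro nn_integral_eq_integral[symmetric]) auto
  also have "\<dots> \<le> ennreal (exp (m\<^sup>2 * (c - - c)\<^sup>2 / 8))"
    by (rule X.Hoeffdings_lemma_nn_integral_0[OF m X(3)])
  also have "m\<^sup>2 * (c - - c)\<^sup>2 / 8 = m\<^sup>2 * c\<^sup>2 / 2" by (simp add: power2_eq_square)
  finally show ?thesis by simp
qed

lemma exp_moment_bound:
  fixes X :: "'a \<Rightarrow> real"
  assumes X: "X \<in> borel_measurable M" "\<And>\<omega>. \<bar>X \<omega>\<bar> \<le> c" "expectation X = 0"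
  shows "expectation (\<lambda>\<omega>. exp (m * X \<omega>)) \<le> exp (m\<^sup>2 * c\<^sup>2 / 2)"
proof (cases m "0 :: real" rule: linorder_cases)
  case greater
  then show ?thesis using exp_moment_bound_pos[OF X] by simp
next
  case less
  then show ?thesis using exp_moment_bound_pos[of "\<lambda>\<omega>. - X \<omega>" c "- m"] X by simp
qed (simp add: prob_space)

text \<open>Both signs of the partial sums are captured since \<open>cosh\<close> is even, and its square is again controlled
  by exponential moments because \<open>cosh\<^sup>2 x \<le> cosh (2 x)\<close>.\<close>

lemma maximal_inequality:
  fixes Y :: "nat \<Rightarrow> 'a \<Rightarrow> real"
  assumes indep: "indep_vars (\<lambda>_. borel) Y UNIV"
    and bound: "\<And>i \<omega>. \<bar>Y i \<omega>\<bar> \<le> c"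
    and mean: "\<And>i. expectation (Y i) = 0"
  shows "integrable M (\<lambda>\<omega>. (running_max l (\<lambda>i. Y i \<omega>) n)\<^sup>2)"
    and "expectation (\<lambda>\<omega>. (running_max l (\<lambda>i. Y i \<omega>) n)\<^sup>2)
      \<le> 4 * exp (2 * l\<^sup>2 * c\<^sup>2 * real n)"
proof -
  have Y [measurable]: "Y i \<in> borel_measurable M" for i
    using indep by (auto simp: indep_vars_def)
  define S where "S n \<omega> = (\<Sum>i<n. Y i \<omega>)" for n \<omega>
  define D where "D n \<omega> = cosh (l * S n \<omega>)" for n \<omega>
  define Q where "Q n \<omega> = running_max l (\<lambda>i. Y i \<omega>) n" for n \<omega>
  have c0: "0 \<le> c" using bound[of 0 undefined] abs_ge_zero order_trans by blast
  have S_meas [measurable]: "S n \<in> borel_measurable M" for n unfolding S_def by measurable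
  have contm: "(\<lambda>x. exp x) \<in> borel_measurable (borel :: real measure)"
     "cosh \<in> borel_measurable (borel :: real measure)" "sinh \<in> borel_measurable (borel :: real measure)"
    by (intro borel_measurable_continuous_onI continuous_intros)+
  have D_meas [measurable]: "D n \<in> borel_measurable M" for n
    unfolding D_def by (intro measurable_compose[OF _ contm(2)]) measurable
  have past: "(\<lambda>\<omega>. \<lambda>i\<in>{..<n}. Y i \<omega>) \<in> measurable M (PiM {..<n} (\<lambda>_. borel))" for n
    by (intro measurable_restrict) measurable
  have Q_restrict: "Q n \<omega> = running_max l (\<lambda>i\<in>{..<n}. Y i \<omega>) n" for n \<omega>
    unfolding Q_def by (rule running_max_restrict[symmetric])
  have Q_meas [measurable]: "Q n \<in> borel_measurable M" for n
    unfolding Q_restrict using measurable_compose[OF past measurable_running_max] by simp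
  have S_bound: "\<bar>S k \<omega>\<bar> \<le> real n * c" if "k \<le> n" for k n \<omega>
  proof -
    have "\<bar>S k \<omega>\<bar> \<le> (\<Sum>i<k. c)"
      unfolding S_def using bound by (intro order_trans[OF sum_abs] sum_mono) auto
    also have "\<dots> \<le> real n * c" using that c0 by (simp add: mult_right_mono)
    finally show ?thesis .
  qed
  have lS: "\<bar>l * S k \<omega>\<bar> \<le> \<bar>l\<bar> * (real n * c)" if "k \<le> n" for k n \<omega>
    using S_bound[OF that] by (simp add: abs_mult mult_left_mono)
  have D_bound: "D k \<omega> \<le> cosh (\<bar>l\<bar> * (real n * c))" if "k \<le> n" for k n \<omega>
    unfolding D_def using lS[OF that] by (rule cosh_le_cosh_bound)
  have D_ge1: "1 \<le> D n \<omega>" for n \<omega> unfolding D_def by (rule cosh_real_ge_1)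
  have Q_ge1: "1 \<le> Q n \<omega>" for n \<omega> unfolding Q_def by (rule running_max_ge1)
  have Q_bound: "Q n \<omega> \<le> cosh (\<bar>l\<bar> * (real n * c))" for n \<omega>
    unfolding Q_def running_max_def using D_bound by (subst Max_le_iff) (auto simp: D_def S_def)
  define C where "C n = cosh (\<bar>l\<bar> * (real n * c))" for n
  have bnd: "0 \<le> Q n \<omega>" "0 \<le> D n \<omega>" "Q n \<omega> \<le> C n" "D n \<omega> \<le> C n" for n \<omega>
    using Q_ge1[of n \<omega>] D_ge1[of n \<omega>] Q_bound[of n \<omega>] D_bound[of n n \<omega>] by (auto simp: C_def)
  have int_QQ: "integrable M (\<lambda>\<omega>. (Q n \<omega>)\<^sup>2)" for n
    by (rule integrable_const_bound[where B = "(C n)\<^sup>2"]) (use bnd in \<open>auto intro!: power_mono\<close>)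
  have int_DD: "integrable M (\<lambda>\<omega>. (D n \<omega>)\<^sup>2)" for n
    by (rule integrable_const_bound[where B = "(C n)\<^sup>2"]) (use bnd in \<open>auto intro!: power_mono\<close>)
  have int_QD: "integrable M (\<lambda>\<omega>. Q n \<omega> * D n \<omega>)" for n
    by (rule integrable_const_bound[where B = "C n * C n"]) (use bnd in \<open>auto intro!: AE_I2 mult_mono order_trans[OF bnd(1) bnd(3)] simp: abs_mult\<close>)
  note ints = Bochner_Integration.integrable_diff Bochner_Integration.integrable_add
    integrable_mult_right int_QQ int_QD int_DD
  have int_Y: "integrable M (Y i)" for i
    by (rule integrable_const_bound[where B = c]) (use bound in auto)
  have sinh_bound: "\<bar>sinh (l * S n \<omega>)\<bar> \<le> C n" for n \<omega>
  proof -
    have "\<bar>sinh (l * S n \<omega>)\<bar> \<le> D n \<omega>"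
      unfolding D_def using sinh_less_cosh_real[of "l * S n \<omega>"] sinh_less_cosh_real[of "- (l * S n \<omega>)"]
      by (simp add: abs_if)
    then show ?thesis using bnd(4)[of n \<omega>] by linarith
  qed
  have potential: "expectation (\<lambda>\<omega>. (Q n \<omega>)\<^sup>2 - 2 * (Q n \<omega> * D n \<omega>)) \<le> 0" for n
  proof (induction n)
    case 0
    have "(\<lambda>\<omega>. (Q 0 \<omega>)\<^sup>2 - 2 * (Q 0 \<omega> * D 0 \<omega>)) = (\<lambda>\<omega>. -1)"
      by (simp add: Q_def D_def S_def running_max_0)
    then show ?case by (simp add: prob_space)
  next
    case (Suc n)
    define G where "G v = - 2 * running_max l v n * l * sinh (l * (\<Sum>i<n. v i))" for v
    have G_eq: "G (\<lambda>i\<in>{..<n}. Y i \<omega>) = - 2 * Q n \<omega> * l * sinh (l * S n \<omega>)" for \<omega>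
      by (simp add: G_def Q_restrict S_def)
    have G_meas: "G \<in> borel_measurable (PiM {..<n} (\<lambda>_. borel))"
      unfolding G_def
      by (intro borel_measurable_times borel_measurable_const measurable_running_max
          measurable_compose[OF _ contm(3)] borel_measurable_sum measurable_component_singleton) auto
    have G_int: "integrable M (\<lambda>\<omega>. G (\<lambda>i\<in>{..<n}. Y i \<omega>))"
    proof (rule integrable_const_bound[where B = "2 * C n * \<bar>l\<bar> * C n"])
      show "(\<lambda>\<omega>. G (\<lambda>i\<in>{..<n}. Y i \<omega>)) \<in> borel_measurable M"
        by (rule measurable_compose[OF past G_meas])
      have "\<bar>2 * Q n \<omega> * l * sinh (l * S n \<omega>)\<bar> \<le> 2 * C n * \<bar>l\<bar> * C n" for \<omega>
        unfolding abs_mult using bnd[of n \<omega>] sinh_bound[of n \<omega>]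
        by (intro mult_mono) auto
      then show "AE \<omega> in M. norm (G (\<lambda>i\<in>{..<n}. Y i \<omega>)) \<le> 2 * C n * \<bar>l\<bar> * C n"
        unfolding G_eq by (simp add: abs_mult)
    qed
    have GY: "expectation (\<lambda>\<omega>. G (\<lambda>i\<in>{..<n}. Y i \<omega>) * Y n \<omega>) = 0"
      using expectation_past_times_present[OF indep G_meas G_int , of "\<lambda>x. x"] int_Y[of n] mean[of n]
      by (simp only: mult_zero_right measurable_ident_sets[OF refl] True_implies_equals simp_thms)
    have int_GY: "integrable M (\<lambda>\<omega>. G (\<lambda>i\<in>{..<n}. Y i \<omega>) * Y n \<omega>)"
    proof (rule Bochner_Integration.integrable_bound[OF integrable_mult_left[OF G_int, of c]])
      show "(\<lambda>\<omega>. G (\<lambda>i\<in>{..<n}. Y i \<omega>) * Y n \<omega>) \<in> borel_measurable M"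
        using measurable_compose[OF past G_meas] by measurable
      show "AE \<omega> in M. norm (G (\<lambda>i\<in>{..<n}. Y i \<omega>) * Y n \<omega>) \<le> norm (G (\<lambda>i\<in>{..<n}. Y i \<omega>) * c)"
        using bound c0 by (intro AE_I2) (simp add: abs_mult mult_left_mono)
    qed
    have "expectation (\<lambda>\<omega>. (Q (Suc n) \<omega>)\<^sup>2 - 2 * (Q (Suc n) \<omega> * D (Suc n) \<omega>))
        \<le> expectation (\<lambda>\<omega>. ((Q n \<omega>)\<^sup>2 - 2 * (Q n \<omega> * D n \<omega>)) + G (\<lambda>i\<in>{..<n}. Y i \<omega>) * Y n \<omega>)"
    proof (rule integral_mono)
      fix \<omega>
      have Q_Suc: "Q (Suc n) \<omega> = max (D (Suc n) \<omega>) (Q n \<omega>)"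
        unfolding Q_def D_def S_def by (rule running_max_Suc)
      have "D n \<omega> + (l * Y n \<omega>) * sinh (l * S n \<omega>) \<le> D (Suc n) \<omega>"
        using cosh_add_ge[of "l * S n \<omega>" "l * Y n \<omega>"] by (simp add: D_def S_def distrib_left)
      then have "2 * Q n \<omega> * ((l * Y n \<omega>) * sinh (l * S n \<omega>)) \<le> 2 * Q n \<omega> * (D (Suc n) \<omega> - D n \<omega>)"
        using bnd[of n \<omega>] by (intro mult_left_mono) auto
      then show "(Q (Suc n) \<omega>)\<^sup>2 - 2 * (Q (Suc n) \<omega> * D (Suc n) \<omega>)
          \<le> ((Q n \<omega>)\<^sup>2 - 2 * (Q n \<omega> * D n \<omega>)) + G (\<lambda>i\<in>{..<n}. Y i \<omega>) * Y n \<omega>"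
        using max_potential_step[of "D (Suc n) \<omega>" "Q n \<omega>" "D n \<omega>"] unfolding Q_Suc G_eq
        by (simp add: mult_ac)
    qed (intro ints int_GY)+
    also have "\<dots> = expectation (\<lambda>\<omega>. (Q n \<omega>)\<^sup>2 - 2 * (Q n \<omega> * D n \<omega>))"
      using GY by (subst Bochner_Integration.integral_add)
        (auto intro!: int_QQ int_QD int_GY)
    finally show ?case using Suc by simp
  qed
  have exp_moment: "integrable M (\<lambda>\<omega>. exp (m * S n \<omega>))
      \<and> expectation (\<lambda>\<omega>. exp (m * S n \<omega>)) \<le> exp (m\<^sup>2 * c\<^sup>2 / 2 * real n)" for m n
  proof (induction n)
    case 0
    show ?case by (simp add: S_def prob_space)
  next
    case (Suc n)
    have int: "integrable M (\<lambda>\<omega>. exp (m * Y n \<omega>))"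
    proof (rule integrable_const_bound[where B = "exp (\<bar>m\<bar> * c)"])
      have "m * Y n \<omega> \<le> \<bar>m\<bar> * c" for \<omega>
        using bound[of n \<omega>] abs_ge_self[of "m * Y n \<omega>"] mult_left_mono[of "\<bar>Y n \<omega>\<bar>" c "\<bar>m\<bar>"]
        by (simp add: abs_mult)
      then show "AE \<omega> in M. norm (exp (m * Y n \<omega>)) \<le> exp (\<bar>m\<bar> * c)" by simp
    qed measurable
    have one: "expectation (\<lambda>\<omega>. exp (m * Y n \<omega>)) \<le> exp (m\<^sup>2 * c\<^sup>2 / 2)"
      by (rule exp_moment_bound) (use bound mean in auto)
    have "(\<lambda>v. exp (m * (\<Sum>i<n. v i))) \<in> borel_measurable (PiM {..<n} (\<lambda>_. borel :: real measure))"
      by (intro measurable_compose[OF _ contm(1)] borel_measurable_times borel_measurable_const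
          borel_measurable_sum measurable_component_singleton) auto
    moreover have S_r: "(\<Sum>i<n. (\<lambda>i\<in>{..<n}. Y i \<omega>) i) = S n \<omega>" for \<omega> by (simp add: S_def)
    ultimately have "expectation (\<lambda>\<omega>. exp (m * S n \<omega>) * exp (m * Y n \<omega>))
        = expectation (\<lambda>\<omega>. exp (m * S n \<omega>)) * expectation (\<lambda>\<omega>. exp (m * Y n \<omega>))"
      using expectation_past_times_present[OF indep, of "\<lambda>v. exp (m * (\<Sum>i<n. v i))" n "\<lambda>y. exp (m * y)"]
        Suc int by (simp add: S_r cong: restrict_cong)
    also have "\<dots> \<le> exp (m\<^sup>2 * c\<^sup>2 / 2 * real n) * exp (m\<^sup>2 * c\<^sup>2 / 2)"
      using Suc one by (intro mult_mono) auto
    also have "\<dots> = exp (m\<^sup>2 * c\<^sup>2 / 2 * real (Suc n))"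
      unfolding exp_add[symmetric] by (simp add: distrib_left add.commute)
    finally have 1: "expectation (\<lambda>\<omega>. exp (m * S n \<omega>) * exp (m * Y n \<omega>))
      \<le> exp (m\<^sup>2 * c\<^sup>2 / 2 * real (Suc n))" .
    have eq: "exp (m * S (Suc n) \<omega>) = exp (m * S n \<omega>) * exp (m * Y n \<omega>)" for \<omega>
      by (simp add: S_def exp_add[symmetric] distrib_left)
    have "integrable M (\<lambda>\<omega>. exp (m * S n \<omega>) * exp (m * Y n \<omega>))"
      unfolding eq[symmetric]
    proof (rule integrable_const_bound[where B = "exp (\<bar>m\<bar> * (real (Suc n) * c))"])
      have "m * S (Suc n) \<omega> \<le> \<bar>m\<bar> * (real (Suc n) * c)" for \<omega>
        using S_bound[of "Suc n" "Suc n" \<omega>] abs_ge_self[of "m * S (Suc n) \<omega>"]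
          mult_left_mono[of "\<bar>S (Suc n) \<omega>\<bar>" "real (Suc n) * c" "\<bar>m\<bar>"]
        by (simp add: abs_mult)
      then show "AE \<omega> in M. norm (exp (m * S (Suc n) \<omega>)) \<le> exp (\<bar>m\<bar> * (real (Suc n) * c))" by simp
    qed measurable
    then show ?case using 1 by (simp only: eq)
  qed
  have "expectation (\<lambda>\<omega>. (Q n \<omega>)\<^sup>2)
      \<le> expectation (\<lambda>\<omega>. 4 * (D n \<omega>)\<^sup>2 + 2 * ((Q n \<omega>)\<^sup>2 - 2 * (Q n \<omega> * D n \<omega>)))"
  proof (rule integral_mono)
    fix \<omega>
    have "0 \<le> (Q n \<omega> - 2 * D n \<omega>)\<^sup>2" by simp
    then show "(Q n \<omega>)\<^sup>2 \<le> 4 * (D n \<omega>)\<^sup>2 + 2 * ((Q n \<omega>)\<^sup>2 - 2 * (Q n \<omega> * D n \<omega>))"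
      by (simp add: power2_eq_square algebra_simps)
  qed (intro ints)+
  also have "\<dots> = 4 * expectation (\<lambda>\<omega>. (D n \<omega>)\<^sup>2)
      + 2 * expectation (\<lambda>\<omega>. (Q n \<omega>)\<^sup>2 - 2 * (Q n \<omega> * D n \<omega>))"
    by (subst Bochner_Integration.integral_add)
       (intro ints | simp only: integral_mult_right_zero)+
  also have "\<dots> \<le> 4 * expectation (\<lambda>\<omega>. (D n \<omega>)\<^sup>2)" using potential[of n] by simp
  also have "expectation (\<lambda>\<omega>. (D n \<omega>)\<^sup>2)
      \<le> expectation (\<lambda>\<omega>. (exp (2 * l * S n \<omega>) + exp ((- 2 * l) * S n \<omega>)) / 2)"
  proof (rule integral_mono)
    fix \<omega>
    have "(D n \<omega>)\<^sup>2 = (cosh (2 * (l * S n \<omega>)) + 1) / 2"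
      unfolding D_def by (simp add: cosh_double_cosh)
    also have "\<dots> \<le> cosh (2 * (l * S n \<omega>))" using cosh_real_ge_1[of "2 * (l * S n \<omega>)"] by simp
    finally show "(D n \<omega>)\<^sup>2 \<le> (exp (2 * l * S n \<omega>) + exp ((- 2 * l) * S n \<omega>)) / 2"
      by (simp add: cosh_def mult.assoc)
  qed (use int_DD exp_moment[of "2 * l" n] exp_moment[of "- 2 * l" n] in auto)
  also have "\<dots> \<le> exp (2 * l\<^sup>2 * c\<^sup>2 * real n)"
    using exp_moment[of "2 * l" n] exp_moment[of "- 2 * l" n]
    by (simp add: power_mult_distrib mult_ac)
  finally show "expectation (\<lambda>\<omega>. (running_max l (\<lambda>i. Y i \<omega>) n)\<^sup>2) \<le> 4 * exp (2 * l\<^sup>2 * c\<^sup>2 * real n)"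
    by (simp add: Q_def)
  show "integrable M (\<lambda>\<omega>. (running_max l (\<lambda>i. Y i \<omega>) n)\<^sup>2)"
    using int_QQ[of n] by (simp add: Q_def)
qed

text \<open>The choice \<open>l = 1 / (c \<surd>n)\<close> balances the exponential moment, which becomes a constant. The power is
  absorbed by \<open>(x / p)\<^sup>p \<le> e\<^sup>x\<close>.\<close>

lemma maximal_moment:
  fixes Y :: "nat \<Rightarrow> 'a \<Rightarrow> real"
  assumes indep: "indep_vars (\<lambda>_. borel) Y UNIV"
    and bound: "\<And>i \<omega>. \<bar>Y i \<omega>\<bar> \<le> c"
    and mean: "\<And>i. expectation (Y i) = 0" and c: "0 < c" and n: "0 < n" and p: "0 < p"
  shows "(\<integral>\<^sup>+\<omega>. ennreal ((MAX k\<in>{..n}. \<bar>\<Sum>i<k. Y i \<omega>\<bar>) powr p) \<partial>M)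
    \<le> ennreal (8 * exp 2 * p powr p * (c * sqrt (real n)) powr p)"
proof -
  define l where "l = 1 / (c * sqrt (real n))"
  define C where "C = 2 * p powr p * (c * sqrt (real n)) powr p"
  have l: "0 < l" using c n by (simp add: l_def)
  have lc: "l\<^sup>2 * c\<^sup>2 * real n = 1"
    using c n by (simp add: l_def power_divide power_mult_distrib)
  have C: "0 \<le> C" by (simp add: C_def)
  note mi = maximal_inequality[OF indep bound mean, of l n]
  have one: "\<bar>\<Sum>i<k. Y i \<omega>\<bar> powr p \<le> C * (running_max l (\<lambda>i. Y i \<omega>) n)\<^sup>2" if "k \<le> n" for k \<omega>
  proof -
    define x where "x = \<bar>l * (\<Sum>i<k. Y i \<omega>)\<bar>"
    have x: "0 \<le> x" by (simp add: x_def)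
    have "(x / p) powr p \<le> exp (x / p) powr p"
      using x p exp_ge_add_one_self[of "x / p"] by (intro powr_mono2) (simp, simp, linarith)
    also have "\<dots> = exp x" using p by (simp add: powr_def)
    also have "\<dots> \<le> 2 * cosh x" by (simp add: cosh_def)
    also have "\<dots> \<le> 2 * running_max l (\<lambda>i. Y i \<omega>) n"
      using running_max_ge[OF that, of l "\<lambda>i. Y i \<omega>"] by (simp add: x_def)
    also have "\<dots> \<le> 2 * (running_max l (\<lambda>i. Y i \<omega>) n)\<^sup>2"
      using running_max_ge1[of l "\<lambda>i. Y i \<omega>" n] by (simp add: power2_eq_square)
    finally have "(x / p) powr p \<le> 2 * (running_max l (\<lambda>i. Y i \<omega>) n)\<^sup>2" .
    then have "(p * (c * sqrt (real n))) powr p * (x / p) powr p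
        \<le> (p * (c * sqrt (real n))) powr p * (2 * (running_max l (\<lambda>i. Y i \<omega>) n)\<^sup>2)"
      by (intro mult_left_mono) auto
    also have "(p * (c * sqrt (real n))) powr p * (x / p) powr p = \<bar>\<Sum>i<k. Y i \<omega>\<bar> powr p"
    proof -
      have "p * (c * sqrt (real n)) * (x / p) = \<bar>\<Sum>i<k. Y i \<omega>\<bar>"
        using p c n by (simp add: x_def l_def abs_mult)
      then show ?thesis using p c x by (simp add: powr_mult[symmetric])
    qed
    also have "(p * (c * sqrt (real n))) powr p * (2 * (running_max l (\<lambda>i. Y i \<omega>) n)\<^sup>2)
        = C * (running_max l (\<lambda>i. Y i \<omega>) n)\<^sup>2"
      using p c by (simp add: C_def powr_mult)
    finally show ?thesis .
  qed
  have "(\<integral>\<^sup>+\<omega>. ennreal ((MAX k\<in>{..n}. \<bar>\<Sum>i<k. Y i \<omega>\<bar>) powr p) \<partial>M)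
      \<le> (\<integral>\<^sup>+\<omega>. ennreal (C * (running_max l (\<lambda>i. Y i \<omega>) n)\<^sup>2) \<partial>M)"
  proof (intro nn_integral_mono ennreal_leI)
    fix \<omega>
    have "(MAX k\<in>{..n}. \<bar>\<Sum>i<k. Y i \<omega>\<bar>) \<in> (\<lambda>k. \<bar>\<Sum>i<k. Y i \<omega>\<bar>) ` {..n}"
      by (intro Max_in) auto
    then obtain k where "k \<le> n" "(MAX k\<in>{..n}. \<bar>\<Sum>i<k. Y i \<omega>\<bar>) = \<bar>\<Sum>i<k. Y i \<omega>\<bar>"
      by (rule imageE) simp
    then show "(MAX k\<in>{..n}. \<bar>\<Sum>i<k. Y i \<omega>\<bar>) powr p \<le> C * (running_max l (\<lambda>i. Y i \<omega>) n)\<^sup>2"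
      using one by simp
  qed
  also have "\<dots> = ennreal (expectation (\<lambda>\<omega>. C * (running_max l (\<lambda>i. Y i \<omega>) n)\<^sup>2))"
    using mi(1) C by (intro nn_integral_eq_integral) auto
  also have "\<dots> \<le> ennreal (C * (4 * exp 2))"
    using mi(2) C lc by (intro ennreal_leI) (simp add: mult.assoc mult_left_mono)
  also have "C * (4 * exp 2) = 8 * exp 2 * p powr p * (c * sqrt (real n)) powr p"
    by (simp add: C_def)
  finally show ?thesis .
qed

end

section \<open>The upper bound for the Runge-Kutta method\<close>

definition unit_clamp :: "real \<Rightarrow> real" where
  "unit_clamp x = min 1 (max 0 x)"

lemma unit_clamp_bounds: "0 \<le> unit_clamp x" "unit_clamp x \<le> 1"
  by (auto simp: unit_clamp_def)

lemma unit_clamp_continuous: "continuous_on UNIV unit_clamp"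
  unfolding unit_clamp_def by (intro continuous_intros)

lemma ennreal_powr_mono_le:
  assumes "x \<le> ennreal r" "0 \<le> r" "0 \<le> q"
  shows "ennreal_powr x q \<le> ennreal (r powr q)"
proof -
  have "x \<noteq> \<top>" using assms(1) by (metis ennreal_neq_top top.extremum_uniqueI)
  moreover have "enn2real x \<le> r" using assms by (simp add: enn2real_leI)
  ultimately show ?thesis
    using assms by (auto simp: ennreal_powr_def intro!: ennreal_leI powr_mono2)
qed

lemma Lp_norm_le:
  assumes "0 < p" "0 \<le> B"
    and "(\<integral>\<^sup>+ \<omega>. ennreal_powr (X \<omega>) p \<partial>M) \<le> ennreal B"
  shows "Lp_norm M p X \<le> ennreal (B powr (1 / p))"
  unfolding Lp_norm_def using assms by (intro ennreal_powr_mono_le) auto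

lemma ennreal_scaled_sum:
  assumes "0 \<le> C" "\<And>i. i \<in> A \<Longrightarrow> 0 \<le> x i" "0 \<le> y"
  shows "ennreal (C * ((\<Sum>i\<in>A. x i) + y)) = ennreal C * ((\<Sum>i\<in>A. ennreal (x i)) + ennreal y)"
  using assms by (simp add: ennreal_mult sum_nonneg)

lemma sum_powr_le:
  fixes x :: "'i \<Rightarrow> real"
  assumes A: "finite A" and x: "\<And>i. i \<in> A \<Longrightarrow> 0 \<le> x i" and y: "0 \<le> y" and p: "0 \<le> p"
  shows "((\<Sum>i\<in>A. x i) + y) powr p \<le> (real (card A) + 1) powr p * ((\<Sum>i\<in>A. x i powr p) + y powr p)"
proof -
  define m where "m = Max (insert y (x ` A))"
  have le: "y \<le> m" "\<And>i. i \<in> A \<Longrightarrow> x i \<le> m" using A by (auto simp: m_def)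
  have m0: "0 \<le> m" using le(1) y by linarith
  have "m \<in> insert y (x ` A)" unfolding m_def using A by (intro Max_in) auto
  then have mp: "m powr p \<le> (\<Sum>i\<in>A. x i powr p) + y powr p"
  proof
    assume "m = y"
    then show ?thesis by (simp add: sum_nonneg)
  next
    assume "m \<in> x ` A"
    then obtain i where i: "i \<in> A" "m = x i" by auto
    have "x i powr p \<le> (\<Sum>i\<in>A. x i powr p)" using i A by (intro member_le_sum) auto
    then show ?thesis using i by (simp add: add_increasing2)
  qed
  have "(\<Sum>i\<in>A. x i) \<le> (\<Sum>i\<in>A. m)" using le by (intro sum_mono) auto
  then have "(\<Sum>i\<in>A. x i) + y \<le> (real (card A) + 1) * m" using le by (simp add: distrib_right)
  then have "((\<Sum>i\<in>A. x i) + y) powr p \<le> ((real (card A) + 1) * m) powr p"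
    using x y p by (intro powr_mono2) (auto intro: add_nonneg_nonneg sum_nonneg)
  also have "\<dots> = (real (card A) + 1) powr p * m powr p" using m0 by (simp add: powr_mult)
  also have "\<dots> \<le> (real (card A) + 1) powr p * ((\<Sum>i\<in>A. x i powr p) + y powr p)"
    using mp by (intro mult_left_mono) auto
  finally show ?thesis .
qed

text \<open>The random variables of the method are numbered from one, the steps from zero.\<close>

lemma (in prob_space) indep_vars_Suc:
  assumes indep: "indep_vars (\<lambda>_. N) X {1 :: nat..}"
  shows "indep_vars (\<lambda>_. N) (\<lambda>j. X (Suc j)) UNIV"
proof -
  define E where "E j = {X j -` A \<inter> space M |A. A \<in> sets N}" for j
  have rv: "\<forall>j\<in>{1..}. random_variable N (X j)" and E: "indep_sets E {1..}"
    using indep unfolding indep_vars_def2 E_def by auto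
  have "indep_sets (\<lambda>j. E (Suc j)) UNIV"
  proof (rule indep_setsI)
    show "E (Suc j) \<subseteq> events" for j using E by (auto simp: indep_sets_def)
    fix A J assume J: "J \<noteq> {}" "finite J" and A: "\<forall>j\<in>J. A j \<in> E (Suc j)"
    have "prob (\<Inter>j\<in>Suc ` J. A (j - 1)) = (\<Prod>j\<in>Suc ` J. prob (A (j - 1)))"
      using J A by (intro indep_setsD[OF E]) auto
    also have "(\<Prod>j\<in>Suc ` J. prob (A (j - 1))) = (\<Prod>j\<in>J. prob (A j))"
      by (subst prod.reindex) auto
    finally show "prob (\<Inter>j\<in>J. A j) = (\<Prod>j\<in>J. prob (A j))" by simp
  qed
  then show ?thesis using rv unfolding indep_vars_def2 E_def by simp
qed

locale random_source = prob_space M for M :: "'w measure" +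
  fixes \<tau> :: "nat \<Rightarrow> 'w \<Rightarrow> real"
  assumes source: "(M, \<tau>) \<in> random_sources"
begin

lemma \<tau>_indep: "indep_vars (\<lambda>_. borel) \<tau> {1..}"
  and \<tau>_distr: "1 \<le> j \<Longrightarrow> distr M borel (\<tau> j) = uniform_measure lborel {0..1}"
  using source by (auto simp: random_sources_def)

lemma \<tau>_measurable: "1 \<le> j \<Longrightarrow> \<tau> j \<in> borel_measurable M"
  using \<tau>_indep by (auto simp: indep_vars_def)

lemma \<tau>_unit: "1 \<le> j \<Longrightarrow> AE \<omega> in M. \<tau> j \<omega> \<in> {0..1}"
proof -
  assume j: "1 \<le> j"
  have "AE x in uniform_measure lborel {0..1}. x \<in> {0..1::real}"
    by (intro AE_uniform_measureI) auto
  then show ?thesis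
    unfolding \<tau>_distr[OF j, symmetric] using \<tau>_measurable[OF j] by (subst (asm) AE_distr_iff) auto
qed

lemma \<tau>_unit_all: "AE \<omega> in M. \<forall>j<N. \<tau> (Suc j) \<omega> \<in> {0..1}"
  unfolding AE_all_countable using \<tau>_unit[of "Suc _"] by (auto intro!: AE_all_countable[THEN iffD2])

lemma \<tau>_expectation:
  fixes \<psi> :: "real \<Rightarrow> real"
  assumes j: "1 \<le> j" and \<psi>: "\<psi> \<in> borel_measurable borel"
  shows "expectation (\<lambda>\<omega>. \<psi> (\<tau> j \<omega>)) = (\<integral>x. indicator {0..1} x *\<^sub>R \<psi> x \<partial>lborel)"
proof -
  have "expectation (\<lambda>\<omega>. \<psi> (\<tau> j \<omega>)) = (\<integral>x. \<psi> x \<partial>distr M borel (\<tau> j))"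
    using \<tau>_measurable[OF j] \<psi> by (subst integral_distr) auto
  also have "distr M borel (\<tau> j) = density lborel (\<lambda>x. ennreal (indicator {0..1} x))"
    unfolding \<tau>_distr[OF j] uniform_measure_def by (simp add: ennreal_indicator divide_ennreal_def)
  also have "(\<integral>x. \<psi> x \<partial>\<dots>) = (\<integral>x. indicator {0..1} x *\<^sub>R \<psi> x \<partial>lborel)"
    using \<psi> by (subst integral_density) auto
  finally show ?thesis .
qed

end

locale ivp_random = ivp a b K L \<rho> \<eta> f + random_source M \<tau>
  for a b K L \<rho> :: real and \<eta> :: "real ^ 'd" and f :: "'d rhs"
    and M :: "'w measure" and \<tau> :: "nat \<Rightarrow> 'w \<Rightarrow> real" +
  fixes N :: nat
  assumes N: "0 < N"
begin

abbreviation "T \<equiv> b - a"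
definition step :: real where "step = (b - a) / real N"
abbreviation "node \<equiv> rk_node a b N"

text \<open>A component of the quadrature error of step \<open>j\<close> as a function of the random variable. The uniform
  variables lie in \<open>[0,1]\<close> only almost surely, and \<open>g\<close> is only known on \<open>[a,b]\<close>; clamping gives a
  function that is continuous and bounded everywhere.\<close>

definition \<xi> :: "'d \<Rightarrow> nat \<Rightarrow> real \<Rightarrow> real" where
  "\<xi> k j x = (if j < N
     then (sol (node (Suc j)) - sol (node j) - step *\<^sub>R g (node j + unit_clamp x * step)) $ k else 0)"

lemma step_pos: "0 < step" using ab N by (simp add: step_def)

lemma node_Suc: "node (Suc j) = node j + step"
  by (simp add: rk_node_Suc step_def)

lemma node_bounds: "j < N \<Longrightarrow> a \<le> node j" "j < N \<Longrightarrow> node j + step \<le> b"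
  using rk_node_bounds[OF ab] by (auto simp: step_def)

lemma \<xi>_bound: "\<bar>\<xi> k j x\<bar> \<le> H * (step powr \<rho> * step)"
proof (cases "j < N")
  case True
  define s where "s = unit_clamp x * step"
  have s: "0 \<le> s" "s \<le> step"
    using step_pos unit_clamp_bounds[of x] mult_right_mono[of "unit_clamp x" 1 step] by (auto simp: s_def)
  have "norm1 (sol (node (Suc j)) - sol (node j) - (node (Suc j) - node j) *\<^sub>R g (node j + s))
      \<le> H * step powr \<rho> * step"
    using node_bounds[OF True] s step_pos by (intro sol_increment) (auto simp: node_Suc)
  then show ?thesis
    using True component_le_norm1[of "sol (node (Suc j)) - sol (node j) - step *\<^sub>R g (node j + s)" k]
    by (simp add: \<xi>_def s_def node_Suc mult.assoc)
qed (use H_nonneg step_pos in \<open>simp add: \<xi>_def\<close>)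

lemma \<xi>_continuous: "continuous_on UNIV (\<xi> k j)"
proof (cases "j < N")
  case True
  have "continuous_on UNIV (\<lambda>x. g (node j + unit_clamp x * step))"
  proof (rule continuous_on_compose2[OF g_cont])
    show "continuous_on UNIV (\<lambda>x. node j + unit_clamp x * step)"
      by (intro continuous_intros unit_clamp_continuous)
    show "range (\<lambda>x. node j + unit_clamp x * step) \<subseteq> {a..b}"
    proof safe
      fix x :: real
      have "0 \<le> unit_clamp x * step" "unit_clamp x * step \<le> 1 * step"
        using step_pos unit_clamp_bounds[of x] by (auto intro!: mult_right_mono mult_nonneg_nonneg)
      then show "node j + unit_clamp x * step \<in> {a..b}" using node_bounds[OF True] by auto
    qed
  qed
  then show ?thesis using True by (auto simp: \<xi>_def intro!: continuous_intros)
qed (simp add: \<xi>_def)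

lemma \<xi>_measurable: "\<xi> k j \<in> borel_measurable borel"
  by (intro borel_measurable_continuous_onI \<xi>_continuous)

text \<open>The random node is uniform in its step, so the mean of the rectangle rule is the integral of \<open>g\<close>.\<close>

lemma \<xi>_mean: "expectation (\<lambda>\<omega>. \<xi> k j (\<tau> (Suc j) \<omega>)) = 0"
proof (cases "j < N")
  case True
  let ?D = "sol (node (Suc j)) - sol (node j)"
  \<comment> \<open>An antiderivative of \<open>\<xi> k j\<close> on \<open>[0,1]\<close> that has equal values at both ends.\<close>
  have "(\<integral>x. indicator {0..1} x *\<^sub>R \<xi> k j x \<partial>lborel)
      = (1 * ?D $ k - sol (node j + 1 * step) $ k) - (0 * ?D $ k - sol (node j + 0 * step) $ k)"
  proof (rule integral_FTC_Icc)
    fix x :: real assume x: "0 \<le> x" "x \<le> 1"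
    have xs: "0 \<le> x * step" "x * step \<le> step" using x step_pos mult_right_mono[of x 1 step] by auto
    have sub: "(\<lambda>x. node j + x * step) ` {0..1} \<subseteq> {node j..node j + step}"
      using step_pos mult_right_mono[of _ 1 step] by auto
    have "(sol has_vector_derivative g (node j + x * step)) (at (node j + x * step) within {node j..node j + step})"
      using node_bounds[OF True] xs by (intro sol_deriv) auto
    then have "(sol has_vector_derivative g (node j + x * step))
        (at (node j + x * step) within (\<lambda>x. node j + x * step) ` {0..1})"
      by (rule has_vector_derivative_within_subset[OF _ sub])
    moreover have "((\<lambda>x. node j + x * step) has_vector_derivative step) (at x within {0..1})"
      by (auto intro!: derivative_eq_intros)
    ultimately have "((sol \<circ> (\<lambda>x. node j + x * step)) has_vector_derivative step *\<^sub>R g (node j + x * step)) (at x within {0..1})"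
      by (intro vector_diff_chain_within)
    then have "((\<lambda>x. sol (node j + x * step)) has_vector_derivative step *\<^sub>R g (node j + x * step)) (at x within {0..1})"
      by (simp only: o_def)
    then have "((\<lambda>x. sol (node j + x * step) $ k) has_vector_derivative (step *\<^sub>R g (node j + x * step)) $ k) (at x within {0..1})"
      by (rule bounded_linear.has_vector_derivative[OF bounded_linear_vec_nth])
    then have "((\<lambda>x. x * ?D $ k - sol (node j + x * step) $ k) has_vector_derivative
        (1 * ?D $ k - (step *\<^sub>R g (node j + x * step)) $ k)) (at x within {0..1})"
      by (intro has_vector_derivative_diff)
         (auto intro!: derivative_eq_intros simp: has_real_derivative_iff_has_vector_derivative[symmetric])
    then show "((\<lambda>x. x * ?D $ k - sol (node j + x * step) $ k) has_vector_derivative \<xi> k j x) (at x within {0..1})"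
      using x True by (simp add: \<xi>_def unit_clamp_def)
  qed (auto intro: continuous_on_subset[OF \<xi>_continuous])
  also have "\<dots> = 0" by (simp add: node_Suc)
  finally show ?thesis using \<tau>_expectation[of "Suc j" "\<xi> k j"] \<xi>_measurable by simp
qed (simp add: \<xi>_def)

definition "Y k j \<omega> = \<xi> k j (\<tau> (Suc j) \<omega>)"

definition "Smax k \<omega> = (MAX j\<in>{..N}. \<bar>\<Sum>i<j. Y k i \<omega>\<bar>)"

lemma Y_indep: "indep_vars (\<lambda>_. borel) (Y k) UNIV"
proof -
  have "indep_vars (\<lambda>_. borel) (\<lambda>j. \<tau> (Suc j)) UNIV"
    by (rule indep_vars_Suc[OF \<tau>_indep])
  then show ?thesis
    unfolding Y_def by (rule indep_vars_compose2) (simp add: \<xi>_measurable)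
qed

lemma Y_measurable [measurable]: "Y k j \<in> borel_measurable M"
  using Y_indep by (auto simp: indep_vars_def)

lemma Smax_measurable [measurable]: "Smax k \<in> borel_measurable M"
  unfolding Smax_def by (intro borel_measurable_Max) auto

lemma Smax_nonneg: "0 \<le> Smax k \<omega>"
proof -
  have "\<bar>\<Sum>i<0. Y k i \<omega>\<bar> \<in> (\<lambda>j. \<bar>\<Sum>i<j. Y k i \<omega>\<bar>) ` {..N}" by (rule imageI) simp
  then have "\<bar>\<Sum>i<0. Y k i \<omega>\<bar> \<le> Smax k \<omega>" unfolding Smax_def by (intro Max_ge) auto
  then show ?thesis by simp
qed

lemma H_pos: "0 < H"
proof -
  have "0 \<le> slope_bound * (b - a) powr (1 - \<rho>)" using slope_bound_nonneg by simp
  then show ?thesis using L by (simp add: H_def add_pos_nonneg)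
qed

lemma Smax_moment:
  assumes p: "0 < p"
  shows "(\<integral>\<^sup>+\<omega>. ennreal (Smax k \<omega> powr p) \<partial>M)
    \<le> ennreal (8 * exp 2 * p powr p * (H * (step powr \<rho> * step) * sqrt (real N)) powr p)"
  unfolding Smax_def
proof (rule maximal_moment[OF Y_indep])
  show "\<bar>Y k i \<omega>\<bar> \<le> H * (step powr \<rho> * step)" for i \<omega>
    unfolding Y_def by (rule \<xi>_bound)
  show "expectation (Y k i) = 0" for i unfolding Y_def by (rule \<xi>_mean)
  show "0 < H * (step powr \<rho> * step)" using H_pos step_pos by simp
qed (use N p in auto)

text \<open>The components of the partial sums are separated because the maximal inequality is scalar.\<close>

lemma path_error:
  assumes \<delta>: "0 \<le> \<delta>" "\<delta> \<le> 1" and noise: "(\<eta>', f') \<in> noisy_data a b \<eta> f \<delta>"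
    and good: "\<forall>j<N. \<tau> (Suc j) \<omega> \<in> {0..1}" and t: "t \<in> {a..b}"
  shows "norm1 (sol t - rk_output \<tau> a b N \<eta>' f' \<omega> t)
    \<le> rk_const * ((\<Sum>k\<in>UNIV. Smax k \<omega>) + (step powr \<rho> * step + \<delta>))"
proof -
  interpret P: rk_path a b K L \<rho> \<eta> f \<delta> \<eta>' f' N \<tau> \<omega>
    by unfold_locales (use \<delta> noise N good in auto)
  have X: "P.X i $ k = Y k i \<omega>" if "i < N" for i k
    using that good
    by (simp add: P.X_def Y_def \<xi>_def P.\<theta>_def P.h_def step_def unit_clamp_def)
  have "norm1 (\<Sum>i<j. P.X i) \<le> (\<Sum>k\<in>UNIV. Smax k \<omega>)" if j: "j \<le> N" for j
    unfolding norm1_def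
  proof (rule sum_mono)
    fix k :: 'd
    have "(\<Sum>i<j. P.X i) $ k = (\<Sum>i<j. Y k i \<omega>)"
      unfolding sum_component using X j by (intro sum.cong) auto
    then show "\<bar>(\<Sum>i<j. P.X i) $ k\<bar> \<le> Smax k \<omega>"
      unfolding Smax_def using j by (auto intro!: Max_ge)
  qed
  from P.rk_path_error[OF this t] show ?thesis
    by (simp add: P.hr_def P.h_def step_def add.assoc)
qed

text \<open>The hypotheses on \<open>B\<close> and \<open>m\<close> separate the probabilistic estimate from the computation of rates: \<open>m\<close> will be
  the maximum of the two rates, and \<open>B\<close> depends on \<open>a\<close>, \<open>b\<close> and \<open>\<rho>\<close> only.\<close>

lemma Lp_error:
  assumes \<delta>: "0 \<le> \<delta>" "\<delta> \<le> 1" and noise: "(\<eta>', f') \<in> noisy_data a b \<eta> f \<delta>" and p: "2 \<le> p"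
    and m: "step powr \<rho> * step * sqrt (real N) \<le> B * m" "step powr \<rho> * step + \<delta> \<le> B * m" "0 \<le> B" "0 \<le> m"
  shows "Lp_norm M p (\<lambda>\<omega>. SUP t\<in>{a..b}. ennreal (norm1 (sol t - rk_output \<tau> a b N \<eta>' f' \<omega> t)))
    \<le> ennreal ((rk_const * (real CARD('d) + 1) * B
          * (real CARD('d) * (8 * exp 2 * p powr p * H powr p) + 1) powr (1 / p)) * m)"
proof -
  let ?X = "\<lambda>\<omega>. SUP t\<in>{a..b}. ennreal (norm1 (sol t - rk_output \<tau> a b N \<eta>' f' \<omega> t))"
  define c where "c = rk_const * (real CARD('d) + 1)"
  define y where "y = step powr \<rho> * step + \<delta>"
  define D where "D = 8 * exp 2 * p powr p * (H * (B * m)) powr p"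
  have c: "0 \<le> c" using rk_const_nonneg by (simp add: c_def)
  have y: "0 \<le> y" using step_pos \<delta> by (simp add: y_def)
  have D: "0 \<le> D" by (simp add: D_def)
  have "(\<integral>\<^sup>+ \<omega>. ennreal_powr (?X \<omega>) p \<partial>M)
    \<le> (\<integral>\<^sup>+ \<omega>. ennreal (c powr p) * ((\<Sum>k\<in>UNIV. ennreal (Smax k \<omega> powr p)) + ennreal (y powr p)) \<partial>M)"
  proof (rule nn_integral_mono_AE, rule AE_mp[OF \<tau>_unit_all[of N]], intro AE_I2 impI)
    fix \<omega> assume good: "\<forall>j<N. \<tau> (Suc j) \<omega> \<in> {0..1}"
    let ?S = "\<Sum>k\<in>UNIV. Smax k \<omega>"
    have S: "0 \<le> ?S" by (intro sum_nonneg Smax_nonneg)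
    have "?X \<omega>
        \<le> ennreal (rk_const * (?S + y))"
      unfolding y_def by (intro SUP_least ennreal_leI path_error[OF \<delta> noise good])
    then have E: "ennreal_powr (?X \<omega>) p
        \<le> ennreal ((rk_const * (?S + y)) powr p)"
      using S y rk_const_nonneg p by (intro ennreal_powr_mono_le) auto
    have "(rk_const * (?S + y)) powr p = rk_const powr p * (?S + y) powr p"
      using S y rk_const_nonneg by (simp add: powr_mult)
    also have "\<dots> \<le> rk_const powr p * ((real CARD('d) + 1) powr p * ((\<Sum>k\<in>UNIV. Smax k \<omega> powr p) + y powr p))"
      using p y Smax_nonneg by (intro mult_left_mono sum_powr_le) auto
    also have "\<dots> = c powr p * ((\<Sum>k\<in>UNIV. Smax k \<omega> powr p) + y powr p)"
      using rk_const_nonneg by (simp add: c_def powr_mult)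
    finally have R: "(rk_const * (?S + y)) powr p \<le> c powr p * ((\<Sum>k\<in>UNIV. Smax k \<omega> powr p) + y powr p)" .
    note order_trans[OF E ennreal_leI[OF R]]
    also have "ennreal (c powr p * ((\<Sum>k\<in>UNIV. Smax k \<omega> powr p) + y powr p))
        = ennreal (c powr p) * ((\<Sum>k\<in>UNIV. ennreal (Smax k \<omega> powr p)) + ennreal (y powr p))"
      by (rule ennreal_scaled_sum) auto
    finally show "ennreal_powr (?X \<omega>) p
        \<le> ennreal (c powr p) * ((\<Sum>k\<in>UNIV. ennreal (Smax k \<omega> powr p)) + ennreal (y powr p))" .
  qed
  also have "\<dots> = ennreal (c powr p)
      * ((\<Sum>k\<in>UNIV. \<integral>\<^sup>+ \<omega>. ennreal (Smax k \<omega> powr p) \<partial>M) + ennreal (y powr p))"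
  proof -
    have "(\<integral>\<^sup>+ \<omega>. ennreal (c powr p) * ((\<Sum>k\<in>UNIV. ennreal (Smax k \<omega> powr p)) + ennreal (y powr p)) \<partial>M)
        = ennreal (c powr p) * (\<integral>\<^sup>+ \<omega>. ((\<Sum>k\<in>UNIV. ennreal (Smax k \<omega> powr p)) + ennreal (y powr p)) \<partial>M)"
      by (rule nn_integral_cmult) measurable
    also have "(\<integral>\<^sup>+ \<omega>. ((\<Sum>k\<in>UNIV. ennreal (Smax k \<omega> powr p)) + ennreal (y powr p)) \<partial>M)
        = (\<integral>\<^sup>+ \<omega>. (\<Sum>k\<in>UNIV. ennreal (Smax k \<omega> powr p)) \<partial>M) + (\<integral>\<^sup>+ \<omega>. ennreal (y powr p) \<partial>M)"
      by (rule nn_integral_add) measurable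
    also have "(\<integral>\<^sup>+ \<omega>. (\<Sum>k\<in>UNIV. ennreal (Smax k \<omega> powr p)) \<partial>M)
        = (\<Sum>k\<in>UNIV. \<integral>\<^sup>+ \<omega>. ennreal (Smax k \<omega> powr p) \<partial>M)"
      by (rule nn_integral_sum) measurable
    also have "(\<integral>\<^sup>+ \<omega>. ennreal (y powr p) \<partial>M) = ennreal (y powr p)"
      by (simp add: emeasure_space_1)
    finally show ?thesis .
  qed
  also have "\<dots> \<le> ennreal (c powr p) * ((\<Sum>k\<in>(UNIV :: 'd set). ennreal D) + ennreal ((B * m) powr p))"
  proof (intro mult_left_mono add_mono sum_mono)
    fix k
    have "H * (step powr \<rho> * step * sqrt (real N)) \<le> H * (B * m)"
      using m H_nonneg by (intro mult_left_mono) auto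
    then have "(H * (step powr \<rho> * step) * sqrt (real N)) powr p \<le> (H * (B * m)) powr p"
      using H_nonneg step_pos p by (intro powr_mono2) (auto simp: mult.assoc)
    then have "8 * exp 2 * p powr p * (H * (step powr \<rho> * step) * sqrt (real N)) powr p \<le> D"
      unfolding D_def by (intro mult_left_mono) auto
    then show "(\<integral>\<^sup>+ \<omega>. ennreal (Smax k \<omega> powr p) \<partial>M) \<le> ennreal D"
      using Smax_moment[of p k] p by (meson ennreal_leI order_trans less_le_trans zero_less_numeral)
    show "ennreal (y powr p) \<le> ennreal ((B * m) powr p)"
      using m y p unfolding y_def[symmetric] by (intro ennreal_leI powr_mono2) auto
  qed simp
  also have "\<dots> = ennreal (c powr p * (real CARD('d) * D + (B * m) powr p))"
    using ennreal_scaled_sum[of "c powr p" "UNIV :: 'd set" "\<lambda>k. D" "(B * m) powr p"] D by simp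
  also have "c powr p * (real CARD('d) * D + (B * m) powr p)
      = (c * (B * m)) powr p * (real CARD('d) * (8 * exp 2 * p powr p * H powr p) + 1)"
    using c m H_nonneg by (simp add: D_def powr_mult algebra_simps)
  finally have int: "(\<integral>\<^sup>+ \<omega>. ennreal_powr (?X \<omega>) p \<partial>M)
    \<le> ennreal ((c * (B * m)) powr p * (real CARD('d) * (8 * exp 2 * p powr p * H powr p) + 1))" .
  have "Lp_norm M p ?X
    \<le> ennreal (((c * (B * m)) powr p * (real CARD('d) * (8 * exp 2 * p powr p * H powr p) + 1)) powr (1 / p))"
    using p by (intro Lp_norm_le int) auto
  also have "((c * (B * m)) powr p * (real CARD('d) * (8 * exp 2 * p powr p * H powr p) + 1)) powr (1 / p)
      = (c * (B * m)) * (real CARD('d) * (8 * exp 2 * p powr p * H powr p) + 1) powr (1 / p)"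
    using p c m by (simp add: powr_mult powr_powr)
  finally show ?thesis by (simp add: c_def mult_ac)
qed

end

lemma rk_upper_bound:
  fixes a b K L \<rho> p :: real
  assumes par: "a < b" "0 < K" "0 < L" "0 < \<rho>" "\<rho> \<le> 1" "2 \<le> p"
  shows "\<exists>c>0. \<forall>(M, \<tau>) \<in> (random_sources :: ('w measure \<times> (nat \<Rightarrow> 'w \<Rightarrow> real)) set). \<forall>n\<ge>2. \<forall>\<delta>\<in>{0<..1}.
    worst_case_error M a b p (rk_output \<tau> a b (n div 2))
          (F_class a b K L \<rho> :: ((real ^ 'd) \<times> 'd rhs) set) \<delta>
      \<le> ennreal (c * max (real n powr (- (\<rho> + 1 / 2))) \<delta>)"
proof -
  define B where "B = (4 * (b - a)) powr (1 + \<rho>) + 1"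
  define c where "c = ivp.rk_const a b K L \<rho> * (real CARD('d) + 1) * B
          * (real CARD('d) * (8 * exp 2 * p powr p * ivp.H a b K L \<rho> powr p) + 1) powr (1 / p)"
  have B0: "0 \<le> B" by (simp add: B_def)
  have main: "worst_case_error M a b p (rk_output \<tau> a b (n div 2))
          (F_class a b K L \<rho> :: ((real ^ 'd) \<times> 'd rhs) set) \<delta>
      \<le> ennreal (\<bar>c\<bar> * max (real n powr (- (\<rho> + 1 / 2))) \<delta>)"
    if src: "(M, \<tau>) \<in> (random_sources :: ('w measure \<times> (nat \<Rightarrow> 'w \<Rightarrow> real)) set)"
      and n: "2 \<le> n" and \<delta>: "0 < \<delta>" "\<delta> \<le> 1" for M :: "'w measure" and \<tau> n \<delta>
  proof -
    define N where "N = n div 2"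
    define m where "m = max (real n powr (- (\<rho> + 1 / 2))) \<delta>"
    define h where "h = (b - a) / real N"
    \<comment> \<open>Rounding \<open>n / 2\<close> down costs at most a factor two for \<open>n \<ge> 2\<close>.\<close>
    have N: "0 < N" and nN: "real n \<le> 4 * real N" using n by (auto simp: N_def)
    have h0: "0 < h" using par N by (simp add: h_def)
    have n0: "0 < real n" using n by simp
    have h_le: "h \<le> 4 * (b - a) / real n"
    proof -
      have "h = 4 * (b - a) / (4 * real N)" unfolding h_def using N by (subst mult_divide_mult_cancel_left) auto
      also have "\<dots> \<le> 4 * (b - a) / real n"
        using nN n0 N par by (intro divide_left_mono) auto
      finally show ?thesis .
    qed
    have "h powr \<rho> * h = h powr (1 + \<rho>)" using h0 by (simp add: powr_add)
    also have "\<dots> \<le> (4 * (b - a) / real n) powr (1 + \<rho>)"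
      using h_le h0 par by (intro powr_mono2) auto
    also have "\<dots> = (4 * (b - a)) powr (1 + \<rho>) * real n powr (- (1 + \<rho>))"
      using par n0 unfolding powr_minus_divide by (simp add: powr_divide)
    finally have hr: "h powr \<rho> * h \<le> (4 * (b - a)) powr (1 + \<rho>) * real n powr (- (1 + \<rho>))" .
    have "h powr \<rho> * h * sqrt (real N) \<le> ((4 * (b - a)) powr (1 + \<rho>) * real n powr (- (1 + \<rho>))) * sqrt (real n)"
      by (rule mult_mono[OF hr]) (auto simp: N_def)
    also have "\<dots> = (4 * (b - a)) powr (1 + \<rho>) * (real n powr (- (1 + \<rho>)) * real n powr (1 / 2))"
      using n0 by (simp add: powr_half_sqrt)
    also have "\<dots> = (4 * (b - a)) powr (1 + \<rho>) * real n powr (- (\<rho> + 1 / 2))"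
    proof -
      have "- (1 + \<rho>) + 1 / 2 = - (\<rho> + 1 / 2)" by simp
      then show ?thesis by (simp only: powr_add[symmetric])
    qed
    also have "\<dots> \<le> B * m" unfolding B_def m_def by (intro mult_mono) auto
    finally have m1: "h powr \<rho> * h * sqrt (real N) \<le> B * m" .
    have "h powr \<rho> * h + \<delta> \<le> (4 * (b - a)) powr (1 + \<rho>) * real n powr (- (\<rho> + 1 / 2)) + 1 * \<delta>"
      using hr n0 n by (intro add_mono order_trans[OF hr] mult_left_mono powr_mono) auto
    also have "\<dots> \<le> (4 * (b - a)) powr (1 + \<rho>) * m + 1 * m"
      unfolding m_def by (intro add_mono mult_left_mono) auto
    finally have m2: "h powr \<rho> * h + \<delta> \<le> B * m" by (simp add: B_def algebra_simps)
    have m0: "0 \<le> m" using \<delta> by (simp add: m_def)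
    have "Lp_norm M p (\<lambda>\<omega>. SUP t\<in>{a..b}. ennreal (norm1 (ivp_solution a b \<eta> f t - rk_output \<tau> a b N \<eta>' f' \<omega> t)))
        \<le> ennreal (\<bar>c\<bar> * m)"
      if F: "(\<eta>, f) \<in> F_class a b K L \<rho>" and noise: "(\<eta>', f') \<in> noisy_data a b \<eta> f \<delta>"
      for \<eta> \<eta>' :: "real ^ 'd" and f f'
    proof -
      interpret random_source M \<tau>
        using src by (auto simp: random_source_def random_source_axioms_def random_sources_def)
      interpret I: ivp_random a b K L \<rho> \<eta> f M \<tau> N
        by unfold_locales (use par F N in auto)
      have "Lp_norm M p (\<lambda>\<omega>. SUP t\<in>{a..b}. ennreal (norm1 (ivp_solution a b \<eta> f t - rk_output \<tau> a b N \<eta>' f' \<omega> t)))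
        \<le> ennreal (c * m)"
        unfolding c_def
        by (rule I.Lp_error) (use \<delta> noise par m1 m2 m0 B0 in \<open>auto simp: I.step_def h_def\<close>)
      also have "\<dots> \<le> ennreal (\<bar>c\<bar> * m)" using m0 by (intro ennreal_leI mult_right_mono) auto
      finally show ?thesis .
    qed
    then show ?thesis
      unfolding worst_case_error_def error_at_def m_def[symmetric] N_def[symmetric]
      by (auto intro!: SUP_least)
  qed
  have "\<bar>c\<bar> * max (real n powr (- (\<rho> + 1 / 2))) \<delta> \<le> (\<bar>c\<bar> + 1) * max (real n powr (- (\<rho> + 1 / 2))) \<delta>" for n :: nat and \<delta>
    by (intro mult_right_mono) (simp_all add: le_max_iff_disj)
  note main' = order_trans[OF main ennreal_leI[OF this]]
  show ?thesis
    by (intro exI[of _ "\<bar>c\<bar> + 1"] conjI ballI case_prodI2 allI impI) (simp, rule main', auto)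
qed

section \<open>Measurability on the Skorokhod space\<close>

lemma continuous_cadlag:
  assumes x: "continuous_on {a..b} x" "x \<in> extensional {a..b}"
  shows "x \<in> cadlag a b"
  unfolding cadlag_def
proof (intro CollectI conjI ballI x(2))
  fix t assume t: "t \<in> {a..<b}"
  then have "continuous_on {t..b} x" by (intro continuous_on_subset[OF x(1)]) auto
  then show "(x \<longlongrightarrow> x t) (at_right t)"
    using t by (auto simp: continuous_on_def at_within_Icc_at_right dest!: bspec[of _ _ t])
next
  fix t assume t: "t \<in> {a<..b}"
  then have "continuous_on {a..t} x" by (intro continuous_on_subset[OF x(1)]) auto
  then show "\<exists>l. (x \<longlongrightarrow> l) (at_left t)"
    using t by (auto simp: continuous_on_def at_within_Icc_at_left dest!: bspec[of _ _ t])
qed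

lemma skorokhod_dist_le_uniform:
  assumes "\<And>t. t \<in> {a..b} \<Longrightarrow> norm1 (x t - y t) \<le> r"
  shows "skorokhod_dist a b x y \<le> ennreal r"
proof -
  have "id \<in> time_changes a b" by (simp add: time_changes_def strict_mono_on_def)
  then have "skorokhod_dist a b x y
      \<le> max (SUP t\<in>{a..b}. ennreal \<bar>id t - t\<bar>) (SUP t\<in>{a..b}. ennreal (norm1 (x (id t) - y t)))"
    unfolding skorokhod_dist_def by (rule INF_lower)
  also have "\<dots> \<le> ennreal r"
    using assms by (intro max.boundedI SUP_least) (auto intro: ennreal_leI)
  finally show ?thesis .
qed

text \<open>Time changes fix the endpoint, so evaluation there is continuous for the Skorokhod distance. At
  interior times it is not, which is why the lower bounds only look at the endpoint \<open>b\<close>.\<close>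

lemma time_change_endpoint:
  assumes l: "l \<in> time_changes a b" and ab: "a < b"
  shows "l b = b"
proof -
  have im: "l ` {a..b} = {a..b}" and mono: "strict_mono_on {a..b} l"
    using l by (auto simp: time_changes_def)
  have "b \<in> l ` {a..b}" unfolding im using ab by simp
  then obtain s where s: "s \<in> {a..b}" "l s = b" by auto
  have "l s \<le> l b"
    using strict_mono_on_leD[OF mono, of s b] s ab by auto
  moreover have "l b \<in> {a..b}" using im ab by auto
  ultimately show ?thesis using s by simp
qed

lemma eval_endpoint_measurable:
  assumes ab: "a < b"
  shows "(\<lambda>x. x b) \<in> borel_measurable (skorokhod_borel a b :: (real \<Rightarrow> real ^ 'd) measure)"
proof (rule borel_measurableI)
  fix S :: "(real ^ 'd) set" assume S: "open S"
  have sp: "space (skorokhod_borel a b :: (real \<Rightarrow> real ^ 'd) measure) = cadlag a b"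
    unfolding skorokhod_borel_def by (simp add: space_measure_of_conv)
  have "skorokhod_open a b {x \<in> cadlag a b. x b \<in> S}"
    unfolding skorokhod_open_def
  proof (intro conjI ballI)
    fix x assume x: "x \<in> {x \<in> cadlag a b. x b \<in> S}"
    then obtain e where e: "0 < e" "\<And>v. dist v (x b) < e \<Longrightarrow> v \<in> S"
      using S by (auto simp: open_dist)
    show "\<exists>\<epsilon>>0. \<forall>y\<in>cadlag a b. skorokhod_dist a b x y < \<epsilon> \<longrightarrow> y \<in> {x \<in> cadlag a b. x b \<in> S}"
    proof (intro exI[of _ "ennreal e"] conjI ballI impI)
      show "0 < ennreal e" using e by simp
      fix y assume y: "y \<in> cadlag a b" "skorokhod_dist a b x y < ennreal e"
      then obtain l where l: "l \<in> time_changes a b"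
        "max (SUP t\<in>{a..b}. ennreal \<bar>l t - t\<bar>) (SUP t\<in>{a..b}. ennreal (norm1 (x (l t) - y t))) < ennreal e"
        unfolding skorokhod_dist_def INF_less_iff by auto
      have "ennreal (norm1 (x (l b) - y b)) \<le> (SUP t\<in>{a..b}. ennreal (norm1 (x (l t) - y t)))"
        using ab by (intro SUP_upper) auto
      also have "\<dots> < ennreal e" using l(2) by simp
      finally have "norm1 (x b - y b) < e"
        using time_change_endpoint[OF l(1) ab] by (simp add: ennreal_less_iff)
      then have "dist (y b) (x b) < e"
        using norm_le_norm1[of "x b - y b"] by (simp add: dist_norm norm_minus_commute)
      then show "y \<in> {x \<in> cadlag a b. x b \<in> S}" using y e by auto
    qed
  qed auto
  then have "{x \<in> cadlag a b. x b \<in> S} \<in> sets (skorokhod_borel a b :: (real \<Rightarrow> real ^ 'd) measure)"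
    unfolding skorokhod_borel_def
    by (subst sets_measure_of) (auto simp: skorokhod_open_def)
  moreover have "(\<lambda>x. x b) -` S \<inter> space (skorokhod_borel a b) = {x \<in> cadlag a b. x b \<in> S}"
    unfolding sp by auto
  ultimately show "(\<lambda>x. x b) -` S \<inter> space (skorokhod_borel a b) \<in> sets (skorokhod_borel a b)" by simp
qed

text \<open>Tuples are functions on the naturals with a default value beyond their length. This embeds them
  measurably into a full product, where open sets are known to be measurable.\<close>

lemma vec_space_into_product:
  "(\<lambda>w. w) \<in> (vec_space m :: (nat \<Rightarrow> real ^ 'd) measure) \<rightarrow>\<^sub>M PiM UNIV (\<lambda>_. borel)"
proof (rule measurable_PiM_single')
  fix i
  show "(\<lambda>w. w i) \<in> borel_measurable (vec_space m :: (nat \<Rightarrow> real ^ 'd) measure)"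
  proof (cases "i < m")
    case False
    have "(\<lambda>w. undefined) \<in> borel_measurable (vec_space m :: (nat \<Rightarrow> real ^ 'd) measure)" by simp
    then show ?thesis
      by (rule measurable_cong[THEN iffD1, rotated]) (use False in \<open>auto simp: space_PiM PiE_def extensional_def\<close>)
  qed simp
qed auto

text \<open>The Skorokhod distance is at most the uniform one, so the preimage of a Skorokhod open set under a
  map that is continuous for the uniform distance is open in the product topology. The function \<open>G\<close> is
  a modulus of continuity.\<close>

lemma measurable_into_skorokhod:
  fixes \<Phi> :: "(nat \<Rightarrow> real ^ 'd) \<Rightarrow> real \<Rightarrow> real ^ 'd"
  assumes cadlag: "\<And>w. \<Phi> w \<in> cadlag a b"
    and G: "\<And>w. continuous_on UNIV (G w)" "\<And>w. G w w = 0"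
    and le: "\<And>w w' t. t \<in> {a..b} \<Longrightarrow> norm1 (\<Phi> w t - \<Phi> w' t) \<le> G w w'"
  shows "\<Phi> \<in> vec_space m \<rightarrow>\<^sub>M skorokhod_borel a b"
  unfolding skorokhod_borel_def
proof (rule measurable_measure_of)
  show "{U. skorokhod_open a b U} \<subseteq> Pow (cadlag a b)" by (auto simp: skorokhod_open_def)
  show "\<Phi> \<in> space (vec_space m) \<rightarrow> cadlag a b" using cadlag by auto
  fix U :: "(real \<Rightarrow> real ^ 'd) set" assume "U \<in> {U. skorokhod_open a b U}"
  then have U: "\<And>x. x \<in> U \<Longrightarrow> \<exists>\<epsilon>>0. \<forall>y\<in>cadlag a b. skorokhod_dist a b x y < \<epsilon> \<longrightarrow> y \<in> U"
    by (auto simp: skorokhod_open_def)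
  have "open (\<Phi> -` U)"
  proof (subst openin_subopen[of euclidean, unfolded open_openin[symmetric]], intro ballI)
    fix w assume w: "w \<in> \<Phi> -` U"
    then obtain \<epsilon> where e: "0 < \<epsilon>" "\<And>y. y \<in> cadlag a b \<Longrightarrow> skorokhod_dist a b (\<Phi> w) y < \<epsilon> \<Longrightarrow> y \<in> U"
      using U[of "\<Phi> w"] by auto
    obtain e' where e': "0 < e'" "e' < \<epsilon>" using dense[OF e(1)] by auto
    then obtain r where r: "0 < r" "ennreal r < \<epsilon>"
      by (cases e') auto
    show "\<exists>T. open T \<and> w \<in> T \<and> T \<subseteq> \<Phi> -` U"
    proof (intro exI conjI)
      show "open {w'. G w w' < r}" by (intro open_Collect_less continuous_intros G)
      show "w \<in> {w'. G w w' < r}" using G(2) r by simp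
      show "{w'. G w w' < r} \<subseteq> \<Phi> -` U"
      proof safe
        fix w' assume "G w w' < r"
        then have "skorokhod_dist a b (\<Phi> w) (\<Phi> w') \<le> ennreal r"
          by (intro skorokhod_dist_le_uniform order_trans[OF le]) auto
        then show "w' \<in> \<Phi> -` U" using r e(2) cadlag by auto
      qed
    qed
  qed
  then have "\<Phi> -` U \<in> sets (PiM UNIV (\<lambda>_ :: nat. borel :: (real ^ 'd) measure))"
    unfolding sets_PiM_equal_borel by simp
  then show "\<Phi> -` U \<inter> space (vec_space m) \<in> sets (vec_space m)"
    using measurable_sets[OF vec_space_into_product, of "\<Phi> -` U" m] by simp
qed

section \<open>The Runge-Kutta method as an algorithm\<close>

text \<open>The continuous polygon that starts at the last entry of \<open>w\<close> and has slope \<open>w (N + j)\<close> on step \<open>j\<close>. As a sum over all steps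
  it is visibly continuous in time and linear in \<open>w\<close>, in contrast to a definition by cases. The entries
  \<open>w (N + j)\<close> are the values at the random times, and \<open>w (2 * N)\<close> is the initial value.\<close>

definition interpolant :: "real \<Rightarrow> real \<Rightarrow> nat \<Rightarrow> (nat \<Rightarrow> real ^ 'd) \<Rightarrow> real \<Rightarrow> real ^ 'd" where
  "interpolant a b N w = (\<lambda>t\<in>{a..b}. w (2 * N) + (\<Sum>j<N.
     ((b - a) / real N * unit_clamp ((t - rk_node a b N j) / ((b - a) / real N))) *\<^sub>R w (N + j)))"

lemma interpolant_measurable:
  assumes ab: "a < b"
  shows "interpolant a b N \<in> vec_space m \<rightarrow>\<^sub>M skorokhod_borel a b"
proof (rule measurable_into_skorokhod)
  fix w w' :: "nat \<Rightarrow> real ^ 'd"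
  let ?h = "(b - a) / real N"
  let ?G = "\<lambda>w w' :: nat \<Rightarrow> real ^ 'd. norm1 (w (2 * N) - w' (2 * N)) + (\<Sum>j<N. ?h * norm1 (w (N + j) - w' (N + j)))"
  have "continuous_on {a..b} (\<lambda>t. w (2 * N) + (\<Sum>j<N. (?h * unit_clamp ((t - rk_node a b N j) / ?h)) *\<^sub>R w (N + j)))"
    unfolding unit_clamp_def by (cases "N = 0") (auto intro!: continuous_intros ab simp: ab[THEN less_imp_neq])
  then have "continuous_on {a..b} (interpolant a b N w)"
    by (rule continuous_on_eq) (simp add: interpolant_def)
  then show "interpolant a b N w \<in> cadlag a b"
    by (rule continuous_cadlag) (simp add: interpolant_def)
  show "continuous_on UNIV (?G w)"
    by (intro continuous_intros continuous_on_product_coordinates)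
  show "?G w w = 0" by simp
  fix t assume t: "t \<in> {a..b}"
  define s where "s j = ?h * unit_clamp ((t - rk_node a b N j) / ?h)" for j
  have s: "0 \<le> s j" "s j \<le> ?h" for j
    using unit_clamp_bounds[of "(t - rk_node a b N j) / ?h"] ab
      mult_left_mono[of "unit_clamp ((t - rk_node a b N j) / ?h)" 1 ?h]
    by (auto simp: s_def)
  have "interpolant a b N w t - interpolant a b N w' t
      = (w (2 * N) - w' (2 * N)) + (\<Sum>j<N. s j *\<^sub>R (w (N + j) - w' (N + j)))"
    using t by (simp add: interpolant_def s_def scaleR_diff_right sum_subtractf)
  also have "norm1 \<dots> \<le> norm1 (w (2 * N) - w' (2 * N)) + (\<Sum>j<N. norm1 (s j *\<^sub>R (w (N + j) - w' (N + j))))"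
    by (intro order_trans[OF norm1_triangle] add_left_mono norm1_sum)
  also have "\<dots> \<le> ?G w w'"
    unfolding norm1_scaleR abs_of_nonneg[OF s(1)]
    by (intro add_left_mono sum_mono mult_right_mono s) simp
  finally show "norm1 (interpolant a b N w t - interpolant a b N w' t) \<le> ?G w w'" .
qed

text \<open>The iterate before step \<open>j\<close> is not stored but recomputed from the information available then.\<close>

definition rk_state :: "real \<Rightarrow> nat \<Rightarrow> (nat \<Rightarrow> real ^ 'd) \<Rightarrow> real ^ 'd" where
  "rk_state h j I = I (2 * j) + h *\<^sub>R (\<Sum>k<j. I (j + k))"

definition rk_algorithm ::
  "(nat \<Rightarrow> 'w \<Rightarrow> real) \<Rightarrow> real \<Rightarrow> real \<Rightarrow> nat \<Rightarrow> ('w, 'd::finite) algorithm" where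
  "rk_algorithm \<tau> a b N = \<lparr>
     stages = N,
     fixed_time = rk_node a b N,
     random_time = (\<lambda>j \<omega>. rk_node a b N j + unit_clamp (\<tau> (Suc j) \<omega>) * ((b - a) / real N)),
     psi_y = rk_state ((b - a) / real N),
     psi_z = (\<lambda>j (I, w, \<theta>). rk_state ((b - a) / real N) j I + (\<theta> - rk_node a b N j) *\<^sub>R w),
     phi = interpolant a b N \<rparr>"

lemma rk_algorithm_simps [simp]:
  "stages (rk_algorithm \<tau> a b N) = N"
  "fixed_time (rk_algorithm \<tau> a b N) = rk_node a b N"
  "random_time (rk_algorithm \<tau> a b N) j \<omega>
    = rk_node a b N j + unit_clamp (\<tau> (Suc j) \<omega>) * ((b - a) / real N)"
  "psi_y (rk_algorithm \<tau> a b N) = rk_state ((b - a) / real N)"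
  "psi_z (rk_algorithm \<tau> a b N) j (I, w, \<theta>)
    = rk_state ((b - a) / real N) j I + (\<theta> - rk_node a b N j) *\<^sub>R w"
  "phi (rk_algorithm \<tau> a b N) = interpolant a b N"
  by (simp_all add: rk_algorithm_def)

lemma rk_state_measurable: "rk_state h j \<in> borel_measurable (vec_space (2 * j + 1))"
  unfolding rk_state_def
  by (intro borel_measurable_add borel_measurable_scaleR borel_measurable_const borel_measurable_sum
      measurable_component_singleton) auto

context random_source
begin

lemma rk_algorithm_in_class:
  assumes ab: "a < b" and N: "0 < N" "2 * N \<le> n"
  shows "rk_algorithm \<tau> a b N \<in> (algorithms M a b n :: ('w, 'd::finite) algorithm set)"
  unfolding algorithms_def
proof (intro CollectI conjI allI impI ballI)
  let ?A = "rk_algorithm \<tau> a b N :: ('w, 'd) algorithm"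
  show "0 < stages ?A" "2 * stages ?A \<le> n" using N by (simp_all add: rk_algorithm_def)
  show "phi ?A \<in> vec_space (2 * stages ?A + 1) \<rightarrow>\<^sub>M skorokhod_borel a b"
    using interpolant_measurable[OF ab] by (simp add: rk_algorithm_def)
  fix j assume "j < stages ?A"
  then have j: "j < N" by (simp add: rk_algorithm_def)
  note nb = rk_node_bounds[OF ab j]
  have h: "0 < (b - a) / real N" using ab N by simp
  show "fixed_time ?A j \<in> {a..b}" using nb h by (simp add: rk_algorithm_def)
  have "unit_clamp \<in> borel_measurable borel"
    by (intro borel_measurable_continuous_onI unit_clamp_continuous)
  then have "(\<lambda>\<omega>. unit_clamp (\<tau> (Suc j) \<omega>)) \<in> borel_measurable M"
    using \<tau>_measurable[of "Suc j"] measurable_compose by fastforce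
  then show "random_time ?A j \<in> borel_measurable M"
    by (simp add: rk_algorithm_def)
  show "psi_y ?A j \<in> vec_space (2 * j + 1) \<rightarrow>\<^sub>M borel"
    using rk_state_measurable by (simp add: rk_algorithm_def)
  have "(\<lambda>x. rk_state ((b - a) / real N) j (fst x) + (snd (snd x) - rk_node a b N j) *\<^sub>R fst (snd x))
      \<in> borel_measurable (vec_space (2 * j + 1) \<Otimes>\<^sub>M borel \<Otimes>\<^sub>M borel)"
    using rk_state_measurable[of "(b - a) / real N" j] by measurable
  then show "psi_z ?A j \<in> vec_space (2 * j + 1) \<Otimes>\<^sub>M borel \<Otimes>\<^sub>M borel \<rightarrow>\<^sub>M borel"
    by (simp add: rk_algorithm_def case_prod_beta')
  fix \<omega>
  have "0 \<le> unit_clamp (\<tau> (Suc j) \<omega>) * ((b - a) / real N)"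
    "unit_clamp (\<tau> (Suc j) \<omega>) * ((b - a) / real N) \<le> 1 * ((b - a) / real N)"
    using unit_clamp_bounds[of "\<tau> (Suc j) \<omega>"] h
    by (auto intro!: mult_nonneg_nonneg mult_right_mono simp del: times_divide_eq_right)
  then show "random_time ?A j \<omega> \<in> {a..b}"
    using nb by (simp add: rk_algorithm_def)
qed

end

text \<open>The statement covers all earlier iterates as well, since the output is computed from the final
  information and not from intermediate ones.\<close>

lemma rk_algorithm_states:
  fixes \<eta>' :: "real ^ 'd"
  assumes good: "\<forall>j<N. \<tau> (Suc j) \<omega> \<in> {0..1}"
  shows "n \<le> N \<Longrightarrow> j \<le> n \<Longrightarrow>
    \<eta>' + ((b - a) / real N) *\<^sub>R (\<Sum>k<j. snd (noisy_values (rk_algorithm \<tau> a b N) \<eta>' f' \<omega> n) k)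
      = rk_value \<tau> a b N \<eta>' f' \<omega> j"
proof (induction n arbitrary: j)
  case 0
  then show ?case by simp
next
  case (Suc n)
  let ?A = "rk_algorithm \<tau> a b N :: ('a, 'd) algorithm"
  let ?h = "(b - a) / real N"
  obtain u v where uv: "noisy_values ?A \<eta>' f' \<omega> n = (u, v)" by force
  have IH: "\<eta>' + ?h *\<^sub>R (\<Sum>k<j. v k) = rk_value \<tau> a b N \<eta>' f' \<omega> j" if "j \<le> n" for j
    using Suc.IH[of j] Suc.prems that uv by simp
  have "rk_state ?h n (info_vec n u v \<eta>') = \<eta>' + ?h *\<^sub>R (\<Sum>k<n. v k)"
    unfolding rk_state_def info_vec_def by (auto intro!: sum.cong arg_cong[where f = "\<lambda>x. ?h *\<^sub>R x"])
  also have "\<dots> = rk_value \<tau> a b N \<eta>' f' \<omega> n" using IH by simp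
  finally have st: "rk_state ?h n (info_vec n u v \<eta>') = rk_value \<tau> a b N \<eta>' f' \<omega> n" .
  have clamp: "unit_clamp (\<tau> (Suc n) \<omega>) = \<tau> (Suc n) \<omega>"
    using good Suc.prems by (auto simp: unit_clamp_def)
  define V where "V = rk_value \<tau> a b N \<eta>' f' \<omega> n"
  define x where "x = f' (rk_node a b N n + \<tau> (Suc n) \<omega> * ?h,
      V + (?h * \<tau> (Suc n) \<omega>) *\<^sub>R f' (rk_node a b N n, V))"
  have v': "snd (noisy_values ?A \<eta>' f' \<omega> (Suc n)) = v(n := x)"
    by (simp add: uv Let_def x_def V_def st clamp mult.commute)
  show ?case
  proof (cases "j \<le> n")
    case True
    then have "(\<Sum>k<j. (v(n := x)) k) = (\<Sum>k<j. v k)" by (intro sum.cong) auto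
    then show ?thesis unfolding v' using IH[OF True] by simp
  next
    case False
    then have j: "j = Suc n" using Suc.prems by simp
    have "(\<Sum>k<n. (v(n := x)) k) = (\<Sum>k<n. v k)" by (intro sum.cong) auto
    then have "\<eta>' + ?h *\<^sub>R (\<Sum>k<Suc n. (v(n := x)) k) = V + ?h *\<^sub>R x"
      using IH[of n] by (simp add: V_def scaleR_add_right add.assoc[symmetric])
    also have "\<dots> = rk_value \<tau> a b N \<eta>' f' \<omega> (Suc n)"
      by (simp add: Let_def V_def[symmetric] x_def)
    finally show ?thesis unfolding v' j .
  qed
qed

lemma run_rk_algorithm:
  fixes \<eta>' :: "real ^ 'd"
  assumes ab: "a < b" and N: "0 < N" and good: "\<forall>j<N. \<tau> (Suc j) \<omega> \<in> {0..1}" and t: "t \<in> {a..b}"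
  shows "run (rk_algorithm \<tau> a b N) \<eta>' f' \<omega> t = rk_output \<tau> a b N \<eta>' f' \<omega> t"
proof -
  let ?A = "rk_algorithm \<tau> a b N :: ('a, 'd) algorithm"
  define h where "h = (b - a) / real N"
  let ?V = "rk_value \<tau> a b N \<eta>' f' \<omega>"
  obtain u v where uv: "noisy_values ?A \<eta>' f' \<omega> N = (u, v)" by force
  have V: "\<eta>' + h *\<^sub>R (\<Sum>k<j. v k) = ?V j" if "j \<le> N" for j
    using that rk_algorithm_states[where \<tau> = \<tau> and \<omega> = \<omega>, OF good, of N j \<eta>' b a f'] uv by (simp add: h_def)
  have h: "0 < h" using ab N by (simp add: h_def)
  obtain j l where j: "j < N" and l: "0 \<le> l" "l \<le> 1" and tj: "t = rk_node a b N j + l * h"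
    and out: "rk_output \<tau> a b N \<eta>' f' \<omega> t = l *\<^sub>R (?V (Suc j) - ?V j) + ?V j"
    unfolding h_def by (rule rk_output_interval[OF ab N t])
  have frac: "(t - rk_node a b N i) / h = real j - real i + l" for i
    using h unfolding tj rk_node_def h_def[symmetric] by (simp add: field_simps)
  define c where "c i = (h * unit_clamp (real j - real i + l)) *\<^sub>R v i" for i
  have stages: "stages ?A = N" by (simp add: rk_algorithm_def)
  have "run ?A \<eta>' f' \<omega> t = interpolant a b N (info_vec N u v \<eta>') t"
    unfolding run_def noisy_information_def stages uv by (simp add: rk_algorithm_def)
  also have "\<dots> = \<eta>' + (\<Sum>i<N. c i)"
    using t unfolding interpolant_def h_def[symmetric] frac c_def
    by (auto simp: info_vec_def frac intro!: sum.cong)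
  also have "(\<Sum>i<N. c i) = (\<Sum>i<Suc j. c i)"
  proof (rule sum.mono_neutral_right)
    have "c i = 0" if "Suc j \<le> i" for i
    proof -
      have "real j - real i + l \<le> 0" using that l by simp
      then show ?thesis by (simp add: c_def unit_clamp_def max_def)
    qed
    then show "\<forall>i\<in>{..<N} - {..<Suc j}. c i = 0" by auto
  qed (use j in auto)
  also have "\<dots> = (\<Sum>i<j. h *\<^sub>R v i) + (h * l) *\<^sub>R v j"
  proof -
    have "(\<Sum>i<j. c i) = (\<Sum>i<j. h *\<^sub>R v i)"
      using l by (intro sum.cong) (auto simp: c_def unit_clamp_def min_def)
    then show ?thesis using l by (simp add: c_def unit_clamp_def)
  qed
  also have "\<eta>' + \<dots> = ?V j + l *\<^sub>R (h *\<^sub>R v j)"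
    using V[of j] j by (simp add: scaleR_sum_right mult.commute add.assoc[symmetric])
  also have "h *\<^sub>R v j = ?V (Suc j) - ?V j"
    unfolding V[of j, symmetric, OF less_imp_le[OF j]] V[of "Suc j", symmetric, OF Suc_leI[OF j]]
    by (simp add: scaleR_add_right)
  finally show ?thesis unfolding out by (simp only: add.commute)
qed

lemma (in random_source) AE_run_rk_algorithm:
  assumes "a < b" "0 < N"
  shows "AE \<omega> in M. \<forall>t\<in>{a..b}.
    run (rk_algorithm \<tau> a b N) \<eta>' f' \<omega> t = rk_output \<tau> a b N \<eta>' f' \<omega> t"
  by (rule AE_mp[OF \<tau>_unit_all[of N]], intro AE_I2 impI ballI) (rule run_rk_algorithm[OF assms])

section \<open>Lower bounds by averaging over a finite family of problems\<close>

lemma ennreal_powr_mono_ge: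
  assumes "ennreal r \<le> x" "0 \<le> r" "0 \<le> q"
  shows "ennreal (r powr q) \<le> ennreal_powr x q"
  using assms
  by (cases x) (auto simp: ennreal_powr_def intro!: ennreal_leI powr_mono2)

text \<open>A supremum over problems is at least an average over a finite family of them. The hypothesis is an
  average for each elementary event separately, where the algorithm is deterministic. Measurability of the errors is what allows the sum and the
  integral to be interchanged.\<close>

lemma worst_case_error_ge:
  fixes \<eta> :: "'s \<Rightarrow> real ^ 'd" and f f' :: "'s \<Rightarrow> 'd rhs"
  assumes "prob_space M" and ab: "a < b" and p: "0 < p" and m: "0 \<le> m" and I: "finite I" "I \<noteq> {}"
    and F: "\<And>s. s \<in> I \<Longrightarrow> (\<eta> s, f s) \<in> F"
    and noise: "\<And>s. s \<in> I \<Longrightarrow> (\<eta>' s, f' s) \<in> noisy_data a b (\<eta> s) (f s) \<delta>"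
    and meas: "\<And>s. s \<in> I \<Longrightarrow> (\<lambda>\<omega>. out (\<eta>' s) (f' s) \<omega> b) \<in> borel_measurable M"
    and ge: "\<And>\<omega>. real (card I) * m powr p
      \<le> (\<Sum>s\<in>I. norm1 (ivp_solution a b (\<eta> s) (f s) b - out (\<eta>' s) (f' s) \<omega> b) powr p)"
  shows "ennreal m \<le> worst_case_error M a b p out F \<delta>"
proof -
  interpret prob_space M by fact
  define E where "E s \<omega> = norm1 (ivp_solution a b (\<eta> s) (f s) b - out (\<eta>' s) (f' s) \<omega> b) powr p" for s \<omega>
  have E_meas: "E s \<in> borel_measurable M" if "s \<in> I" for s
    unfolding E_def using meas[OF that] by measurable
  have "\<exists>s\<in>I. ennreal (m powr p) \<le> (\<integral>\<^sup>+\<omega>. ennreal (E s \<omega>) \<partial>M)"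
  proof (rule ccontr)
    assume "\<not> ?thesis"
    then have less: "(\<integral>\<^sup>+\<omega>. ennreal (E s \<omega>) \<partial>M) < ennreal (m powr p)" if "s \<in> I" for s
      using that by (auto simp: not_le)
    define r where "r s = enn2real (\<integral>\<^sup>+\<omega>. ennreal (E s \<omega>) \<partial>M)" for s
    have r: "(\<integral>\<^sup>+\<omega>. ennreal (E s \<omega>) \<partial>M) = ennreal (r s)" if "s \<in> I" for s
      using less[OF that] unfolding r_def by (subst ennreal_enn2real) (auto intro: less_trans)
    have r_less: "r s < m powr p" if "s \<in> I" for s
      using less[OF that] unfolding r[OF that] by (simp add: ennreal_less_iff r_def)
    have "ennreal (real (card I) * m powr p) = (\<integral>\<^sup>+\<omega>. ennreal (real (card I) * m powr p) \<partial>M)"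
      by (simp add: emeasure_space_1)
    also have "\<dots> \<le> (\<integral>\<^sup>+\<omega>. (\<Sum>s\<in>I. ennreal (E s \<omega>)) \<partial>M)"
      using ge by (intro nn_integral_mono) (simp add: E_def ennreal_leI)
    also have "\<dots> = (\<Sum>s\<in>I. \<integral>\<^sup>+\<omega>. ennreal (E s \<omega>) \<partial>M)"
      using E_meas by (intro nn_integral_sum) auto
    also have "\<dots> = (\<Sum>s\<in>I. ennreal (r s))" by (intro sum.cong refl r)
    also have "\<dots> = ennreal (\<Sum>s\<in>I. r s)" by (rule sum_ennreal) (simp add: r_def)
    finally have "real (card I) * m powr p \<le> (\<Sum>s\<in>I. r s)"
      by (subst (asm) ennreal_le_iff) (auto simp: r_def intro!: sum_nonneg)
    also have "\<dots> < (\<Sum>s\<in>I. m powr p)" using I r_less by (intro sum_strict_mono) auto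
    finally show False by simp
  qed
  then obtain s where s: "s \<in> I" "ennreal (m powr p) \<le> (\<integral>\<^sup>+\<omega>. ennreal (E s \<omega>) \<partial>M)" by auto
  let ?X = "\<lambda>\<omega>. SUP t\<in>{a..b}. ennreal (norm1 (ivp_solution a b (\<eta> s) (f s) t - out (\<eta>' s) (f' s) \<omega> t))"
  have "ennreal (E s \<omega>) \<le> ennreal_powr (?X \<omega>) p" for \<omega>
    unfolding E_def using ab p by (intro ennreal_powr_mono_ge SUP_upper) auto
  then have "ennreal (m powr p) \<le> (\<integral>\<^sup>+\<omega>. ennreal_powr (?X \<omega>) p \<partial>M)"
    using s(2) by (meson nn_integral_mono order_trans)
  then have "ennreal ((m powr p) powr (1 / p)) \<le> Lp_norm M p ?X"
    unfolding Lp_norm_def using p by (intro ennreal_powr_mono_ge) auto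
  also have "(m powr p) powr (1 / p) = m" using p m by (simp add: powr_powr)
  also have "Lp_norm M p ?X \<le> error_at M a b p out (\<eta> s) (f s) \<delta>"
    unfolding error_at_def by (rule SUP_upper2[OF noise[OF s(1)]]) simp
  also have "\<dots> \<le> worst_case_error M a b p out F \<delta>"
    unfolding worst_case_error_def by (rule SUP_upper2[OF F[OF s(1)]]) simp
  finally show ?thesis .
qed

lemma noisy_data_self:
  assumes "0 \<le> \<delta>" "norm1 (\<eta>' - \<eta>) \<le> \<delta>"
  shows "(\<eta>', f) \<in> noisy_data a b \<eta> f \<delta>"
  unfolding noisy_data_def ball1_def using assms by (auto intro!: exI[of _ "\<lambda>_. 0"])

subsection \<open>Dependence of an algorithm on the right-hand side\<close>

lemma info_vec_measurable:
  assumes "\<And>k. (\<lambda>\<omega>. u \<omega> k) \<in> borel_measurable M" "\<And>k. (\<lambda>\<omega>. v \<omega> k) \<in> borel_measurable M"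
  shows "(\<lambda>\<omega>. info_vec j (u \<omega>) (v \<omega>) e) \<in> M \<rightarrow>\<^sub>M vec_space (2 * j + 1)"
  unfolding info_vec_def
proof (rule measurable_restrict)
  fix k assume "k \<in> {..<2 * j + 1}"
  show "(\<lambda>\<omega>. if k < j then u \<omega> k else if k < 2 * j then v \<omega> (k - j) else e) \<in> borel_measurable M"
    using assms(1)[of k] assms(2)[of "k - j"] by (cases "k < j"; cases "k < 2 * j") auto
qed

lemma run_endpoint_measurable:
  fixes A :: "('w, 'd::finite) algorithm" and f :: "'d rhs"
  assumes A: "A \<in> algorithms M a b n" and ab: "a < b" and f: "f \<in> borel_measurable borel"
  shows "(\<lambda>\<omega>. run A \<eta> f \<omega> b) \<in> borel_measurable M"
proof -
  let ?nv = "\<lambda>j \<omega>. noisy_values A \<eta> f \<omega> j"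
  have nv: "j \<le> stages A \<Longrightarrow> (\<forall>k. (\<lambda>\<omega>. fst (?nv j \<omega>) k) \<in> borel_measurable M) \<and>
      (\<forall>k. (\<lambda>\<omega>. snd (?nv j \<omega>) k) \<in> borel_measurable M)" for j
  proof (induction j)
    case (Suc j)
    then have j: "j < stages A" by simp
    from A j have rt [measurable]: "random_time A j \<in> borel_measurable M"
      and py: "psi_y A j \<in> vec_space (2 * j + 1) \<rightarrow>\<^sub>M borel"
      and pz: "psi_z A j \<in> vec_space (2 * j + 1) \<Otimes>\<^sub>M borel \<Otimes>\<^sub>M borel \<rightarrow>\<^sub>M borel"
      by (auto simp: algorithms_def)
    define I where "I \<omega> = info_vec j (fst (?nv j \<omega>)) (snd (?nv j \<omega>)) \<eta>" for \<omega>
    define w where "w \<omega> = f (fixed_time A j, psi_y A j (I \<omega>))" for \<omega>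
    define z where "z \<omega> = psi_z A j (I \<omega>, w \<omega>, random_time A j \<omega>)" for \<omega>
    have I: "I \<in> M \<rightarrow>\<^sub>M vec_space (2 * j + 1)"
      unfolding I_def using Suc by (intro info_vec_measurable) auto
    have fc: "(\<lambda>\<omega>. f (t \<omega>, y \<omega>)) \<in> borel_measurable M"
      if "t \<in> borel_measurable M" "y \<in> borel_measurable M" for t y
      by (rule measurable_compose[OF _ f]) (intro borel_measurable_Pair that)
    have y: "(\<lambda>\<omega>. psi_y A j (I \<omega>)) \<in> borel_measurable M" by (rule measurable_compose[OF I py])
    have w: "w \<in> borel_measurable M" unfolding w_def by (intro fc y) simp
    have z: "z \<in> borel_measurable M" unfolding z_def
      by (rule measurable_compose[OF _ pz]) (intro measurable_Pair I w rt)
    have fz: "(\<lambda>\<omega>. f (random_time A j \<omega>, z \<omega>)) \<in> borel_measurable M" by (intro fc rt z)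
    have eq: "?nv (Suc j) \<omega> = ((fst (?nv j \<omega>))(j := w \<omega>),
        (snd (?nv j \<omega>))(j := f (random_time A j \<omega>, z \<omega>)))" for \<omega>
      by (simp add: Let_def case_prod_beta w_def z_def I_def)
    show ?case unfolding eq fst_conv snd_conv
    proof (intro conjI allI)
      fix k
      show "(\<lambda>\<omega>. ((fst (?nv j \<omega>))(j := w \<omega>)) k) \<in> borel_measurable M"
        using Suc w by (cases "k = j") auto
      show "(\<lambda>\<omega>. ((snd (?nv j \<omega>))(j := f (random_time A j \<omega>, z \<omega>))) k) \<in> borel_measurable M"
        using Suc fz by (cases "k = j") auto
    qed
  qed simp
  have phi: "phi A \<in> vec_space (2 * stages A + 1) \<rightarrow>\<^sub>M skorokhod_borel a b"
    using A by (simp add: algorithms_def)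
  have "(\<lambda>\<omega>. noisy_information A \<eta> f \<omega>) \<in> M \<rightarrow>\<^sub>M vec_space (2 * stages A + 1)"
    unfolding noisy_information_def case_prod_beta Let_def
    using nv by (intro info_vec_measurable) auto
  from measurable_compose[OF measurable_compose[OF this phi] eval_endpoint_measurable[OF ab]]
  show ?thesis by (simp add: run_def)
qed

text \<open>The sampling times of an algorithm do not depend on the values obtained. Two right-hand sides that
  agree at these times, for all arguments in space, therefore lead to the same output.\<close>

lemma run_cong:
  assumes "\<And>j x. j < stages A \<Longrightarrow> f (fixed_time A j, x) = f' (fixed_time A j, x)"
    and "\<And>j x. j < stages A \<Longrightarrow> f (random_time A j \<omega>, x) = f' (random_time A j \<omega>, x)"
  shows "run A \<eta> f \<omega> = run A \<eta> f' \<omega>"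
proof -
  have "j \<le> stages A \<Longrightarrow> noisy_values A \<eta> f \<omega> j = noisy_values A \<eta> f' \<omega> j" for j
    by (induction j) (auto simp: Let_def case_prod_beta assms)
  then show ?thesis by (simp add: run_def noisy_information_def)
qed

subsection \<open>The noise level is a lower bound\<close>

lemma constant_problem:
  fixes \<eta> :: "real ^ 'd"
  assumes par: "a < b" "0 < K" "0 < L" "0 < \<rho>" "\<rho> \<le> 1" and \<eta>: "norm1 \<eta> \<le> K"
  shows "(\<eta>, \<lambda>_. 0) \<in> F_class a b K L \<rho>" "ivp_solution a b \<eta> (\<lambda>_. 0) b = \<eta>"
proof -
  show F: "(\<eta>, \<lambda>_. 0) \<in> F_class a b K L \<rho>"
    using par \<eta> by (auto simp: F_class_def)
  interpret ivp a b K L \<rho> \<eta> "\<lambda>_. 0" by unfold_locales (use par F in auto)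
  show "ivp_solution a b \<eta> (\<lambda>_. 0) b = \<eta>"
    using solves_integral[OF solves_sol, of a b] solves_sol par by (simp add: solves_def)
qed

text \<open>The data \<open>(0, 0)\<close> are admissible for the zero problem with initial value \<open>0\<close> and with an initial value at
  distance \<open>\<delta>\<close>. One of the two errors is at least \<open>\<delta> / 2\<close>.\<close>

lemma noise_lower_bound:
  fixes A :: "('w, 'd::finite) algorithm"
  assumes par: "a < b" "0 < K" "0 < L" "0 < \<rho>" "\<rho> \<le> 1" "2 \<le> p" and \<delta>: "0 < \<delta>" "\<delta> \<le> K"
    and M: "prob_space M" and A: "A \<in> algorithms M a b n"
  shows "ennreal (\<delta> / 4) \<le> worst_case_error M a b p (run A) (F_class a b K L \<rho>) \<delta>"
proof -
  define k :: 'd where "k = undefined"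
  define \<eta> where "\<eta> s = (if s then axis k \<delta> else 0 :: real ^ 'd)" for s
  have \<eta>: "norm1 (\<eta> s) \<le> \<delta>" for s using \<delta> by (simp add: \<eta>_def)
  note const = constant_problem[OF par(1-5) order_trans[OF \<eta> \<delta>(2)]]
  show ?thesis
  proof (rule worst_case_error_ge[where I = UNIV and \<eta> = \<eta> and f = "\<lambda>_ _. 0"
        and \<eta>' = "\<lambda>_. 0" and f' = "\<lambda>_ _. 0", OF M par(1)])
    show "(0, \<lambda>_. 0) \<in> noisy_data a b (\<eta> s) (\<lambda>_. 0) \<delta>" for s
      using \<eta>[of s] \<delta> by (intro noisy_data_self) auto
    show "(\<lambda>\<omega>. run A 0 (\<lambda>_. 0) \<omega> b) \<in> borel_measurable M"
      by (intro run_endpoint_measurable[OF A par(1)]) simp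
    fix \<omega>
    define x where "x s = norm1 (\<eta> s - run A 0 (\<lambda>_. 0) \<omega> b)" for s
    have "\<delta> = norm1 (\<eta> True - \<eta> False)" using \<delta> by (simp add: \<eta>_def)
    also have "\<dots> \<le> x True + x False"
      unfolding x_def using norm1_triangle_mid by (metis norm1_minus_commute)
    finally have "\<delta> / 2 \<le> x True \<or> \<delta> / 2 \<le> x False" by linarith
    then have "(\<delta> / 2) powr p \<le> x True powr p \<or> (\<delta> / 2) powr p \<le> x False powr p"
      using par \<delta> by (auto intro!: powr_mono2)
    then have 1: "(\<delta> / 2) powr p \<le> x True powr p + x False powr p"
      by (smt (verit) powr_ge_zero)
    have "2 * (\<delta> / 4) powr p \<le> 2 powr p * (\<delta> / 4) powr p"
      using par powr_mono[of 1 p 2] by (intro mult_right_mono) auto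
    also have "\<dots> = (\<delta> / 2) powr p" using \<delta> by (simp add: powr_mult[symmetric])
    finally show "real (card (UNIV :: bool set)) * (\<delta> / 4) powr p
        \<le> (\<Sum>s\<in>UNIV. norm1 (ivp_solution a b (\<eta> s) (\<lambda>_. 0) b - run A 0 (\<lambda>_. 0) \<omega> b) powr p)"
      using 1 unfolding const(2) x_def[symmetric] by (simp add: UNIV_bool add.commute)
  qed (use par \<delta> const in auto)
qed

subsection \<open>Random signs\<close>

definition sign :: "'i set \<Rightarrow> 'i \<Rightarrow> real" where
  "sign s i = (if i \<in> s then 1 else - 1)"

definition flip :: "'i set \<Rightarrow> 'i set \<Rightarrow> 'i set" where
  "flip J s = (s - J) \<union> (J - s)"

lemma flip_bij: "J \<subseteq> S \<Longrightarrow> bij_betw (flip J) (Pow S) (Pow S)"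
  by (rule bij_betwI[of _ _ _ "flip J"]) (auto simp: flip_def)

lemma sign_flip: "sign (flip J s) i = (if i \<in> J then - sign s i else sign s i)"
  by (auto simp: sign_def flip_def)

text \<open>Reversing the signs in \<open>J\<close> preserves the uniform distribution on sign patterns.\<close>

lemma sum_flip: "J \<subseteq> S \<Longrightarrow> (\<Sum>s\<in>Pow S. h (flip J s)) = (\<Sum>s\<in>Pow S. h s)"
  by (rule sum.reindex_bij_betw[OF flip_bij])

lemma sign_correlation:
  assumes S: "finite S" and ij: "i \<in> S" "j \<in> S"
  shows "(\<Sum>s\<in>Pow S. sign s i * sign s j) = (if i = j then 2 ^ card S else 0)"
proof (cases "i = j")
  case True
  then have "(\<Sum>s\<in>Pow S. sign s i * sign s j) = (\<Sum>s\<in>Pow S. 1)"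
    by (intro sum.cong) (auto simp: sign_def)
  then show ?thesis using True S by (simp add: card_Pow)
next
  case False
  have "(\<Sum>s\<in>Pow S. sign s i * sign s j) = (\<Sum>s\<in>Pow S. sign (flip {i} s) i * sign (flip {i} s) j)"
    using ij by (intro sum_flip[symmetric]) auto
  also have "\<dots> = - (\<Sum>s\<in>Pow S. sign s i * sign s j)"
    using False by (simp add: sign_flip sum_negf)
  finally show ?thesis using False by simp
qed

lemma sign_second_moment:
  assumes S: "finite S" and J: "J \<subseteq> S"
  shows "(\<Sum>s\<in>Pow S. (\<Sum>i\<in>J. sign s i)\<^sup>2) = real (card J) * 2 ^ card S"
proof -
  have fJ: "finite J" using S J by (rule finite_subset[rotated])
  have "(\<Sum>s\<in>Pow S. (\<Sum>i\<in>J. sign s i)\<^sup>2) = (\<Sum>s\<in>Pow S. \<Sum>i\<in>J. \<Sum>j\<in>J. sign s i * sign s j)"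
    by (simp add: power2_eq_square sum_product)
  also have "\<dots> = (\<Sum>i\<in>J. \<Sum>s\<in>Pow S. \<Sum>j\<in>J. sign s i * sign s j)"
    by (rule sum.swap)
  also have "\<dots> = (\<Sum>i\<in>J. \<Sum>j\<in>J. \<Sum>s\<in>Pow S. sign s i * sign s j)"
    by (intro sum.cong refl sum.swap)
  also have "\<dots> = (\<Sum>i\<in>J. \<Sum>j\<in>J. if i = j then 2 ^ card S else 0)"
    using J by (intro sum.cong refl sign_correlation S) auto
  also have "\<dots> = real (card J) * 2 ^ card S" using fJ by simp
  finally show ?thesis .
qed

text \<open>An estimate that cannot see the signs in \<open>J\<close> is the same for \<open>s\<close> and \<open>flip J s\<close>, whereas the quantity to be
  estimated differs by \<open>2 c\<close> times the sum of the unseen signs. The parallelogram identity bounds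
  the sum of the two squared errors from below, and the unseen signs are uncorrelated.\<close>

lemma unseen_signs_error:
  fixes out :: "'i set \<Rightarrow> real"
  assumes S: "finite S" and J: "J \<subseteq> S"
    and blind: "\<And>s. s \<subseteq> S \<Longrightarrow> out (flip J s) = out s"
  shows "c\<^sup>2 * real (card J) * 2 ^ card S \<le> (\<Sum>s\<in>Pow S. (c * (\<Sum>i\<in>S. sign s i) - out s)\<^sup>2)"
proof -
  let ?e = "\<lambda>s. (c * (\<Sum>i\<in>S. sign s i) - out s)\<^sup>2"
  have key: "2 * (c\<^sup>2 * (\<Sum>i\<in>J. sign s i)\<^sup>2) \<le> ?e s + ?e (flip J s)" if s: "s \<in> Pow S" for s
  proof -
    define x where "x = c * (\<Sum>i\<in>S - J. sign s i) - out s"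
    define y where "y = c * (\<Sum>i\<in>J. sign s i)"
    have split: "(\<Sum>i\<in>S. sign t i) = (\<Sum>i\<in>S - J. sign t i) + (\<Sum>i\<in>J. sign t i)" for t
      using S J by (rule sum.subset_diff[rotated])
    have "(\<Sum>i\<in>S - J. sign (flip J s) i) = (\<Sum>i\<in>S - J. sign s i)"
      by (intro sum.cong) (auto simp: sign_flip)
    moreover have "(\<Sum>i\<in>J. sign (flip J s) i) = - (\<Sum>i\<in>J. sign s i)"
      by (simp add: sign_flip sum_negf)
    ultimately have "?e s = (x + y)\<^sup>2" "?e (flip J s) = (x - y)\<^sup>2"
      using blind[of s] s unfolding split[of s] split[of "flip J s"]
      by (auto simp: x_def y_def algebra_simps)
    moreover have "2 * y\<^sup>2 \<le> (x + y)\<^sup>2 + (x - y)\<^sup>2" by (simp add: power2_eq_square algebra_simps)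
    ultimately show ?thesis by (simp add: y_def power_mult_distrib)
  qed
  have "2 * (c\<^sup>2 * (real (card J) * 2 ^ card S)) = (\<Sum>s\<in>Pow S. 2 * (c\<^sup>2 * (\<Sum>i\<in>J. sign s i)\<^sup>2))"
    unfolding sign_second_moment[OF S J, symmetric] by (simp add: sum_distrib_left)
  also have "\<dots> \<le> (\<Sum>s\<in>Pow S. ?e s + ?e (flip J s))" by (intro sum_mono key)
  also have "\<dots> = 2 * (\<Sum>s\<in>Pow S. ?e s)"
    using sum_flip[OF J, of ?e] by (simp add: sum.distrib)
  finally show ?thesis by simp
qed

text \<open>A replacement of Jensen's inequality that loses a constant only: \<open>y\<^sup>p \<ge> y\<^sup>2 - 1\<close> for \<open>y \<ge> 0\<close> and
  \<open>p \<ge> 2\<close>, applied to \<open>y = e s / m\<close>.\<close>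

lemma powr_moment_ge_second_moment:
  fixes e :: "'s \<Rightarrow> real"
  assumes p: "2 \<le> p" and m: "0 < m" and e: "\<And>s. s \<in> P \<Longrightarrow> 0 \<le> e s"
    and ge: "real (card P) * (2 * m\<^sup>2) \<le> (\<Sum>s\<in>P. (e s)\<^sup>2)"
  shows "real (card P) * m powr p \<le> (\<Sum>s\<in>P. e s powr p)"
proof -
  have "m powr p * ((e s)\<^sup>2 / m\<^sup>2 - 1) \<le> e s powr p" if s: "s \<in> P" for s
  proof -
    define y where "y = e s / m"
    have y: "0 \<le> y" using e[OF s] m by (simp add: y_def)
    have "y\<^sup>2 - 1 \<le> y powr p"
    proof (cases "y \<le> 1")
      case True
      then have "y\<^sup>2 \<le> 1" using y by (simp add: power_le_one)
      then show ?thesis using powr_ge_zero[of y p] by linarith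
    next
      case False
      then have "y powr 2 \<le> y powr p" using p by (intro powr_mono) auto
      then show ?thesis using y False by simp
    qed
    then have "m powr p * (y\<^sup>2 - 1) \<le> m powr p * y powr p" by (intro mult_left_mono) auto
    also have "\<dots> = e s powr p"
      using m e[OF s] by (simp add: y_def powr_mult[symmetric])
    finally show ?thesis by (simp add: y_def power_divide)
  qed
  then have "(\<Sum>s\<in>P. m powr p * ((e s)\<^sup>2 / m\<^sup>2 - 1)) \<le> (\<Sum>s\<in>P. e s powr p)" by (rule sum_mono)
  also have "(\<Sum>s\<in>P. m powr p * ((e s)\<^sup>2 / m\<^sup>2 - 1)) = m powr p * ((\<Sum>s\<in>P. (e s)\<^sup>2) / m\<^sup>2 - real (card P))"
    by (simp add: sum_distrib_left[symmetric] sum_subtractf sum_divide_distrib)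
  finally have 1: "m powr p * ((\<Sum>s\<in>P. (e s)\<^sup>2) / m\<^sup>2 - real (card P)) \<le> (\<Sum>s\<in>P. e s powr p)" .
  have "real (card P) * 2 \<le> (\<Sum>s\<in>P. (e s)\<^sup>2) / m\<^sup>2"
    using ge m by (simp add: pos_le_divide_eq mult.assoc)
  then have "m powr p * real (card P) \<le> m powr p * ((\<Sum>s\<in>P. (e s)\<^sup>2) / m\<^sup>2 - real (card P))"
    by (intro mult_left_mono) auto
  then show ?thesis using 1 by (simp add: mult.commute)
qed

subsection \<open>A family of rough quadrature problems\<close>

text \<open>A parabolic bump with sign \<open>\<sigma> i\<close> on each unit interval \<open>[i, i + 1]\<close>. The bumps vanish at the integers
  and have slope at most one, which makes the function Lipschitz across cells for every choice of signs.\<close>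

definition bumps :: "(int \<Rightarrow> real) \<Rightarrow> real \<Rightarrow> real" where
  "bumps \<sigma> u = \<sigma> \<lfloor>u\<rfloor> * (frac u * (1 - frac u))"

lemma bumps_abs_le:
  assumes \<sigma>: "\<And>i. \<bar>\<sigma> i\<bar> \<le> 1"
  shows "\<bar>bumps \<sigma> u\<bar> \<le> frac u" "\<bar>bumps \<sigma> u\<bar> \<le> 1 - frac u" "\<bar>bumps \<sigma> u\<bar> \<le> 1 / 2"
proof -
  have f: "0 \<le> frac u" "frac u \<le> 1" using frac_lt_1[of u] by auto
  have "\<bar>bumps \<sigma> u\<bar> = \<bar>\<sigma> \<lfloor>u\<rfloor>\<bar> * (frac u * (1 - frac u))" using f by (simp add: bumps_def abs_mult)
  also have "\<dots> \<le> 1 * (frac u * (1 - frac u))" using \<sigma> f by (intro mult_right_mono) auto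
  finally have 1: "\<bar>bumps \<sigma> u\<bar> \<le> frac u * (1 - frac u)" by simp
  have "frac u * (1 - frac u) \<le> frac u * 1" "frac u * (1 - frac u) \<le> 1 * (1 - frac u)"
    using f by (intro mult_left_mono mult_right_mono; simp)+
  then show "\<bar>bumps \<sigma> u\<bar> \<le> frac u" "\<bar>bumps \<sigma> u\<bar> \<le> 1 - frac u" using 1 by auto
  then show "\<bar>bumps \<sigma> u\<bar> \<le> 1 / 2" by linarith
qed

lemma bumps_Lipschitz:
  assumes \<sigma>: "\<And>i. \<bar>\<sigma> i\<bar> \<le> 1"
  shows "\<bar>bumps \<sigma> u - bumps \<sigma> v\<bar> \<le> \<bar>u - v\<bar>"
proof -
  have le: "\<bar>bumps \<sigma> u - bumps \<sigma> v\<bar> \<le> v - u" if uv: "u \<le> v" for u v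
  proof (cases "\<lfloor>u\<rfloor> = \<lfloor>v\<rfloor>")
    case True
    define x y where "x = frac u" and "y = frac v"
    have xy: "0 \<le> x" "x \<le> 1" "0 \<le> y" "y \<le> 1" "y - x = v - u"
    proof -
      show "0 \<le> x" "x \<le> 1" "0 \<le> y" "y \<le> 1"
        using frac_lt_1[of u] frac_lt_1[of v] unfolding x_def y_def by (simp_all add: less_imp_le)
      show "y - x = v - u" using True by (simp add: x_def y_def frac_def)
    qed
    have "bumps \<sigma> u - bumps \<sigma> v = \<sigma> \<lfloor>v\<rfloor> * ((x - y) * (1 - x - y))"
      by (simp add: bumps_def True x_def y_def algebra_simps)
    then have "\<bar>bumps \<sigma> u - bumps \<sigma> v\<bar> = \<bar>\<sigma> \<lfloor>v\<rfloor>\<bar> * (\<bar>x - y\<bar> * \<bar>1 - x - y\<bar>)"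
      by (simp add: abs_mult)
    also have "\<dots> \<le> 1 * (\<bar>x - y\<bar> * 1)"
      using \<sigma> xy by (intro mult_mono) (auto simp: abs_le_iff)
    finally show ?thesis using xy uv by simp
  next
    case False
    then have "\<lfloor>u\<rfloor> + 1 \<le> \<lfloor>v\<rfloor>" using floor_mono[OF uv] by linarith
    then have "(1 - frac u) + frac v \<le> v - u" unfolding frac_def by linarith
    moreover have "\<bar>bumps \<sigma> u\<bar> \<le> 1 - frac u" "\<bar>bumps \<sigma> v\<bar> \<le> frac v"
      using bumps_abs_le[of \<sigma>, OF \<sigma>] by auto
    ultimately show ?thesis by linarith
  qed
  show ?thesis using le[of u v] le[of v u] by (cases "u \<le> v") auto
qed

text \<open>A function that is both bounded by \<open>1/2\<close> and Lipschitz with constant one is Hoelder for every exponent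
  up to one.\<close>

lemma bumps_Hoelder:
  assumes \<sigma>: "\<And>i. \<bar>\<sigma> i\<bar> \<le> 1" and \<rho>: "0 < \<rho>" "\<rho> \<le> 1"
  shows "\<bar>bumps \<sigma> u - bumps \<sigma> v\<bar> \<le> \<bar>u - v\<bar> powr \<rho>"
proof (cases "\<bar>u - v\<bar> \<le> 1")
  case True
  have "\<bar>u - v\<bar> \<le> \<bar>u - v\<bar> powr \<rho>"
  proof (cases "u = v")
    case False
    then have "\<bar>u - v\<bar> powr 1 \<le> \<bar>u - v\<bar> powr \<rho>" using True \<rho> by (intro powr_mono') auto
    then show ?thesis by simp
  qed simp
  then show ?thesis using bumps_Lipschitz[of \<sigma> u v, OF \<sigma>] by linarith
next
  case False
  then have "1 \<le> \<bar>u - v\<bar> powr \<rho>" using \<rho> by (intro ge_one_powr_ge_zero) auto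
  moreover have "\<bar>bumps \<sigma> u\<bar> \<le> 1 / 2" "\<bar>bumps \<sigma> v\<bar> \<le> 1 / 2" using bumps_abs_le(3)[of \<sigma>, OF \<sigma>] by auto
  ultimately show ?thesis by linarith
qed

lemma bumps_integral:
  assumes w: "0 < w"
  shows "((\<lambda>t. bumps \<sigma> ((t - a) / w)) has_integral w / 6 * (\<Sum>i<m. \<sigma> (int i))) {a..a + real m * w}"
proof (induction m)
  case 0
  show ?case using has_integral_refl(2)[of "\<lambda>t. bumps \<sigma> ((t - a) / w)" a] by simp
next
  case (Suc m)
  define c where "c = a + real m * w"
  let ?x = "\<lambda>t. (t - c) / w"
  have alg: "s * w * ((2 * X * (1 / w)) / 2 - (3 * X\<^sup>2 * (1 / w)) / 3) = s * (X * (1 - X))" for s X :: real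
  proof -
    have "s * w * ((2 * X * v) / 2 - (3 * X\<^sup>2 * v) / 3) = s * (w * v) * (X * (1 - X))" for v
      by (simp add: power2_eq_square algebra_simps)
    from this[of "1 / w"] show ?thesis using w by simp
  qed
  let ?\<Psi> = "\<lambda>t. \<sigma> (int m) * w * ((?x t)\<^sup>2 / 2 - (?x t) ^ 3 / 3)"
  have "((\<lambda>t. \<sigma> (int m) * (?x t * (1 - ?x t))) has_integral ?\<Psi> (c + w) - ?\<Psi> c) {c..c + w}"
  proof (rule fundamental_theorem_of_calculus)
    show "c \<le> c + w" using w by simp
    fix t
    have x': "(?x has_real_derivative 1 / w) (at t within {c..c + w})"
      using w by (auto intro!: derivative_eq_intros)
    have "(?\<Psi> has_real_derivative \<sigma> (int m) * w *
        ((real 2 * (1 / w * ?x t ^ (2 - Suc 0))) / 2 - (real 3 * (1 / w * ?x t ^ (3 - Suc 0))) / 3))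
        (at t within {c..c + w})"
      by (intro DERIV_cmult DERIV_diff DERIV_cdivide DERIV_power x')
    also have "\<sigma> (int m) * w *
        ((real 2 * (1 / w * ?x t ^ (2 - Suc 0))) / 2 - (real 3 * (1 / w * ?x t ^ (3 - Suc 0))) / 3)
        = \<sigma> (int m) * w * ((2 * ?x t * (1 / w)) / 2 - (3 * (?x t)\<^sup>2 * (1 / w)) / 3)"
      by (simp add: power2_eq_square)
    also have "\<sigma> (int m) * w * ((2 * ?x t * (1 / w)) / 2 - (3 * (?x t)\<^sup>2 * (1 / w)) / 3)
        = \<sigma> (int m) * (?x t * (1 - ?x t))"
      by (rule alg)
    finally show "(?\<Psi> has_vector_derivative \<sigma> (int m) * (?x t * (1 - ?x t))) (at t within {c..c + w})"
      by (simp add: has_real_derivative_iff_has_vector_derivative)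
  qed
  moreover have "?\<Psi> (c + w) - ?\<Psi> c = w / 6 * \<sigma> (int m)" using w by (simp add: field_simps)
  moreover have "\<sigma> (int m) * (?x t * (1 - ?x t)) = bumps \<sigma> ((t - a) / w)" if t: "t \<in> {c..c + w}" for t
  proof -
    have u: "(t - a) / w = real m + ?x t" using w by (simp add: c_def field_simps)
    have x: "0 \<le> ?x t" "?x t \<le> 1" using t w by auto
    show ?thesis
    proof (cases "?x t = 1")
      case True
      then have "frac ((t - a) / w) = 0" unfolding u by (simp add: frac_def)
      then show ?thesis using True by (simp add: bumps_def)
    next
      case False
      then have "?x t < 1" using x by linarith
      then have "\<lfloor>real m + ?x t\<rfloor> = int m" using x(1) by (intro floor_unique; simp only: of_int_of_nat_eq; linarith)
      then have "\<lfloor>(t - a) / w\<rfloor> = int m" by (simp only: u)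
      then show ?thesis unfolding bumps_def frac_def by (simp add: u)
    qed
  qed
  ultimately have "((\<lambda>t. bumps \<sigma> ((t - a) / w)) has_integral w / 6 * \<sigma> (int m)) {c..c + w}"
    by (metis (no_types, lifting) has_integral_eq)
  moreover have e: "c + w = a + real (Suc m) * w" by (simp add: c_def algebra_simps)
  ultimately have cell: "((\<lambda>t. bumps \<sigma> ((t - a) / w)) has_integral w / 6 * \<sigma> (int m)) {c..a + real (Suc m) * w}"
    by (simp only:)
  have "((\<lambda>t. bumps \<sigma> ((t - a) / w)) has_integral
      w / 6 * (\<Sum>i<m. \<sigma> (int i)) + w / 6 * \<sigma> (int m)) {a..a + real (Suc m) * w}"
  proof (rule has_integral_combine[OF _ _ Suc[folded c_def] cell])
    show "a \<le> c" using w by (simp add: c_def)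
    show "c \<le> a + real (Suc m) * w" using w e by linarith
  qed
  then show ?case by (simp add: distrib_left)
qed

text \<open>The first bound keeps the Hoelder constant below \<open>L\<close>; the second keeps the values below \<open>K\<close> for every
  cell width up to \<open>b - a\<close>.\<close>

definition amplitude :: "real \<Rightarrow> real \<Rightarrow> real \<Rightarrow> real \<Rightarrow> real \<Rightarrow> real" where
  "amplitude a b K L \<rho> = min L (K / (b - a) powr \<rho>)"

definition rough_rhs :: "real \<Rightarrow> real \<Rightarrow> real \<Rightarrow> (int \<Rightarrow> real) \<Rightarrow> 'd::finite rhs" where
  "rough_rhs a w c \<sigma> = (\<lambda>(t, x). (c * bumps \<sigma> ((t - a) / w)) *\<^sub>R axis undefined 1)"

lemma bumps_continuous:
  assumes \<sigma>: "\<And>i. \<bar>\<sigma> i\<bar> \<le> 1"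
  shows "continuous_on UNIV (bumps \<sigma>)"
proof (rule lipschitz_on_continuous_on)
  show "1-lipschitz_on UNIV (bumps \<sigma>)"
    using bumps_Lipschitz[of \<sigma>, OF \<sigma>] by (intro lipschitz_onI) (auto simp: dist_real_def)
qed

lemma rough_rhs_continuous:
  assumes \<sigma>: "\<And>i. \<bar>\<sigma> i\<bar> \<le> 1"
  shows "continuous_on UNIV (rough_rhs a w c \<sigma> :: 'd::finite rhs)"
proof -
  have "continuous_on UNIV (\<lambda>u :: real \<times> (real ^ 'd). bumps \<sigma> ((fst u - a) * inverse w))"
    by (rule continuous_on_compose2[OF bumps_continuous[of \<sigma>, OF \<sigma>]]) (auto intro!: continuous_intros)
  then show ?thesis
    unfolding rough_rhs_def case_prod_beta by (auto intro!: continuous_intros simp: divide_inverse)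
qed

lemma rough_problem:
  fixes \<sigma> :: "int \<Rightarrow> real"
  assumes par: "a < b" "0 < K" "0 < L" "0 < \<rho>" "\<rho> \<le> 1" and \<sigma>: "\<And>i. \<bar>\<sigma> i\<bar> \<le> 1" and m: "0 < m"
  defines "w \<equiv> (b - a) / real m"
  defines "f \<equiv> rough_rhs a w (amplitude a b K L \<rho> * w powr \<rho>) \<sigma> :: 'd::finite rhs"
  shows "(0, f) \<in> F_class a b K L \<rho>"
    and "ivp_solution a b 0 f b $ undefined
      = (amplitude a b K L \<rho> * w powr \<rho>) * (w / 6) * (\<Sum>i<m. \<sigma> (int i))"
proof -
  define \<kappa> where "\<kappa> = amplitude a b K L \<rho>"
  have w: "0 < w" "w \<le> b - a"
    using par m divide_left_mono[of 1 "real m" "b - a"] by (auto simp: w_def)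
  have \<kappa>: "0 < \<kappa>" "\<kappa> \<le> L" "\<kappa> \<le> K / (b - a) powr \<rho>" using par by (auto simp: \<kappa>_def amplitude_def)
  have \<kappa>w: "\<kappa> * w powr \<rho> \<le> K"
  proof -
    have "\<kappa> * w powr \<rho> \<le> K / (b - a) powr \<rho> * (b - a) powr \<rho>"
      using \<kappa> w par by (intro mult_mono powr_mono2) auto
    then show ?thesis using par by simp
  qed
  have f: "f (t, x) = (\<kappa> * w powr \<rho> * bumps \<sigma> ((t - a) / w)) *\<^sub>R axis undefined 1" for t x
    by (simp add: f_def rough_rhs_def \<kappa>_def)
  have le_K: "norm1 (f (t, x)) \<le> K" for t x
  proof -
    have "\<bar>bumps \<sigma> ((t - a) / w)\<bar> \<le> 1" using bumps_abs_le(3)[of \<sigma> "(t - a) / w", OF \<sigma>] by linarith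
    then have "(\<kappa> * w powr \<rho>) * \<bar>bumps \<sigma> ((t - a) / w)\<bar> \<le> K * 1"
      using \<kappa>w \<kappa> par by (intro mult_mono) auto
    then show ?thesis using \<kappa> by (simp add: f abs_mult)
  qed
  have Hoelder: "norm1 (f (t, x) - f (s, x)) \<le> L * \<bar>t - s\<bar> powr \<rho>" for t s x
  proof -
    have "norm1 (f (t, x) - f (s, x)) = \<kappa> * w powr \<rho> * \<bar>bumps \<sigma> ((t - a) / w) - bumps \<sigma> ((s - a) / w)\<bar>"
      using \<kappa> unfolding f scaleR_diff_left[symmetric] right_diff_distrib[symmetric] by (simp add: abs_mult)
    also have "\<dots> \<le> \<kappa> * w powr \<rho> * \<bar>(t - a) / w - (s - a) / w\<bar> powr \<rho>"
      using \<kappa> par by (intro mult_left_mono bumps_Hoelder \<sigma>) auto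
    also have "\<bar>(t - a) / w - (s - a) / w\<bar> = \<bar>t - s\<bar> / w"
      using w by (simp add: diff_divide_distrib[symmetric])
    also have "\<kappa> * w powr \<rho> * (\<bar>t - s\<bar> / w) powr \<rho> = \<kappa> * \<bar>t - s\<bar> powr \<rho>"
      using w by (simp add: powr_divide)
    also have "\<dots> \<le> L * \<bar>t - s\<bar> powr \<rho>" using \<kappa> by (intro mult_right_mono) auto
    finally show ?thesis .
  qed
  show F: "(0, f) \<in> F_class a b K L \<rho>"
    unfolding F_class_def
  proof (intro CollectI case_prodI conjI ballI allI)
    show "continuous_on ({a..b} \<times> UNIV) f"
      unfolding f_def by (rule continuous_on_subset[OF rough_rhs_continuous[of \<sigma>, OF \<sigma>]]) auto
    show "norm1 (f (t, x)) \<le> K * (1 + norm1 x)" for t x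
      using le_K[of t x] par by (simp add: distrib_left add_increasing2)
    show "norm1 (f (t, x) - f (t, y)) \<le> L * norm1 (x - y)" for t x y
      using par by (simp add: f)
  qed (use par Hoelder in auto)
  interpret ivp a b K L \<rho> 0 f by unfold_locales (use par F in auto)
  have "((\<lambda>t. bumps \<sigma> ((t - a) / w)) has_integral w / 6 * (\<Sum>i<m. \<sigma> (int i))) {a..b}"
    using bumps_integral[OF w(1), of \<sigma> a m] m by (simp add: w_def)
  then have "((\<lambda>t. f (t, sol t)) has_integral (\<kappa> * w powr \<rho> * (w / 6 * (\<Sum>i<m. \<sigma> (int i)))) *\<^sub>R axis undefined 1) {a..b}"
    unfolding f by (intro has_integral_scaleR_left has_integral_mult_right)
  then have "sol b = (\<kappa> * w powr \<rho> * (w / 6 * (\<Sum>i<m. \<sigma> (int i)))) *\<^sub>R axis undefined 1"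
    using solves_integral[OF solves_sol, of a b] solves_sol par
    by (simp add: solves_def integral_unique)
  then show "ivp_solution a b 0 f b $ undefined
      = (amplitude a b K L \<rho> * w powr \<rho>) * (w / 6) * (\<Sum>i<m. \<sigma> (int i))"
    by (simp add: \<kappa>_def axis_def)
qed

text \<open>With \<open>2 n\<close> cells at least \<open>n\<close> of them contain no sampling time, whatever the elementary event.\<close>

lemma sampling_lower_bound:
  fixes A :: "('w, 'd::finite) algorithm"
  assumes par: "a < b" "0 < K" "0 < L" "0 < \<rho>" "\<rho> \<le> 1" "2 \<le> p" and \<delta>: "0 \<le> \<delta>" and n: "0 < n"
    and M: "prob_space M" and A: "A \<in> algorithms M a b n"
  shows "ennreal (amplitude a b K L \<rho> / 6 * ((b - a) / 2) powr (1 + \<rho>) / sqrt 2 * real n powr (- (\<rho> + 1 / 2)))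
    \<le> worst_case_error M a b p (run A) (F_class a b K L \<rho>) \<delta>"
proof -
  define w where "w = (b - a) / real (2 * n)"
  define c where "c = amplitude a b K L \<rho> * w powr \<rho>"
  define m where "m = c * (w / 6) * sqrt (real n / 2)"
  define S where "S = {0..<int (2 * n)}"
  define f where "f s = (rough_rhs a w c (sign s) :: 'd rhs)" for s
  have w: "0 < w" using par n by (simp add: w_def)
  have c: "0 < c" using par w by (simp add: c_def amplitude_def)
  have m: "0 < m" using c w n by (simp add: m_def)
  have sg: "\<bar>sign s i\<bar> \<le> 1" for s :: "int set" and i by (simp add: sign_def)
  note problem = rough_problem[OF par(1-5), where m = "2 * n" and \<sigma> = "sign s" for s, OF sg]
  have F: "(0, f s) \<in> F_class a b K L \<rho>" for s
    using problem(1)[of s] n by (simp add: f_def w_def c_def)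
  have S_sum: "(\<Sum>i\<in>S. sign s i) = (\<Sum>i<2 * n. sign s (int i))" for s
    unfolding S_def by (subst sum.reindex_bij_betw[symmetric, where h = int and S = "{..<2 * n}"])
      (auto simp: bij_betw_def image_int_atLeastLessThan[of 0, simplified] lessThan_atLeast0)
  have sol: "ivp_solution a b 0 (f s) b $ undefined = c * (w / 6) * (\<Sum>i\<in>S. sign s i)" for s
    using problem(2)[of s] n unfolding S_sum by (simp add: f_def w_def c_def)
  have st: "2 * stages A \<le> n" using A by (simp add: algorithms_def)
  have "ennreal m \<le> worst_case_error M a b p (run A) (F_class a b K L \<rho>) \<delta>"
  proof (rule worst_case_error_ge[where I = "Pow S" and \<eta> = "\<lambda>_. 0" and f = f
        and \<eta>' = "\<lambda>_. 0" and f' = f, OF M par(1)])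
    show "(0, f s) \<in> noisy_data a b 0 (f s) \<delta>" for s using \<delta> by (intro noisy_data_self) auto
    show "(\<lambda>\<omega>. run A 0 (f s) \<omega> b) \<in> borel_measurable M" for s
      unfolding f_def
      by (intro run_endpoint_measurable[OF A par(1)] borel_measurable_continuous_onI rough_rhs_continuous sg)
    fix \<omega>
    define cell where "cell t = \<lfloor>(t - a) / w\<rfloor>" for t
    define seen where "seen = cell ` fixed_time A ` {..<stages A} \<union> cell ` (\<lambda>j. random_time A j \<omega>) ` {..<stages A}"
    define J where "J = S - seen"
    have "card seen \<le> card (cell ` fixed_time A ` {..<stages A}) + card (cell ` (\<lambda>j. random_time A j \<omega>) ` {..<stages A})"
      unfolding seen_def by (rule card_Un_le)
    also have "\<dots> \<le> stages A + stages A"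
      unfolding image_image by (intro add_mono order_trans[OF card_image_le]) auto
    finally have "card seen \<le> n" using st by simp
    moreover have "card S - card seen \<le> card J"
      unfolding J_def by (rule diff_card_le_card_Diff) (simp add: seen_def)
    ultimately have cJ: "n \<le> card J" by (simp add: S_def)
    have fin: "finite S" "J \<subseteq> S" by (auto simp: S_def J_def)
    have same: "f (flip J s) (t, x) = f s (t, x)" if "cell t \<in> seen" for s t x
    proof -
      have "sign (flip J s) (cell t) = sign s (cell t)"
        using that by (simp add: sign_flip J_def)
      then show ?thesis by (simp add: f_def rough_rhs_def bumps_def cell_def)
    qed
    have blind: "run A 0 (f (flip J s)) \<omega> b $ undefined = run A 0 (f s) \<omega> b $ undefined" for s
    proof -
      have "run A 0 (f (flip J s)) \<omega> = run A 0 (f s) \<omega>"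
        by (intro run_cong same) (auto simp: seen_def)
      then show ?thesis by simp
    qed
    define e where "e s = \<bar>c * (w / 6) * (\<Sum>i\<in>S. sign s i) - run A 0 (f s) \<omega> b $ undefined\<bar>" for s
    have "(sqrt (real n / 2))\<^sup>2 = real n / 2" by simp
    then have "2 * m\<^sup>2 = (c * (w / 6))\<^sup>2 * real n"
      unfolding m_def power_mult_distrib[of "c * (w / 6)"] by simp
    then have "real (card (Pow S)) * (2 * m\<^sup>2) = (c * (w / 6))\<^sup>2 * real n * 2 ^ card S"
      using fin by (simp add: card_Pow)
    also have "\<dots> \<le> (c * (w / 6))\<^sup>2 * real (card J) * 2 ^ card S"
      using cJ by (intro mult_right_mono mult_left_mono) auto
    also have "\<dots> \<le> (\<Sum>s\<in>Pow S. (e s)\<^sup>2)"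
      using unseen_signs_error[OF fin, of "\<lambda>s. run A 0 (f s) \<omega> b $ undefined" "c * (w / 6)"] blind
      by (simp add: e_def)
    finally have "real (card (Pow S)) * m powr p \<le> (\<Sum>s\<in>Pow S. e s powr p)"
      by (intro powr_moment_ge_second_moment par m) (auto simp: e_def)
    also have "\<dots> \<le> (\<Sum>s\<in>Pow S. norm1 (ivp_solution a b 0 (f s) b - run A 0 (f s) \<omega> b) powr p)"
    proof (intro sum_mono powr_mono2)
      fix s
      show "e s \<le> norm1 (ivp_solution a b 0 (f s) b - run A 0 (f s) \<omega> b)"
        using component_le_norm1[of "ivp_solution a b 0 (f s) b - run A 0 (f s) \<omega> b" undefined]
        by (simp add: e_def sol)
    qed (use par in \<open>auto simp: e_def\<close>)
    finally show "real (card (Pow S)) * m powr p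
      \<le> (\<Sum>s\<in>Pow S. norm1 (ivp_solution a b 0 (f s) b - run A 0 (f s) \<omega> b) powr p)" .
  qed (use par m F in \<open>auto simp: S_def\<close>)
  also have "m = amplitude a b K L \<rho> / 6 * ((b - a) / 2) powr (1 + \<rho>) / sqrt 2 * real n powr (- (\<rho> + 1 / 2))"
  proof -
    have n0: "0 < real n" using n by simp
    have "w powr \<rho> * w = w powr (1 + \<rho>)" using w by (simp add: powr_add)
    also have "\<dots> = ((b - a) / 2 / real n) powr (1 + \<rho>)" by (simp add: w_def)
    also have "\<dots> = ((b - a) / 2) powr (1 + \<rho>) * real n powr (- (1 + \<rho>))"
      using par n0 unfolding powr_minus_divide by (subst powr_divide) auto
    finally have ww: "w powr \<rho> * w = ((b - a) / 2) powr (1 + \<rho>) * real n powr (- (1 + \<rho>))" .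
    have "w powr \<rho> * w * sqrt (real n) = ((b - a) / 2) powr (1 + \<rho>) * (real n powr (- (1 + \<rho>)) * real n powr (1 / 2))"
      unfolding ww using n0 by (simp only: powr_half_sqrt mult.assoc of_nat_0_le_iff)
    also have "real n powr (- (1 + \<rho>)) * real n powr (1 / 2) = real n powr (- (\<rho> + 1 / 2))"
    proof -
      have "- (1 + \<rho>) + 1 / 2 = - (\<rho> + 1 / 2)" by simp
      then show ?thesis by (simp only: powr_add[symmetric])
    qed
    finally have "w powr \<rho> * w * sqrt (real n) = ((b - a) / 2) powr (1 + \<rho>) * real n powr (- (\<rho> + 1 / 2))" .
    moreover have "m = amplitude a b K L \<rho> / 6 * (w powr \<rho> * w * sqrt (real n)) / sqrt 2"
      by (simp add: m_def c_def real_sqrt_divide)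
    ultimately show ?thesis by simp
  qed
  finally show ?thesis .
qed

section \<open>Optimality of the randomized Runge-Kutta method\<close>

text \<open>The method and the algorithm that realizes it differ where a uniform variable leaves \<open>[0,1]\<close>; such
  null sets do not affect the error.\<close>

lemma worst_case_error_AE_cong:
  assumes "\<And>\<eta>' f'. AE \<omega> in M. \<forall>t\<in>{a..b}. out \<eta>' f' \<omega> t = out' \<eta>' f' \<omega> t"
  shows "worst_case_error M a b p out F \<delta> = worst_case_error M a b p out' F \<delta>"
proof -
  have "Lp_norm M p (\<lambda>\<omega>. SUP t\<in>{a..b}. ennreal (norm1 (z t - out \<eta>' f' \<omega> t)))
      = Lp_norm M p (\<lambda>\<omega>. SUP t\<in>{a..b}. ennreal (norm1 (z t - out' \<eta>' f' \<omega> t)))" for \<eta>' f' z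
  proof -
    have "AE \<omega> in M. ennreal_powr (SUP t\<in>{a..b}. ennreal (norm1 (z t - out \<eta>' f' \<omega> t))) p
        = ennreal_powr (SUP t\<in>{a..b}. ennreal (norm1 (z t - out' \<eta>' f' \<omega> t))) p"
    proof (rule AE_mp[OF assms[of \<eta>' f']], intro AE_I2 impI)
      fix \<omega> assume "\<forall>t\<in>{a..b}. out \<eta>' f' \<omega> t = out' \<eta>' f' \<omega> t"
      then have "(SUP t\<in>{a..b}. ennreal (norm1 (z t - out \<eta>' f' \<omega> t)))
          = (SUP t\<in>{a..b}. ennreal (norm1 (z t - out' \<eta>' f' \<omega> t)))"
        by (intro SUP_cong) auto
      then show "ennreal_powr (SUP t\<in>{a..b}. ennreal (norm1 (z t - out \<eta>' f' \<omega> t))) p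
        = ennreal_powr (SUP t\<in>{a..b}. ennreal (norm1 (z t - out' \<eta>' f' \<omega> t))) p" by simp
    qed
    from nn_integral_cong_AE[OF this] show ?thesis by (simp add: Lp_norm_def)
  qed
  then show ?thesis unfolding worst_case_error_def error_at_def by simp
qed

theorem theorem2:
  fixes a b K L \<rho> p :: real
  assumes "a < b" and "0 < K" and "0 < L" and "0 < \<rho>" and "\<rho> \<le> 1" and "2 \<le> p"
  shows
    "uniform_Theta (random_sources :: ('w measure \<times> (nat \<Rightarrow> 'w \<Rightarrow> real)) set)
       (\<lambda>(M, \<tau>) n \<delta>. minimal_error M a b p
          (F_class a b K L \<rho> :: ((real ^ 'd) \<times> 'd rhs) set) n \<delta>)
       (\<lambda>n \<delta>. max (real n powr (- (\<rho> + 1 / 2))) \<delta>)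
     \<and> uniform_Theta (random_sources :: ('w measure \<times> (nat \<Rightarrow> 'w \<Rightarrow> real)) set)
       (\<lambda>(M, \<tau>) n \<delta>. worst_case_error M a b p (rk_output \<tau> a b (n div 2))
          (F_class a b K L \<rho> :: ((real ^ 'd) \<times> 'd rhs) set) \<delta>)
       (\<lambda>n \<delta>. max (real n powr (- (\<rho> + 1 / 2))) \<delta>)
     \<and> (\<forall>(M, \<tau>) \<in> (random_sources :: ('w measure \<times> (nat \<Rightarrow> 'w \<Rightarrow> real)) set). \<forall>n\<ge>2.
          \<exists>A \<in> algorithms M a b n. \<forall>(\<eta>' :: real ^ 'd) f'.
            AE \<omega> in M. \<forall>t\<in>{a..b}. run A \<eta>' f' \<omega> t = rk_output \<tau> a b (n div 2) \<eta>' f' \<omega> t)"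
proof -
  let ?F = "F_class a b K L \<rho> :: ((real ^ 'd) \<times> 'd rhs) set"
  let ?S = "random_sources :: ('w measure \<times> (nat \<Rightarrow> 'w \<Rightarrow> real)) set"
  let ?m = "\<lambda>n \<delta>. max (real n powr (- (\<rho> + 1 / 2))) \<delta>"
  define c1 where "c1 = amplitude a b K L \<rho> / 6 * ((b - a) / 2) powr (1 + \<rho>) / sqrt 2"
  define cl where "cl = min c1 (1 / 4)"
  define \<delta>0 where "\<delta>0 = min 1 K"
  have "0 < c1" using assms by (simp add: c1_def amplitude_def)
  then have cl: "0 < cl" by (simp add: cl_def)
  have \<delta>0: "\<delta>0 \<in> {0<..1}" using assms by (simp add: \<delta>0_def)
  obtain cu where cu: "0 < cu"
    and upper: "\<And>M \<tau> n \<delta>. (M, \<tau>) \<in> ?S \<Longrightarrow> 2 \<le> n \<Longrightarrow> \<delta> \<in> {0<..1} \<Longrightarrow>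
      worst_case_error M a b p (rk_output \<tau> a b (n div 2)) ?F \<delta> \<le> ennreal (cu * ?m n \<delta>)"
    using rk_upper_bound[OF assms, where 'w = 'w and 'd = 'd] by fastforce
  have alg: "rk_algorithm \<tau> a b (n div 2) \<in> (algorithms M a b n :: ('w, 'd) algorithm set)"
    and run: "AE \<omega> in M. \<forall>t\<in>{a..b}.
      run (rk_algorithm \<tau> a b (n div 2)) \<eta>' f' \<omega> t = rk_output \<tau> a b (n div 2) \<eta>' f' \<omega> t"
    if "(M, \<tau>) \<in> ?S" "2 \<le> n" for M \<tau> n and \<eta>' :: "real ^ 'd" and f'
  proof -
    interpret random_source M \<tau>
      using that by (auto simp: random_source_def random_source_axioms_def random_sources_def)
    show "rk_algorithm \<tau> a b (n div 2) \<in> (algorithms M a b n :: ('w, 'd) algorithm set)"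
      using that assms by (intro rk_algorithm_in_class) auto
    show "AE \<omega> in M. \<forall>t\<in>{a..b}.
      run (rk_algorithm \<tau> a b (n div 2)) \<eta>' f' \<omega> t = rk_output \<tau> a b (n div 2) \<eta>' f' \<omega> t"
      using that assms by (intro AE_run_rk_algorithm) auto
  qed
  have lower: "ennreal (cl * ?m n \<delta>) \<le> minimal_error M a b p ?F n \<delta>"
    if "(M, \<tau>) \<in> ?S" "2 \<le> n" "\<delta> \<in> {0<..\<delta>0}" for M \<tau> n \<delta>
    unfolding minimal_error_def
  proof (rule INF_greatest)
    fix A :: "('w, 'd) algorithm" assume A: "A \<in> algorithms M a b n"
    have M: "prob_space M" using that by (simp add: random_sources_def)
    have \<delta>: "0 < \<delta>" "\<delta> \<le> K" using that by (auto simp: \<delta>0_def)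
    show "ennreal (cl * ?m n \<delta>) \<le> worst_case_error M a b p (run A) ?F \<delta>"
    proof (cases "\<delta> \<le> real n powr (- (\<rho> + 1 / 2))")
      case True
      then have "ennreal (cl * ?m n \<delta>) \<le> ennreal (c1 * real n powr (- (\<rho> + 1 / 2)))"
        by (intro ennreal_leI) (simp add: cl_def max_def mult_right_mono)
      also have "\<dots> \<le> worst_case_error M a b p (run A) ?F \<delta>"
        unfolding c1_def using that \<delta> by (intro sampling_lower_bound[OF assms _ _ M A]) auto
      finally show ?thesis .
    next
      case False
      then have "ennreal (cl * ?m n \<delta>) \<le> ennreal (\<delta> / 4)"
        using \<delta> mult_right_mono[of cl "1 / 4" \<delta>] by (intro ennreal_leI) (simp add: cl_def max_def)
      also have "\<dots> \<le> worst_case_error M a b p (run A) ?F \<delta>"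
        by (rule noise_lower_bound[OF assms \<delta> M A])
      finally show ?thesis .
    qed
  qed
  have minimal: "minimal_error M a b p ?F n \<delta>
      \<le> worst_case_error M a b p (rk_output \<tau> a b (n div 2)) ?F \<delta>"
    if "(M, \<tau>) \<in> ?S" "2 \<le> n" for M \<tau> n \<delta>
  proof -
    have "minimal_error M a b p ?F n \<delta>
        \<le> worst_case_error M a b p (run (rk_algorithm \<tau> a b (n div 2))) ?F \<delta>"
      unfolding minimal_error_def by (rule INF_lower) (rule alg[OF that])
    also have "\<dots> = worst_case_error M a b p (rk_output \<tau> a b (n div 2)) ?F \<delta>"
      by (rule worst_case_error_AE_cong) (rule run[OF that])
    finally show ?thesis .
  qed
  have unit: "\<delta> \<in> {0<..1}" if "\<delta> \<in> {0<..\<delta>0}" for \<delta> using that by (auto simp: \<delta>0_def)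
  have Theta: "uniform_Theta ?S g ?m"
    if "\<And>M \<tau> n \<delta>. (M, \<tau>) \<in> ?S \<Longrightarrow> 2 \<le> n \<Longrightarrow> \<delta> \<in> {0<..\<delta>0} \<Longrightarrow>
      minimal_error M a b p ?F n \<delta> \<le> g (M, \<tau>) n \<delta> \<and>
      g (M, \<tau>) n \<delta> \<le> worst_case_error M a b p (rk_output \<tau> a b (n div 2)) ?F \<delta>" for g
    unfolding uniform_Theta_def
  proof (rule exI[of _ cl], intro conjI cl exI[of _ cu] cu exI[of _ 2] bexI[OF _ \<delta>0] ballI allI impI)
    fix s n \<delta> assume s: "s \<in> ?S" "(2 :: nat) \<le> n" "\<delta> \<in> {0<..\<delta>0}"
    obtain M \<tau> where "s = (M, \<tau>)" by force
    then show "ennreal (cl * ?m n \<delta>) \<le> g s n \<delta>" "g s n \<delta> \<le> ennreal (cu * ?m n \<delta>)"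
      using lower[of M \<tau> n \<delta>] upper[of M \<tau> n \<delta>] that[of M \<tau> n \<delta>] s unit[of \<delta>]
      by (auto intro: order_trans)
  qed
  show ?thesis
  proof (intro conjI ballI)
    show "uniform_Theta ?S (\<lambda>(M, \<tau>) n \<delta>. minimal_error M a b p ?F n \<delta>) ?m"
      by (rule Theta) (simp add: minimal)
    show "uniform_Theta ?S (\<lambda>(M, \<tau>) n \<delta>.
        worst_case_error M a b p (rk_output \<tau> a b (n div 2)) ?F \<delta>) ?m"
      by (rule Theta) (simp add: minimal)
    fix s :: "'w measure \<times> (nat \<Rightarrow> 'w \<Rightarrow> real)" assume s: "s \<in> ?S"
    obtain M \<tau> where M: "s = (M, \<tau>)" by force
    show "case s of (M, \<tau>) \<Rightarrow> \<forall>n\<ge>2. \<exists>A \<in> algorithms M a b n. \<forall>(\<eta>' :: real ^ 'd) f'.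
        AE \<omega> in M. \<forall>t\<in>{a..b}. run A \<eta>' f' \<omega> t = rk_output \<tau> a b (n div 2) \<eta>' f' \<omega> t"
      unfolding M prod.case
    proof (intro allI impI)
      fix n :: nat assume n: "2 \<le> n"
      show "\<exists>A \<in> algorithms M a b n. \<forall>(\<eta>' :: real ^ 'd) f'.
        AE \<omega> in M. \<forall>t\<in>{a..b}. run A \<eta>' f' \<omega> t = rk_output \<tau> a b (n div 2) \<eta>' f' \<omega> t"
        by (rule bexI[OF _ alg[OF s[unfolded M] n]]) (intro allI run[OF s[unfolded M] n])
    qed
  qed
qed

end
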